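(* Each of the functions $C\mapsto\mathrm{mft}_{\text{2REG}}(C)$ (on configurations of 2REG), $C\mapsto\mathrm{mft}_{\text{g-2PATH}}(C)$ (on configurations of g-2PATH) and $C\mapsto\mathrm{mft}_{\text{2PATH}}(C)$ (on configurations of 2PATH) is computable by a deterministic Turing machine using space polynomial in the length of a standard encoding of the input configuration.
   Context: Positions are elements of $\mathbb{Z}^2$; with $\epsilon_0=(1,0),\epsilon_1=(0,1),\epsilon_2=(-1,0),\epsilon_3=(0,-1)$, positions $p,p'$ are adjacent if $p'-p$ is some $\epsilon_i$; a path is a sequence of positions with consecutive positions adjacent. A configuration of 2REG is a finite set $C\subseteq\mathbb{Z}^2$ containing $(0,0)$ (the general) in which any two positions are joined by a path inside $C$. A configuration of g-2PATH is a configuration of 2REG which is a path $p_r\dots p_s$ ($r\le0\le s$, $p_0=(0,0)$) with all positions distinct and $p_l,p_m$ not adjacent whenever $|l-m|\ge2$. A configuration of 2PATH is a configuration of g-2PATH one of whose two end positions is $(0,0)$. Configurations are encoded by listing the coordinates of their positions. For $p\in C$, $\mathrm{bc}_C(p)=(b_0,\dots,b_3)$ with $b_i=1$ iff $p+\epsilon_i\in C$. Firing squad model (boundary-sensitive): a finite automaton $A$ has a finite state set with quiescent state $\mathrm{Q}$, general states $\mathrm{G}_0,\dots,\mathrm{G}_{m-1}$, firing states $\mathcal F\not\ni\mathrm{Q}$, a map $\tau:\{0,1\}^4\to\{0,\dots,m-1\}$ and a transition function from the current state and the four neighbour states ($\#$ where no node), with $\mathrm{Q}$ stable when all inputs are in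 $\{\mathrm{Q},\#\}$. On a configuration $C$, at time $0$ node $(0,0)$ is in $\mathrm{G}_{\tau(\mathrm{bc}_C((0,0)))}$, others in $\mathrm{Q}$, synchronous updates. For $\Gamma\in\{$2REG, g-2PATH, 2PATH$\}$, $A$ is a solution of $\Gamma$ if for every configuration $C$ of $\Gamma$ there is $t_C$ with no node in $\mathcal F$ before $t_C$ and all nodes in $\mathcal F$ at $t_C=:\mathrm{ft}(C,A)$. Solutions exist, and $\mathrm{mft}_\Gamma(C)=\min_A\mathrm{ft}(C,A)$ over all solutions $A$ of $\Gamma$. *)

theory Defs
  imports Main
begin

type_synonym pos = "int \<times> int"

definition eps :: "nat \<Rightarrow> pos" where
  "eps i = (if i = 0 then (1,0) else if i = 1 then (0,1) else if i = 2 then (-1,0) else (0,-1))"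

definition shift :: "pos \<Rightarrow> nat \<Rightarrow> pos" where
  "shift p i = (fst p + fst (eps i), snd p + snd (eps i))"

definition adjacent :: "pos \<Rightarrow> pos \<Rightarrow> bool" where
  "adjacent p p' \<longleftrightarrow> (\<exists>i<4. p' = shift p i)"

definition is_path :: "pos list \<Rightarrow> bool" where
  "is_path ps \<longleftrightarrow> ps \<noteq> [] \<and> (\<forall>i. Suc i < length ps \<longrightarrow> adjacent (ps ! i) (ps ! Suc i))"

definition configs_2REG :: "pos set set" where
  "configs_2REG = {C. finite C \<and> (0,0) \<in> C \<and>
     (\<forall>p\<in>C. \<forall>q\<in>C. \<exists>ps. is_path ps \<and> set ps \<subseteq> C \<and> hd ps = p \<and> last ps = q)}"

definition is_g2path_list :: "pos list \<Rightarrow> bool" where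
  "is_g2path_list ps \<longleftrightarrow> is_path ps \<and> distinct ps \<and> (0,0) \<in> set ps \<and>
     (\<forall>l<length ps. \<forall>m<length ps. (l + 2 \<le> m \<or> m + 2 \<le> l) \<longrightarrow> \<not> adjacent (ps ! l) (ps ! m))"

definition configs_g2PATH :: "pos set set" where
  "configs_g2PATH = {C. C \<in> configs_2REG \<and> (\<exists>ps. is_g2path_list ps \<and> set ps = C)}"

definition configs_2PATH :: "pos set set" where
  "configs_2PATH = {C. C \<in> configs_2REG \<and>
     (\<exists>ps. is_g2path_list ps \<and> set ps = C \<and> (hd ps = (0,0) \<or> last ps = (0,0)))}"

definition bc :: "pos set \<Rightarrow> pos \<Rightarrow> bool \<times> bool \<times> bool \<times> bool" where
  "bc C p = (shift p 0 \<in> C, shift p 1 \<in> C, shift p 2 \<in> C, shift p 3 \<in> C)"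

text \<open>Neighbour inputs are given in the order eps_0, eps_1, eps_2, eps_3; None stands for #.\<close>
record fsa =
  fs_states :: "nat set"
  fs_Q :: nat
  fs_m :: nat
  fs_G :: "nat \<Rightarrow> nat"
  fs_F :: "nat set"
  fs_tau :: "bool \<times> bool \<times> bool \<times> bool \<Rightarrow> nat"
  fs_delta :: "nat \<Rightarrow> nat option \<Rightarrow> nat option \<Rightarrow> nat option \<Rightarrow> nat option \<Rightarrow> nat"

definition fsa_wf :: "fsa \<Rightarrow> bool" where
  "fsa_wf A \<longleftrightarrow>
     finite (fs_states A) \<and> fs_Q A \<in> fs_states A \<and>
     (\<forall>i<fs_m A. fs_G A i \<in> fs_states A) \<and>
     fs_F A \<subseteq> fs_states A \<and> fs_Q A \<notin> fs_F A \<and>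
     (\<forall>b. fs_tau A b < fs_m A) \<and>
     (\<forall>s\<in>fs_states A. \<forall>a0 a1 a2 a3.
        (\<forall>a\<in>{a0,a1,a2,a3}. a = None \<or> the a \<in> fs_states A) \<longrightarrow>
        fs_delta A s a0 a1 a2 a3 \<in> fs_states A) \<and>
     (\<forall>a0 a1 a2 a3. (\<forall>a\<in>{a0,a1,a2,a3}. a = None \<or> a = Some (fs_Q A)) \<longrightarrow>
        fs_delta A (fs_Q A) a0 a1 a2 a3 = fs_Q A)"

definition nbr :: "pos set \<Rightarrow> (pos \<Rightarrow> nat) \<Rightarrow> pos \<Rightarrow> nat \<Rightarrow> nat option" where
  "nbr C st p i = (if shift p i \<in> C then Some (st (shift p i)) else None)"

primrec fs_run :: "fsa \<Rightarrow> pos set \<Rightarrow> nat \<Rightarrow> pos \<Rightarrow> nat" where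
  "fs_run A C 0 p = (if p = (0,0) then fs_G A (fs_tau A (bc C (0,0))) else fs_Q A)"
| "fs_run A C (Suc t) p = fs_delta A (fs_run A C t p)
      (nbr C (fs_run A C t) p 0) (nbr C (fs_run A C t) p 1)
      (nbr C (fs_run A C t) p 2) (nbr C (fs_run A C t) p 3)"

definition fires_at :: "fsa \<Rightarrow> pos set \<Rightarrow> nat \<Rightarrow> bool" where
  "fires_at A C t \<longleftrightarrow> (\<forall>t'<t. \<forall>p\<in>C. fs_run A C t' p \<notin> fs_F A) \<and> (\<forall>p\<in>C. fs_run A C t p \<in> fs_F A)"

definition is_solution :: "pos set set \<Rightarrow> fsa \<Rightarrow> bool" where
  "is_solution \<Gamma> A \<longleftrightarrow> fsa_wf A \<and> (\<forall>C\<in>\<Gamma>. \<exists>t. fires_at A C t)"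

definition ft :: "pos set \<Rightarrow> fsa \<Rightarrow> nat" where
  "ft C A = (THE t. fires_at A C t)"

definition mft :: "pos set set \<Rightarrow> pos set \<Rightarrow> nat" where
  "mft \<Gamma> C = (LEAST t. \<exists>A. is_solution \<Gamma> A \<and> ft C A = t)"

section \<open>Encodings (symbols: 0 blank, 1 digit 0, 2 digit 1, 3 plus, 4 minus, 5 comma, 6 semicolon)\<close>

fun bin :: "nat \<Rightarrow> nat list" where
  "bin n = (if n < 2 then [n + 1] else bin (n div 2) @ [n mod 2 + 1])"

definition enc_int :: "int \<Rightarrow> nat list" where
  "enc_int z = (if z < 0 then 4 else 3) # bin (nat \<bar>z\<bar>)"

definition enc_config_list :: "pos list \<Rightarrow> nat list" where
  "enc_config_list xs = concat (map (\<lambda>(x,y). enc_int x @ [5] @ enc_int y @ [6]) xs)"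

definition config_encodings :: "pos set \<Rightarrow> nat list set" where
  "config_encodings C = {enc_config_list xs | xs. distinct xs \<and> set xs = C}"

record tm =
  tm_states :: "nat set"
  tm_alpha :: "nat set"
  tm_start :: nat
  tm_halt :: nat
  tm_delta :: "nat \<Rightarrow> nat \<Rightarrow> nat \<times> nat \<times> int"

definition tm_wf :: "tm \<Rightarrow> bool" where
  "tm_wf M \<longleftrightarrow> finite (tm_states M) \<and> finite (tm_alpha M) \<and>
     {0,1,2,3,4,5,6} \<subseteq> tm_alpha M \<and>
     tm_start M \<in> tm_states M \<and> tm_halt M \<in> tm_states M \<and>
     (\<forall>q\<in>tm_states M. \<forall>a\<in>tm_alpha M.
        fst (tm_delta M q a) \<in> tm_states M \<and> fst (snd (tm_delta M q a)) \<in> tm_alpha M \<and>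
        snd (snd (tm_delta M q a)) \<in> {-1,0,1})"

type_synonym tm_conf = "nat \<times> (int \<Rightarrow> nat) \<times> int"

definition tm_step :: "tm \<Rightarrow> tm_conf \<Rightarrow> tm_conf" where
  "tm_step M c = (case c of (q, tp, h) \<Rightarrow>
     if q = tm_halt M then c
     else (case tm_delta M q (tp h) of (q', b, d) \<Rightarrow> (q', tp(h := b), h + d)))"

definition word_tape :: "nat list \<Rightarrow> int \<Rightarrow> nat" where
  "word_tape w i = (if 0 \<le> i \<and> i < int (length w) then w ! nat i else 0)"

definition tm_run :: "tm \<Rightarrow> nat list \<Rightarrow> nat \<Rightarrow> tm_conf" where
  "tm_run M w t = (tm_step M ^^ t) (tm_start M, word_tape w, 0)"

definition pspace_computable :: "'a set \<Rightarrow> ('a \<Rightarrow> nat list set) \<Rightarrow> ('a \<Rightarrow> nat) \<Rightarrow> bool" where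
  "pspace_computable D enc f \<longleftrightarrow>
     (\<exists>M c k. tm_wf M \<and> (\<forall>x\<in>D. \<forall>w\<in>enc x.
        (\<exists>t h. tm_run M w t = (tm_halt M, word_tape (bin (f x)), h)) \<and>
        (\<forall>t. \<bar>snd (snd (tm_run M w t))\<bar> \<le> int (c * (length w + 1) ^ k))))"

end

theory Submission
  imports Defs "HOL-Library.Countable"
begin


text \<open>
Run the automaton whose state is the entire history a node has seen. Call two configurations
adjacent at time t if some awake node has the same history in both. Adjacent configurations fire
together, so if a solution fires C at time t then no configuration connected to C by a chain of such
adjacencies has a node still asleep at time t. Conversely, if that holds at t, then any solution that
fires C later can be modified, by recording histories up to time t, to fire exactly the configurations
of the chain component of C at time t. Hence the minimum firing time is the least such t, and it is
at most 2|C| + 1, because by then every node has seen the whole configuration. Configurations that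
matter can be truncated to radius t + 1, so they fit into a square of side linear in the input length;
the chain condition is then reachability in a graph whose vertices are bit maps of polynomial length,
which Savitch's procedure decides in polynomial space.

If there were no solution, the minimum firing time would be the LEAST element of the empty
predicate, a constant; this case is computable as well, so no solution has to be constructed.

Time is irrelevant, so the machine model is a program with increment, decrement
and while over finitely many registers, whose values must have polynomially many bits.
\<close>

section \<open>Counter programs and their simulation by a Turing machine\<close>

text \<open>An awake history contains the trace of a signal from the general, hence the coordinates
  of its node and the current time. Therefore "fire on these histories" is triggered only at time t
  and only inside the chain component, and the modified automaton is still a solution. Quiescent
  histories carry no such trace, which is why adjacency demands an awake node; an asleep node in the
  component forbids firing because Q is not a firing state. The bound 2|C| + 1 counts |C| steps
  until all nodes are awake and |C| more steps during which the history of one node is read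
  backwards across C while everybody stays awake; the last step compares neighbourhoods. Truncation
  has to stay inside the family, which becomes easy once both path families are described by
  connectedness and degrees. Histories are trees of exponential size, but only their equality at a
  common node matters, and this is a bit map updated once per time step. Machine programming is
  confined to a few closure properties of a class of functions in which only bit lengths are
  bounded; loops of exponential length are free, so composition, recursion with short values and
  bounded quantifiers suffice.\<close>

datatype cmd = Inc nat | Dec nat | While nat "cmd list"

instance cmd :: countable by countable_datatype

text \<open>The bound B restricts increments only; passive registers may exceed it.\<close>

inductive exec :: "nat \<Rightarrow> cmd list \<Rightarrow> (nat \<Rightarrow> nat) \<Rightarrow> (nat \<Rightarrow> nat) \<Rightarrow> bool" for B where
  exec_Nil: "exec B [] s s"
| exec_Inc: "\<lbrakk>s r + 1 < B; exec B k (s(r := s r + 1)) s'\<rbrakk> \<Longrightarrow> exec B (Inc r # k) s s'"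
| exec_Dec: "\<lbrakk>s r = Suc n; exec B k (s(r := n)) s'\<rbrakk> \<Longrightarrow> exec B (Dec r # k) s s'"
| exec_WhileF: "\<lbrakk>s r = 0; exec B k s s'\<rbrakk> \<Longrightarrow> exec B (While r b # k) s s'"
| exec_WhileT: "\<lbrakk>s r \<noteq> 0; exec B (b @ While r b # k) s s'\<rbrakk> \<Longrightarrow> exec B (While r b # k) s s'"

fun regs :: "cmd list \<Rightarrow> nat set" where
  "regs [] = {}"
| "regs (Inc r # k) = insert r (regs k)"
| "regs (Dec r # k) = insert r (regs k)"
| "regs (While r b # k) = insert r (regs b \<union> regs k)"

lemma regs_append [simp]: "regs (p @ q) = regs p \<union> regs q"
  by (induction p rule: regs.induct) auto

lemma finite_regs: "finite (regs p)"
  by (induction p rule: regs.induct) auto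

text \<open>The programs that can remain to be executed at some moment: inside a loop body the loop
  itself is still pending. There are finitely many, so they can serve as the finite control.\<close>

fun conts :: "cmd list \<Rightarrow> cmd list set" where
  "conts [] = {[]}"
| "conts (Inc r # k) = insert (Inc r # k) (conts k)"
| "conts (Dec r # k) = insert (Dec r # k) (conts k)"
| "conts (While r b # k) = (\<lambda>c. c @ While r b # k) ` conts b \<union> conts k"

lemma Nil_in_conts: "[] \<in> conts p"
  by (induction p rule: conts.induct) auto

lemma self_in_conts: "p \<in> conts p"
  by (induction p rule: conts.induct) (auto intro: image_eqI[where x="[]"] Nil_in_conts)

lemma finite_conts: "finite (conts p)"
  by (induction p rule: conts.induct) auto

lemma tl_in_conts: "c \<in> conts p \<Longrightarrow> tl c \<in> conts p"
proof (induction p arbitrary: c rule: conts.induct)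
  case (4 r b k)
  from 4(3) consider d where "d \<in> conts b" "c = d @ While r b # k" | "c \<in> conts k" by auto
  then show ?case
  proof cases
    case 1
    then show ?thesis using 4(1)[of d] self_in_conts[of k] by (cases d) (auto)
  next
    case 2 then show ?thesis using 4(2) by auto
  qed
qed (auto simp: self_in_conts)

lemma body_in_conts: "While r b # k \<in> conts p \<Longrightarrow> b @ While r b # k \<in> conts p"
proof (induction p arbitrary: r b k rule: conts.induct)
  case (4 r' b' k')
  from 4(3) consider d where "d \<in> conts b'" "While r b # k = d @ While r' b' # k'"
    | "While r b # k \<in> conts k'" by auto
  then show ?case
  proof cases
    case 1
    then show ?thesis using 4(1) self_in_conts[of b'] by (cases d) auto
  next
    case 2 then show ?thesis using 4(2) by auto
  qed
qed auto

section \<open>The Turing machine of a counter program\<close>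

definition loop_entry :: "cmd list \<Rightarrow> cmd list" where
  "loop_entry p = (case p of While r b # k \<Rightarrow> b @ p | _ \<Rightarrow> p)"

text \<open>\<open>Inc\<close> clears ones while carrying and sets the first zero, marking that cell
  as visited because the carry may leave the visited part. \<open>Dec\<close> borrows in the dual
  way. \<open>While\<close> looks for a one and gives up at the first unvisited cell. The empty
  program erases every track except 0 and 1 on its way to the right.\<close>

definition cmd_step :: "nat \<Rightarrow> cmd list \<Rightarrow> nat \<Rightarrow> (cmd list \<times> nat) \<times> nat \<times> int" where
  "cmd_step K p a = (case p of
     [] \<Rightarrow> if bit a K then (([], 0), take_bit 2 a, 1) else (([], 7), a, 0)
   | Inc r # k \<Rightarrow> if bit a r then ((p, 0), unset_bit r a, 1) else ((p, 1), set_bit r (set_bit K a), 0)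
   | Dec r # k \<Rightarrow> if bit a r then ((p, 1), unset_bit r a, 0) else ((p, 0), set_bit r a, 1)
   | While r b # k \<Rightarrow> if bit a r then ((p, 2), a, 0) else if bit a K then ((p, 0), a, 1) else ((p, 1), a, -1))"

text \<open>A state is a continuation together with a phase: 0 executes the first command, starting at
cell 0; 1, 2 and 5 return to cell 0 and continue with the tail, with the unfolded loop, and with the
unchanged continuation; 3 and 4 mark the input; 7 (with the empty continuation) is the halting state.\<close>

definition state_step :: "nat \<Rightarrow> cmd list \<times> nat \<Rightarrow> nat \<Rightarrow> (cmd list \<times> nat) \<times> nat \<times> int" where
  "state_step K q a = (case q of (p, ph) \<Rightarrow>
     if ph = 0 then cmd_step K p a
     else if ph = 1 then (if bit a (K + 1) then ((tl p, 0), a, 0) else (q, a, -1))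
     else if ph = 2 then (if bit a (K + 1) then ((loop_entry p, 0), a, 0) else (q, a, -1))
     else if ph = 3 then ((p, 4), set_bit K (set_bit (K + 1) a), 1)
     else if ph = 4 then (if a = 0 then ((p, 5), a, -1) else ((p, 4), set_bit K a, 1))
     else if ph = 5 then (if bit a (K + 1) then ((p, 0), a, 0) else (q, a, -1))
     else (q, a, 0))"

text \<open>Truncating the written symbol keeps the alphabet closed without any invariant on the
  tape; the symbols written in the simulation are below \<open>2^(K+2)\<close> anyway.\<close>

definition tm_of :: "nat \<Rightarrow> cmd list \<Rightarrow> tm" where
  "tm_of K p = \<lparr>tm_states = to_nat ` (conts p \<times> {..7::nat}), tm_alpha = {..<2^(K+2)},
     tm_start = to_nat (p, 3::nat), tm_halt = to_nat ([] :: cmd list, 7::nat),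
     tm_delta = (\<lambda>q a. case state_step K (from_nat q) a of (q', b, d) \<Rightarrow> (to_nat q', take_bit (K+2) b, d))\<rparr>"

lemma cmd_step_closed:
  "fst (fst (cmd_step K p a)) \<in> {p, []}" "snd (fst (cmd_step K p a)) \<in> {0,1,2,7}"
  "snd (snd (cmd_step K p a)) \<in> {-1,0,1}"
  by (simp_all add: cmd_step_def split: list.split cmd.split)

lemma state_step_closed:
  assumes p: "fst q \<in> conts p" "snd q \<le> 7"
  shows "fst (fst (state_step K q a)) \<in> conts p" (is ?A) "snd (fst (state_step K q a)) \<le> 7" (is ?B)
    "snd (snd (state_step K q a)) \<in> {-1,0,1}" (is ?C)
proof -
  obtain c ph where q: "q = (c, ph)" by (cases q)
  have le: "loop_entry c \<in> conts p"
    using p(1) body_in_conts by (auto simp: loop_entry_def q split: list.split cmd.split)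
  have c: "c \<in> conts p" "tl c \<in> conts p" using p(1) tl_in_conts by (auto simp: q)
  have "fst (fst (cmd_step K c a)) \<in> conts p" 
    using cmd_step_closed(1)[of K c a] c Nil_in_conts[of p] by auto
  then show ?A unfolding q state_step_def using le c by simp
  have "snd (fst (cmd_step K c a)) \<le> 7" 
    using cmd_step_closed(2)[of K c a] by auto
  then show ?B unfolding q state_step_def using p(2) by (simp add: q)
  show ?C unfolding q state_step_def using cmd_step_closed(3)[of K c a] by simp
qed

lemma tm_wf_tm_of:
  assumes "3 \<le> K"
  shows "tm_wf (tm_of K p)"
proof -
  have "(2::nat)^5 \<le> 2^(K+2)" using assms by (intro power_increasing) auto
  then have a: "{0,1,2,3,4,5,6} \<subseteq> tm_alpha (tm_of K p)" by (auto simp: tm_of_def)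
  show ?thesis
    unfolding tm_wf_def
  proof (intro conjI ballI a)
    fix q a assume "q \<in> tm_states (tm_of K p)"
    then obtain x :: "cmd list \<times> nat" where x: "q = to_nat x" "fst x \<in> conts p" "snd x \<le> 7" by (auto simp: tm_of_def)
    show "fst (tm_delta (tm_of K p) q a) \<in> tm_states (tm_of K p)"
      "fst (snd (tm_delta (tm_of K p) q a)) \<in> tm_alpha (tm_of K p)"
      "snd (snd (tm_delta (tm_of K p) q a)) \<in> {- 1, 0, 1}"
      using state_step_closed[OF x(2,3), of K a]
      by (auto simp: x(1) tm_of_def split: prod.splits intro!: imageI take_bit_nat_less_exp[of "K+2", simplified])
  qed (auto simp: tm_of_def finite_conts Nil_in_conts self_in_conts)
qed

inductive reach :: "tm \<Rightarrow> int \<Rightarrow> tm_conf \<Rightarrow> tm_conf set \<Rightarrow> bool" for M S where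
  reach_refl: "\<lbrakk>\<bar>snd (snd c)\<bar> \<le> S; c \<in> T\<rbrakk> \<Longrightarrow> reach M S c T"
| reach_step: "\<lbrakk>\<bar>snd (snd c)\<bar> \<le> S; reach M S (tm_step M c) T\<rbrakk> \<Longrightarrow> reach M S c T"

text \<open>A halting configuration is a fixed point of the step function, so the bound persists for
  all later times.\<close>

lemma reach_halt:
  assumes "reach M S c T" "\<And>c'. c' \<in> T \<Longrightarrow> fst c' = tm_halt M"
  shows "(\<exists>t. (tm_step M ^^ t) c \<in> T) \<and> (\<forall>t. \<bar>snd (snd ((tm_step M ^^ t) c))\<bar> \<le> S)"
  using assms
proof (induction rule: reach.induct)
  case (reach_refl c T)
  have "(tm_step M ^^ t) c = c" for t
    by (induction t) (use reach_refl in \<open>auto simp: tm_step_def split: prod.splits\<close>)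
  then show ?case using reach_refl by auto
next
  case (reach_step c T)
  then obtain t where "(tm_step M ^^ t) (tm_step M c) \<in> T" by auto
  then have "(tm_step M ^^ Suc t) c \<in> T" by (simp add: funpow_swap1)
  moreover have "\<bar>snd (snd ((tm_step M ^^ t) c))\<bar> \<le> S" for t
    using reach_step by (cases t) (auto simp: funpow_swap1)
  ultimately show ?case by blast
qed

definition conf :: "cmd list \<times> nat \<Rightarrow> (int \<Rightarrow> nat) \<Rightarrow> nat \<Rightarrow> tm_conf" where
  "conf q tp h = (to_nat q, tp, int h)"

lemma tm_step_conf:
  assumes "q \<noteq> ([], 7)" "state_step K q (tp (int h)) = (q', b, d)" "0 \<le> int h + d" "b < 2^(K+2)"
  shows "tm_step (tm_of K p) (conf q tp h) = conf q' (tp(int h := b)) (nat (int h + d))"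
proof -
  have "to_nat q \<noteq> to_nat ([] :: cmd list, 7::nat)" using assms(1) by (metis from_nat_to_nat)
  then show ?thesis using assms(2-4) by (simp add: tm_step_def conf_def tm_of_def take_bit_nat_eq_self)
qed

text \<open>Register j is stored in binary along track j: bit j of the symbol in cell i is bit i of the
register. Track K marks the E visited cells and track K + 1 marks cell 0. As the input symbols are
less than 8, the input word is already the content of registers 0, 1 and 2.\<close>

definition rep :: "nat \<Rightarrow> nat \<Rightarrow> (nat \<Rightarrow> nat) \<Rightarrow> (int \<Rightarrow> nat) \<Rightarrow> bool" where
  "rep K E s tp \<longleftrightarrow> 0 < E \<and> (\<forall>r<K. s r < 2^E) \<and>
     (\<forall>i j. bit (tp i) j \<longleftrightarrow> 0 \<le> i \<and> i < int E \<and>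
        (j < K \<and> bit (s j) (nat i) \<or> j = K \<or> j = K + 1 \<and> i = 0))"

lemma less_power2_iff_bit: "(a::nat) < 2^n \<longleftrightarrow> (\<forall>j\<ge>n. \<not> bit a j)"
proof
  assume "a < 2^n"
  then have *: "take_bit n a = a" by (simp add: take_bit_nat_eq_self)
  show "\<forall>j\<ge>n. \<not> bit a j"
  proof (intro allI impI)
    fix j assume "n \<le> j"
    then have "\<not> bit (take_bit n a) j" by (simp add: bit_take_bit_iff)
    then show "\<not> bit a j" by (simp add: *)
  qed
next
  assume *: "\<forall>j\<ge>n. \<not> bit a j"
  have "take_bit n a = a"
  proof (rule bit_eqI)
    fix j show "bit (take_bit n a) j = bit a j" using * by (cases "j < n") (auto simp: bit_take_bit_iff)
  qed
  then show "a < 2^n" using take_bit_nat_less_exp[of n a] by simp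
qed

lemma rep_symbol_less: "rep K E s tp \<Longrightarrow> tp i < 2^(K+2)"
  unfolding less_power2_iff_bit rep_def by fastforce

lemma reach_conf_step:
  assumes "q \<noteq> ([], 7)" "state_step K q (tp (int h)) = (q', b, d)" "0 \<le> int h + d" "b < 2^(K+2)"
    "int h \<le> S" "reach (tm_of K p) S (conf q' (tp(int h := b)) (nat (int h + d))) c"
  shows "reach (tm_of K p) S (conf q tp h) c"
proof -
  have "tm_step (tm_of K p) (conf q tp h) = conf q' (tp(int h := b)) (nat (int h + d))"
    by (rule tm_step_conf[where tp=tp and h=h, OF assms(1-4)])
  then have "reach (tm_of K p) S (tm_step (tm_of K p) (conf q tp h)) c" using assms(6) by simp
  moreover have "\<bar>snd (snd (conf q tp h))\<bar> \<le> S" using assms(5) by (simp add: conf_def)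
  ultimately show ?thesis by (rule reach_step[rotated])
qed

section \<open>Head movements and their effect on the registers\<close>

lemma bit_marker:
  assumes "rep K E s tp"
  shows "bit (tp (int h)) (K + 1) \<longleftrightarrow> h = 0"
  using assms unfolding rep_def by auto

lemma return_left:
  assumes q: "\<And>a. state_step K q a = (if bit a (K + 1) then (q', a, 0) else (q, a, -1))"
    and n: "q \<noteq> ([], 7)" and rp: "rep K E s tp" and "h \<le> E" "int E \<le> S"
    and fin: "reach (tm_of K p) S (conf q' tp 0) c"
  shows "reach (tm_of K p) S (conf q tp h) c"
  using \<open>h \<le> E\<close>
proof (induction h)
  case 0
  show ?case
  proof (rule reach_conf_step[OF n])
    show "state_step K q (tp (int 0)) = (q', tp (int 0), 0)"
      using bit_marker[OF rp, of 0] q by simp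
    show "int 0 \<le> S" using \<open>int E \<le> S\<close> by simp
  qed (use rep_symbol_less[OF rp] fin in simp_all)
next
  case (Suc h)
  show ?case
  proof (rule reach_conf_step[OF n])
    show "state_step K q (tp (int (Suc h))) = (q, tp (int (Suc h)), -1)"
      using bit_marker[OF rp, of "Suc h"] q by simp
    show "int (Suc h) \<le> S" using \<open>int E \<le> S\<close> Suc.prems by simp
    show "reach (tm_of K p) S (conf q (tp(int (Suc h) := tp (int (Suc h)))) (nat (int (Suc h) + - 1))) c"
      using Suc by simp
  qed (use rep_symbol_less[OF rp] in simp_all)
qed

lemma bit_symbol:
  assumes "rep K E s tp" "r < K"
  shows "bit (tp (int h)) r \<longleftrightarrow> bit (s r) h"
proof (cases "h < E")
  case False
  then have "\<not> bit (s r) h" using assms by (auto simp: rep_def less_power2_iff_bit)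
  then show ?thesis using False assms by (auto simp: rep_def)
qed (use assms in \<open>auto simp: rep_def\<close>)

lemma bit_visited:
  assumes "rep K E s tp"
  shows "bit (tp (int h)) K \<longleftrightarrow> h < E"
  using assms by (auto simp: rep_def)

lemma add_power2_bit: "\<not> bit (x::nat) h \<Longrightarrow> x + 2^h = set_bit h x"
  by (simp add: set_bit_eq)

lemma diff_power2_bit: "bit (x::nat) h \<Longrightarrow> x - 2^h = unset_bit h x"
proof -
  assume "bit x h"
  then have "set_bit h (unset_bit h x) = x"
    by (intro bit_eqI) (auto simp: bit_set_bit_iff bit_unset_bit_iff)
  moreover have "\<not> bit (unset_bit h x) h" by (simp add: bit_unset_bit_iff)
  ultimately have "unset_bit h x + 2^h = x" using add_power2_bit by metis
  then show ?thesis by simp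
qed

lemma bit_imp_le: "bit (x::nat) h \<Longrightarrow> 2^h \<le> x"
  using less_power2_iff_bit[of x h] by (meson le_refl not_less)

lemma rep_unset:
  assumes "rep K E s tp" "r < K" "h < E"
  shows "rep K E (s(r := unset_bit h (s r))) (tp(int h := unset_bit r (tp (int h))))"
proof -
  have "\<forall>r'<K. (s(r := unset_bit h (s r))) r' < 2^E"
    using assms unfolding rep_def less_power2_iff_bit by (auto simp: bit_unset_bit_iff)
  moreover have "bit ((tp(int h := unset_bit r (tp (int h)))) i) j \<longleftrightarrow> 0 \<le> i \<and> i < int E \<and>
      (j < K \<and> bit ((s(r := unset_bit h (s r))) j) (nat i) \<or> j = K \<or> j = K + 1 \<and> i = 0)" for i j
    using assms unfolding rep_def less_power2_iff_bit by (auto simp: bit_unset_bit_iff)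
  moreover have "0 < E" using assms by simp
  ultimately show ?thesis unfolding rep_def by blast
qed

lemma rep_set:
  assumes "rep K E s tp" "r < K" "h < E"
  shows "rep K E (s(r := set_bit h (s r))) (tp(int h := set_bit r (tp (int h))))"
proof -
  have "\<forall>r'<K. (s(r := set_bit h (s r))) r' < 2^E"
    using assms unfolding rep_def less_power2_iff_bit by (auto simp: bit_set_bit_iff)
  moreover have "bit ((tp(int h := set_bit r (tp (int h)))) i) j \<longleftrightarrow> 0 \<le> i \<and> i < int E \<and>
      (j < K \<and> bit ((s(r := set_bit h (s r))) j) (nat i) \<or> j = K \<or> j = K + 1 \<and> i = 0)" for i j
    using assms unfolding rep_def less_power2_iff_bit by (auto simp: bit_set_bit_iff)
  moreover have "0 < E" using assms by simp
  ultimately show ?thesis unfolding rep_def by blast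
qed

text \<open>The only way in which the visited part grows: a carry that arrives at the first
  unvisited cell.\<close>

lemma rep_set_extend:
  assumes "rep K E s tp" "r < K"
  shows "rep K (Suc E) (s(r := set_bit E (s r))) (tp(int E := set_bit r (set_bit K (tp (int E)))))"
proof -
  have "\<forall>r'<K. (s(r := set_bit E (s r))) r' < 2^Suc E"
    using assms unfolding rep_def less_power2_iff_bit by (auto simp: bit_set_bit_iff)
  moreover have "bit ((tp(int E := set_bit r (set_bit K (tp (int E))))) i) j \<longleftrightarrow> 0 \<le> i \<and> i < int (Suc E) \<and>
      (j < K \<and> bit ((s(r := set_bit E (s r))) j) (nat i) \<or> j = K \<or> j = K + 1 \<and> i = 0)" for i j
    using assms unfolding rep_def less_power2_iff_bit by (auto simp: bit_set_bit_iff)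
  ultimately show ?thesis unfolding rep_def by blast
qed

lemma set_visited:
  assumes "rep K E s tp" "h < E"
  shows "set_bit K (tp (int h)) = tp (int h)"
  using bit_visited[OF assms(1), of h] assms(2) by (simp add: set_bit_eq)


text \<open>Scanning from an arbitrary cell h adds 2^h, which makes carry propagation an induction.\<close>

lemma Inc_scan:
  assumes "rep K E s tp" "r < K" "h \<le> E" "int E \<le> S" "s r + 2^h < 2^nat S"
    and "\<And>E' tp' h'. rep K E' (s(r := s r + 2^h)) tp' \<Longrightarrow> h' < E' \<Longrightarrow> int E' \<le> S \<Longrightarrow>
      reach (tm_of K p) S (conf (Inc r # k, 1) tp' h') c"
  shows "reach (tm_of K p) S (conf (Inc r # k, 0) tp h) c"
  using assms
proof (induction "E - h" arbitrary: s tp h rule: less_induct)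
  case less
  note rp = less.prems(1) and rK = less.prems(2)
  have hS: "int h \<le> S" using less.prems by simp
  show ?case
  proof (cases "bit (s r) h")
    case True
    have hE: "h < E"
      using True rp rK unfolding rep_def less_power2_iff_bit by (meson not_le)
    have le: "2^h \<le> s r" using True bit_imp_le by blast
    let ?s = "s(r := unset_bit h (s r))" and ?tp = "tp(int h := unset_bit r (tp (int h)))"
    have v: "unset_bit h (s r) = s r - 2^h" using True by (simp add: diff_power2_bit)
    have rp': "rep K E ?s ?tp" using rep_unset rp rK hE by blast
    \<comment> \<open>Clearing bit h and then adding \<open>2^Suc h\<close> amounts to adding
      \<open>2^h\<close>; this is the carry.\<close>
    have e: "?s(r := ?s r + 2^Suc h) = s(r := s r + 2^h)" using le by (auto simp: v)
    have R: "reach (tm_of K p) S (conf (Inc r # k, 0) ?tp (Suc h)) c"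
    proof (rule less.hyps[OF _ rp' rK])
      show "?s r + 2 ^ Suc h < 2 ^ nat S" using less.prems(5) le by (simp add: v)
      show "reach (tm_of K p) S (conf (Inc r # k, 1) tp' h') c"
        if "rep K E' (?s(r := ?s r + 2^Suc h)) tp'" "h' < E'" "int E' \<le> S" for E' tp' h'
        using that(2,3) less.prems(6)[OF that(1)[unfolded e]] by blast
    qed (use hE less.prems(4) in auto)
    show ?thesis
    proof (rule reach_conf_step)
      show "state_step K (Inc r # k, 0) (tp (int h)) = ((Inc r # k, 0), unset_bit r (tp (int h)), 1)"
        using True bit_symbol[OF rp rK, of h] by (simp add: state_step_def cmd_step_def)
      show "unset_bit r (tp (int h)) < 2^(K+2)" using rep_symbol_less[OF rp', of "int h"] by simp
      have "nat (int h + 1) = Suc h" by simp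
      then show "reach (tm_of K p) S (conf (Inc r # k, 0) ?tp (nat (int h + 1))) c" using R by simp
    qed (use hS in simp_all)
  next
    case False
    let ?b = "set_bit r (set_bit K (tp (int h)))" and ?E = "max E (Suc h)"
    have v: "set_bit h (s r) = s r + 2^h" using False by (simp add: add_power2_bit)
    have rp': "rep K ?E (s(r := s r + 2^h)) (tp(int h := ?b))"
    proof (cases "h < E")
      case True
      then show ?thesis using rep_set[OF rp rK True] set_visited[OF rp True] by (simp add: v max_absorb1)
    next
      case False
      then have "h = E" using less.prems by simp
      then show ?thesis using rep_set_extend[OF rp rK] v by simp
    qed
    \<comment> \<open>The bound on the incremented value becomes a bound on the cell where the carry
      stops, hence on space.\<close>
    have "2^h < (2::nat)^nat S" using less.prems(5) by linarith
    then have "h < nat S" by (metis power_strict_increasing_iff one_less_numeral_iff semiring_norm(76))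
    then have ES: "int ?E \<le> S" using less.prems(4) by simp
    show ?thesis
    proof (rule reach_conf_step)
      show "state_step K (Inc r # k, 0) (tp (int h)) = ((Inc r # k, 1), ?b, 0)"
        using False bit_symbol[OF rp rK, of h] by (simp add: state_step_def cmd_step_def)
      show "?b < 2^(K+2)" using rep_symbol_less[OF rp', of "int h"] by simp
      show "reach (tm_of K p) S (conf (Inc r # k, 1) (tp(int h := ?b)) (nat (int h + 0))) c"
        using less.prems(6)[OF rp' _ ES, of h] by simp
    qed (use hS in simp_all)
  qed
qed

text \<open>A borrow turns zeros into ones until it meets a one. The premise
  \<open>2^h \<le> s r\<close> says that there is a one at or beyond cell h, so the head stays
  within the visited cells.\<close>

lemma Dec_scan:
  assumes "rep K E s tp" "r < K" "int E \<le> S" "2^h \<le> s r"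
    and "\<And>tp' h'. rep K E (s(r := s r - 2^h)) tp' \<Longrightarrow> h' < E \<Longrightarrow>
      reach (tm_of K p) S (conf (Dec r # k, 1) tp' h') c"
  shows "reach (tm_of K p) S (conf (Dec r # k, 0) tp h) c"
  using assms
proof (induction "E - h" arbitrary: s tp h rule: less_induct)
  case less
  note rp = less.prems(1) and rK = less.prems(2)
  have "s r < 2^E" using rp rK by (simp add: rep_def)
  then have "(2::nat)^h < 2^E" using less.prems(4) by (rule le_less_trans[rotated])
  then have hE: "h < E" by (metis power_strict_increasing_iff one_less_numeral_iff semiring_norm(76))
  have hS: "int h \<le> S" using less.prems hE by simp
  show ?case
  proof (cases "bit (s r) h")
    case True
    have v: "unset_bit h (s r) = s r - 2^h" using True by (simp add: diff_power2_bit)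
    have rp': "rep K E (s(r := s r - 2^h)) (tp(int h := unset_bit r (tp (int h))))"
      using rep_unset[OF rp rK hE] v by simp
    show ?thesis
    proof (rule reach_conf_step)
      show "state_step K (Dec r # k, 0) (tp (int h)) = ((Dec r # k, 1), unset_bit r (tp (int h)), 0)"
        using True bit_symbol[OF rp rK, of h] by (simp add: state_step_def cmd_step_def)
      show "unset_bit r (tp (int h)) < 2^(K+2)" using rep_symbol_less[OF rp', of "int h"] by simp
      show "reach (tm_of K p) S (conf (Dec r # k, 1) (tp(int h := unset_bit r (tp (int h)))) (nat (int h + 0))) c"
        using less.prems(5)[OF rp' hE] by simp
    qed (use hS in simp_all)
  next
    case False
    let ?s = "s(r := set_bit h (s r))" and ?tp = "tp(int h := set_bit r (tp (int h)))"
    have v: "set_bit h (s r) = s r + 2^h" using False by (simp add: add_power2_bit)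
    have rp': "rep K E ?s ?tp" using rep_set rp rK hE by blast
    have e: "?s(r := ?s r - 2^Suc h) = s(r := s r - 2^h)" by (auto simp: v)
    have R: "reach (tm_of K p) S (conf (Dec r # k, 0) ?tp (Suc h)) c"
    proof (rule less.hyps[OF _ rp' rK less.prems(3)])
      show "2 ^ Suc h \<le> ?s r" using less.prems(4) by (simp add: v)
      show "reach (tm_of K p) S (conf (Dec r # k, 1) tp' h') c"
        if "rep K E (?s(r := ?s r - 2^Suc h)) tp'" "h' < E" for tp' h'
        using that(2) less.prems(5)[OF that(1)[unfolded e]] by blast
    qed (use hE in auto)
    show ?thesis
    proof (rule reach_conf_step)
      show "state_step K (Dec r # k, 0) (tp (int h)) = ((Dec r # k, 0), set_bit r (tp (int h)), 1)"
        using False bit_symbol[OF rp rK, of h] by (simp add: state_step_def cmd_step_def)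
      show "set_bit r (tp (int h)) < 2^(K+2)" using rep_symbol_less[OF rp', of "int h"] by simp
      have "nat (int h + 1) = Suc h" by simp
      then show "reach (tm_of K p) S (conf (Dec r # k, 0) ?tp (nat (int h + 1))) c" using R by simp
    qed (use hS in simp_all)
  qed
qed

text \<open>For h = 0 the two alternatives are the outcomes of the zero test; general h makes the
  scan an induction. Reaching the first unvisited cell shows that no one is left.\<close>

lemma While_scan:
  assumes "rep K E s tp" "r < K" "int E \<le> S" "h \<le> E"
    and "\<And>h'. h' \<le> E \<Longrightarrow> 2^h \<le> s r \<Longrightarrow> reach (tm_of K p) S (conf (While r b # k, 2) tp h') c"
    and "\<And>h'. h' \<le> E \<Longrightarrow> s r < 2^h \<Longrightarrow> reach (tm_of K p) S (conf (While r b # k, 1) tp h') c"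
  shows "reach (tm_of K p) S (conf (While r b # k, 0) tp h) c"
  using assms(4-)
proof (induction "E - h" arbitrary: h rule: less_induct)
  case less
  note rp = assms(1) and rK = assms(2)
  have hS: "int h \<le> S" using less.prems assms(3) by simp
  note sym = rep_symbol_less[OF rp, of "int h"]
  consider "bit (s r) h" | "\<not> bit (s r) h" "h < E" | "\<not> bit (s r) h" "h = E" using less.prems(1) by linarith
  then show ?case
  proof cases
    case 1
    show ?thesis
    proof (rule reach_conf_step)
      show "state_step K (While r b # k, 0) (tp (int h)) = ((While r b # k, 2), tp (int h), 0)"
        using 1 bit_symbol[OF rp rK, of h] by (simp add: state_step_def cmd_step_def)
      show "reach (tm_of K p) S (conf (While r b # k, 2) (tp(int h := tp (int h))) (nat (int h + 0))) c"
        using less.prems(2)[of h] bit_imp_le[OF 1] less.prems(1) by simp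
    qed (use hS sym in simp_all)
  next
    case 2
    have iff: "2^Suc h \<le> s r \<longleftrightarrow> 2^h \<le> s r"
    proof
      assume "2^h \<le> s r"
      then obtain j where "j \<ge> h" "bit (s r) j" using less_power2_iff_bit[of "s r" h] by (auto simp: not_less)
      then have "j \<ge> Suc h" "bit (s r) j" using 2 by (auto simp: Suc_le_eq le_less)
      then show "2^Suc h \<le> s r" using less_power2_iff_bit[of "s r" "Suc h"] not_less by blast
    qed simp
    have R: "reach (tm_of K p) S (conf (While r b # k, 0) tp (Suc h)) c"
    proof (rule less.hyps)
      show "reach (tm_of K p) S (conf (While r b # k, 2) tp h') c" if "h' \<le> E" "2^Suc h \<le> s r" for h'
        using less.prems(2) that iff by blast
      show "reach (tm_of K p) S (conf (While r b # k, 1) tp h') c" if "h' \<le> E" "s r < 2^Suc h" for h'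
        using less.prems(3) that iff by (meson not_less)
    qed (use 2 in auto)
    show ?thesis
    proof (rule reach_conf_step)
      show "state_step K (While r b # k, 0) (tp (int h)) = ((While r b # k, 0), tp (int h), 1)"
        using 2 bit_symbol[OF rp rK, of h] bit_visited[OF rp, of h] by (simp add: state_step_def cmd_step_def)
      have "nat (int h + 1) = Suc h" by simp
      then show "reach (tm_of K p) S (conf (While r b # k, 0) (tp(int h := tp (int h))) (nat (int h + 1))) c" using R by simp
    qed (use hS sym in simp_all)
  next
    case 3
    have "s r < 2^h" using rp rK 3 by (simp add: rep_def)
    then have R: "reach (tm_of K p) S (conf (While r b # k, 1) tp (h - 1)) c" using less.prems(3) 3 by simp
    have h: "0 < h" using rp 3 by (simp add: rep_def)
    show ?thesis
    proof (rule reach_conf_step)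
      show "state_step K (While r b # k, 0) (tp (int h)) = ((While r b # k, 1), tp (int h), -1)"
        using 3 bit_symbol[OF rp rK, of h] bit_visited[OF rp, of h] by (simp add: state_step_def cmd_step_def)
      have "nat (int h + -1) = h - 1" by simp
      then show "reach (tm_of K p) S (conf (While r b # k, 1) (tp(int h := tp (int h))) (nat (int h + -1))) c" using R by simp
      show "0 \<le> int h + -1" using h by simp
    qed (use hS sym in simp_all)
  qed
qed

lemma return_to:
  assumes "rep K E s tp" "h \<le> E" "int E \<le> S" "reach (tm_of K p) S (conf (q, 0) tp 0) c"
  shows "q = tl k \<Longrightarrow> reach (tm_of K p) S (conf (k, 1) tp h) c"
    "q = loop_entry k \<Longrightarrow> reach (tm_of K p) S (conf (k, 2) tp h) c"
    "q = k \<Longrightarrow> reach (tm_of K p) S (conf (k, 5) tp h) c"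
  by (rule return_left[where q'="(q, 0)", OF _ _ assms(1-3)], simp add: state_step_def, simp, rule assms(4))+

text \<open>Only increments can visit new cells, so a bound on incremented values is all that is
  needed to control space.\<close>

lemma exec_simulation:
  assumes "exec B k s s'" "B \<le> 2^nat S" "regs k \<subseteq> {..<K}"
    and "rep K E s tp" "int E \<le> S"
    and "\<And>E' tp'. rep K E' s' tp' \<Longrightarrow> int E' \<le> S \<Longrightarrow> reach (tm_of K p) S (conf ([], 0) tp' 0) c"
  shows "reach (tm_of K p) S (conf (k, 0) tp 0) c"
  using assms
proof (induction arbitrary: E tp rule: exec.induct)
  case (exec_Nil s)
  then show ?case by blast
next
  case (exec_Inc s r k s')
  show ?case
  proof (rule Inc_scan[OF exec_Inc.prems(3)])
    fix E' tp' h' assume *: "rep K E' (s(r := s r + 2^0)) tp'" "h' < E'" "int E' \<le> S"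
    have "reach (tm_of K p) S (conf (k, 0) tp' 0) c"
      by (rule exec_Inc.IH[where E=E' and tp=tp']) (use exec_Inc.prems * in \<open>auto simp: fun_upd_def\<close>)
    then show "reach (tm_of K p) S (conf (Inc r # k, 1) tp' h') c"
      using * by (intro return_to(1)[of K E' "s(r := s r + 2^0)"]) auto
  qed (use exec_Inc in auto)
next
  case (exec_Dec s r n k s')
  show ?case
  proof (rule Dec_scan[OF exec_Dec.prems(3)])
    fix tp' h' assume *: "rep K E (s(r := s r - 2^0)) tp'" "h' < E"
    have "reach (tm_of K p) S (conf (k, 0) tp' 0) c"
      by (rule exec_Dec.IH) (use exec_Dec.prems exec_Dec.hyps * in \<open>auto simp: fun_upd_def\<close>)
    then show "reach (tm_of K p) S (conf (Dec r # k, 1) tp' h') c"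
      using * exec_Dec.prems(4) by (intro return_to(1)[of K E "s(r := s r - 2^0)"]) auto
  qed (use exec_Dec in auto)
next
  case (exec_WhileF s r k s' b)
  have "reach (tm_of K p) S (conf (k, 0) tp 0) c"
    by (rule exec_WhileF.IH) (use exec_WhileF.prems in auto)
  then have "reach (tm_of K p) S (conf (While r b # k, 1) tp h') c" if "h' \<le> E" for h'
    using that exec_WhileF.prems(3,4) by (intro return_to(1)) auto
  then show ?case
    by (intro While_scan[OF exec_WhileF.prems(3)]) (use exec_WhileF in auto)
next
  case (exec_WhileT s r b k s')
  have "reach (tm_of K p) S (conf (b @ While r b # k, 0) tp 0) c"
    by (rule exec_WhileT.IH) (use exec_WhileT.prems in auto)
  then have "reach (tm_of K p) S (conf (While r b # k, 2) tp h') c" if "h' \<le> E" for h'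
    using that exec_WhileT.prems(3,4) by (intro return_to(2)) (auto simp: loop_entry_def)
  then show ?case
    by (intro While_scan[OF exec_WhileT.prems(3)]) (use exec_WhileT in auto)
qed

section \<open>Reading the input and writing the output\<close>

declare bin.simps [simp del]

text \<open>One track of a word as a binary number whose lowest bit comes from the first
  symbol.\<close>

definition track :: "nat list \<Rightarrow> nat \<Rightarrow> nat" where
  "track w r = horner_sum of_bool 2 (map (\<lambda>a. bit a r) w)"

lemma bit_track: "bit (track w r) i \<longleftrightarrow> i < length w \<and> bit (w ! i) r"
  by (auto simp: track_def bit_horner_sum_bit_iff)

lemma track_less: "track w r < 2 ^ length w"
  unfolding less_power2_iff_bit by (auto simp: bit_track)

definition input_regs :: "nat list \<Rightarrow> nat \<Rightarrow> nat" where
  "input_regs w r = (if r < 3 then track w r else 0)"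

lemma bit_word_tape: "bit (word_tape w i) j \<longleftrightarrow> 0 \<le> i \<and> i < int (length w) \<and> bit (track w j) (nat i)"
  by (auto simp: word_tape_def bit_track)

lemma word_tape_less: "\<forall>a\<in>set w. a < n \<Longrightarrow> 0 < n \<Longrightarrow> word_tape w i < n"
  using nth_mem[of "nat i" w] by (auto simp: word_tape_def simp del: nth_mem)

text \<open>Invariant of the first pass: cell 0 carries its mark and h cells have been declared
  visited, while the input symbols are intact.\<close>

definition marked :: "nat \<Rightarrow> nat \<Rightarrow> nat list \<Rightarrow> (int \<Rightarrow> nat) \<Rightarrow> bool" where
  "marked K h w tp \<longleftrightarrow> (\<forall>i j. bit (tp i) j \<longleftrightarrow>
     bit (word_tape w i) j \<or> j = K \<and> 0 \<le> i \<and> i < int h \<or> j = K + 1 \<and> i = 0)"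

lemma bit_input_symbol:
  assumes "\<forall>a\<in>set w. a < 8"
  shows "bit (word_tape w i) j \<longleftrightarrow> j < 3 \<and> bit (word_tape w i) j"
proof -
  have "word_tape w i < 2^3" using word_tape_less[OF assms] by simp
  then show ?thesis unfolding less_power2_iff_bit using not_le by blast
qed

lemma marked_rep:
  assumes "marked K (length w) w tp" "3 \<le> K" "w \<noteq> []" "\<forall>a\<in>set w. a < 8"
  shows "rep K (length w) (input_regs w) tp"
  unfolding rep_def
proof (intro conjI allI impI)
  fix i j
  have "bit (word_tape w i) j \<longleftrightarrow> 0 \<le> i \<and> i < int (length w) \<and> j < K \<and> bit (input_regs w j) (nat i)"
    using bit_input_symbol[OF assms(4), of i j] assms(2) bit_word_tape[of w i j]
    by (auto simp: input_regs_def)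
  then show "bit (tp i) j \<longleftrightarrow> 0 \<le> i \<and> i < int (length w) \<and>
      (j < K \<and> bit (input_regs w j) (nat i) \<or> j = K \<or> j = K + 1 \<and> i = 0)"
    using assms(1,3) unfolding marked_def by auto
qed (use assms track_less in \<open>auto simp: input_regs_def\<close>)

lemma marked_symbol_less:
  assumes "marked K h w tp" "3 \<le> K" "\<forall>a\<in>set w. a < 8"
  shows "tp i < 2^(K+2)"
  unfolding less_power2_iff_bit
proof (intro allI impI)
  fix j assume "K + 2 \<le> j"
  then show "\<not> bit (tp i) j" using assms(1) bit_input_symbol[OF assms(3), of i j] assms(2)
    unfolding marked_def by auto
qed

text \<open>Input symbols are nonzero, so the first blank is the end of the word; there the tape
  already represents the initial registers.\<close>

lemma init_scan:
  assumes "marked K h w tp" "0 < h" "h \<le> length w" "3 \<le> K" "\<forall>a\<in>set w. 0 < a \<and> a < 8"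
    and "int (length w) \<le> S"
    and "\<And>tp'. rep K (length w) (input_regs w) tp' \<Longrightarrow> reach (tm_of K p) S (conf (q, 0) tp' 0) c"
  shows "reach (tm_of K p) S (conf (q, 4) tp h) c"
  using assms
proof (induction "length w - h" arbitrary: h tp rule: less_induct)
  case less
  have w8: "\<forall>a\<in>set w. a < 8" using less.prems(5) by blast
  have hS: "int h \<le> S" using less.prems by simp
  have e: "tp (int h) = word_tape w (int h)"
  proof (rule bit_eqI)
    fix j show "bit (tp (int h)) j = bit (word_tape w (int h)) j"
      using less.prems(1,2) unfolding marked_def by simp
  qed
  show ?case
  proof (cases "h = length w")
    case True
    have rp: "rep K (length w) (input_regs w) tp"
      using marked_rep[of K w tp] less.prems(1,2,4) w8 True by auto
    have R: "reach (tm_of K p) S (conf (q, 5) tp (h - 1)) c"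
      by (rule return_to(3)[OF rp _ less.prems(6) less.prems(7)[OF rp]]) (use True in simp_all)
    show ?thesis
    proof (rule reach_conf_step)
      show "state_step K (q, 4) (tp (int h)) = ((q, 5), tp (int h), -1)"
        using True e by (simp add: state_step_def word_tape_def)
      have "nat (int h + -1) = h - 1" by simp
      then show "reach (tm_of K p) S (conf (q, 5) (tp(int h := tp (int h))) (nat (int h + -1))) c" using R by simp
    qed (use hS less.prems marked_symbol_less[OF less.prems(1,4) w8] in simp_all)
  next
    case False
    then have h: "h < length w" using less.prems(3) by simp
    then have n0: "tp (int h) \<noteq> 0" using less.prems(5) by (simp add: e word_tape_def)
    let ?tp = "tp(int h := set_bit K (tp (int h)))"
    have m: "marked K (Suc h) w ?tp"
      unfolding marked_def
    proof (intro allI)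
      fix i j
      have i: "0 \<le> i \<and> i < int (Suc h) \<longleftrightarrow> 0 \<le> i \<and> i < int h \<or> i = int h" by auto
      show "bit (?tp i) j \<longleftrightarrow> bit (word_tape w i) j \<or> j = K \<and> 0 \<le> i \<and> i < int (Suc h) \<or> j = K + 1 \<and> i = 0"
        unfolding i using less.prems(1) by (auto simp: marked_def bit_set_bit_iff)
    qed
    show ?thesis
    proof (rule reach_conf_step)
      show "state_step K (q, 4) (tp (int h)) = ((q, 4), set_bit K (tp (int h)), 1)"
        using n0 by (simp add: state_step_def)
      have "nat (int h + 1) = Suc h" by simp
      then show "reach (tm_of K p) S (conf (q, 4) ?tp (nat (int h + 1))) c"
        using less.hyps[OF _ m] h less.prems by simp
      show "set_bit K (tp (int h)) < 2^(K+2)" using marked_symbol_less[OF m less.prems(4) w8, of "int h"] by simp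
    qed (use hS in simp_all)
  qed
qed

lemma init_phase:
  assumes "w \<noteq> []" "3 \<le> K" "\<forall>a\<in>set w. 0 < a \<and> a < 8" and "int (length w) \<le> S"
    and "\<And>tp'. rep K (length w) (input_regs w) tp' \<Longrightarrow> reach (tm_of K p) S (conf (q, 0) tp' 0) c"
  shows "reach (tm_of K p) S (conf (q, 3) (word_tape w) 0) c"
proof -
  let ?b = "set_bit K (set_bit (K + 1) (word_tape w 0))"
  have w8: "\<forall>a\<in>set w. a < 8" using assms(3) by blast
  have m: "marked K 1 w ((word_tape w)(int 0 := ?b))"
    unfolding marked_def by (auto simp: bit_set_bit_iff)
  have R: "reach (tm_of K p) S (conf (q, 4) ((word_tape w)(int 0 := ?b)) 1) c"
    by (rule init_scan[OF m _ _ assms(2-5)]) (use assms(1) in \<open>auto simp: Suc_le_eq\<close>)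
  show ?thesis
  proof (rule reach_conf_step)
    show "state_step K (q, 3) (word_tape w (int 0)) = ((q, 4), ?b, 1)" by (simp add: state_step_def)
    show "?b < 2^(K+2)" using marked_symbol_less[OF m assms(2) w8, of 0] by simp
    show "reach (tm_of K p) S (conf (q, 4) ((word_tape w)(int 0 := ?b)) (nat (int 0 + 1))) c" using R by simp
  qed (use assms(4) in simp_all)
qed

text \<open>Invariant of the last pass, which keeps only the two tracks that hold the
  output.\<close>

definition partly_cleaned :: "nat \<Rightarrow> nat \<Rightarrow> nat \<Rightarrow> (nat \<Rightarrow> nat) \<Rightarrow> (int \<Rightarrow> nat) \<Rightarrow> bool" where
  "partly_cleaned K E h s tp \<longleftrightarrow> (\<exists>tp0. rep K E s tp0 \<and>
     (\<forall>i. tp i = (if 0 \<le> i \<and> i < int h then take_bit 2 (tp0 i) else tp0 i)))"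

lemma final_scan:
  assumes "partly_cleaned K E h s tp" "h \<le> E" "int E \<le> S" "2 \<le> K"
    and "\<And>tp' h'. partly_cleaned K E E s tp' \<Longrightarrow> h' \<le> E \<Longrightarrow> reach (tm_of K p) S (conf ([], 7) tp' h') c"
  shows "reach (tm_of K p) S (conf ([], 0) tp h) c"
  using assms
proof (induction "E - h" arbitrary: h tp rule: less_induct)
  case less
  obtain tp0 where rp: "rep K E s tp0" and tp: "\<And>i. tp i = (if 0 \<le> i \<and> i < int h then take_bit 2 (tp0 i) else tp0 i)"
    using less.prems(1) unfolding partly_cleaned_def by blast
  have hS: "int h \<le> S" using less.prems by simp
  have e: "tp (int h) = tp0 (int h)" using tp by simp
  have sym: "tp (int h) < 2^(K+2)" using rep_symbol_less[OF rp] e by simp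
  show ?case
  proof (cases "h = E")
    case True
    show ?thesis
    proof (rule reach_conf_step)
      show "state_step K ([], 0) (tp (int h)) = (([], 7), tp (int h), 0)"
        using bit_visited[OF rp, of h] True e by (simp add: state_step_def cmd_step_def)
      show "reach (tm_of K p) S (conf ([], 7) (tp(int h := tp (int h))) (nat (int h + 0))) c"
        using less.prems(1,5) True by simp
    qed (use hS sym in simp_all)
  next
    case False
    let ?tp = "tp(int h := take_bit 2 (tp (int h)))"
    have m: "partly_cleaned K E (Suc h) s ?tp"
      unfolding partly_cleaned_def using rp tp by (intro exI[of _ tp0]) auto
    show ?thesis
    proof (rule reach_conf_step)
      show "state_step K ([], 0) (tp (int h)) = (([], 0), take_bit 2 (tp (int h)), 1)"
        using bit_visited[OF rp, of h] False less.prems(2) e by (simp add: state_step_def cmd_step_def)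
      have "nat (int h + 1) = Suc h" by simp
      then show "reach (tm_of K p) S (conf ([], 0) ?tp (nat (int h + 1))) c"
        using less.hyps[OF _ m] False less.prems by simp
      have "take_bit 2 (tp (int h)) \<le> tp (int h)" by (rule take_bit_nat_less_eq_self)
      then show "take_bit 2 (tp (int h)) < 2^(K+2)" using sym by linarith
    qed (use hS in simp_all)
  qed
qed

text \<open>Symbols below 4 are determined by their bits 0 and 1. No output symbol lies outside the
  visited part, because \<open>rep\<close> bounds registers 0 and 1 by \<open>2^E\<close>.\<close>

lemma cleaned_word_tape:
  assumes "partly_cleaned K E E s tp" "2 \<le> K" "\<forall>a\<in>set v. a < 4" "s 0 = track v 0" "s 1 = track v 1"
  shows "tp = word_tape v"
proof
  fix i
  obtain tp0 where rp: "rep K E s tp0" and tp: "\<And>i. tp i = (if 0 \<le> i \<and> i < int E then take_bit 2 (tp0 i) else tp0 i)"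
    using assms(1) unfolding partly_cleaned_def by blast
  show "tp i = word_tape v i"
  proof (rule bit_eqI)
    fix j
    have v: "bit (word_tape v i) j \<longleftrightarrow> j < 2 \<and> bit (word_tape v i) j"
    proof -
      have "word_tape v i < 2^2" using word_tape_less[OF assms(3)] by simp
      then show ?thesis unfolding less_power2_iff_bit using not_le by blast
    qed
    have tp0: "bit (tp0 i) j \<longleftrightarrow> 0 \<le> i \<and> i < int E \<and> (j < K \<and> bit (s j) (nat i) \<or> j = K \<or> j = K + 1 \<and> i = 0)"
      using rp unfolding rep_def by blast
    have "bit (tp i) j \<longleftrightarrow> 0 \<le> i \<and> i < int E \<and> j < 2 \<and> bit (s j) (nat i)"
    proof (cases "0 \<le> i \<and> i < int E")
      case True
      then show ?thesis using assms(2) tp[of i] tp0 by (auto simp: bit_take_bit_iff)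
    next
      case False
      then show ?thesis using tp[of i] tp0 by auto
    qed
    also have "\<dots> \<longleftrightarrow> 0 \<le> i \<and> j < 2 \<and> bit (s j) (nat i)"
    proof -
      have "i < int E" if "bit (s j) (nat i)" "j < 2"
      proof -
        have "s j < 2^E" using rp that(2) assms(2) by (simp add: rep_def)
        then have "nat i < E" using that(1) unfolding less_power2_iff_bit by (meson not_le)
        then show ?thesis by linarith
      qed
      then show ?thesis by blast
    qed
    also have "\<dots> \<longleftrightarrow> 0 \<le> i \<and> j < 2 \<and> bit (track v j) (nat i)"
      using assms(4,5) by (metis One_nat_def less_2_cases)
    also have "\<dots> \<longleftrightarrow> bit (word_tape v i) j"
      using v bit_word_tape[of v i j] bit_track[of v j "nat i"] by auto
    finally show "bit (tp i) j \<longleftrightarrow> bit (word_tape v i) j" .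
  qed
qed

lemma bin_symbols: "\<forall>a\<in>set (bin n). a < 4"
proof (induction n rule: bin.induct)
  case (1 n)
  then show ?case by (subst bin.simps) (cases "n < 2", auto simp del: bin.simps)
qed

lemma pspace_computable_by_program:
  assumes "\<And>x w. x \<in> D \<Longrightarrow> w \<in> enc x \<Longrightarrow> w \<noteq> [] \<and> (\<forall>a\<in>set w. 0 < a \<and> a < 8)"
    and "\<And>x w. x \<in> D \<Longrightarrow> w \<in> enc x \<Longrightarrow>
      \<exists>s. exec (2 ^ (c * (length w + 1) ^ k)) p (input_regs w) s \<and>
        s 0 = track (bin (f x)) 0 \<and> s 1 = track (bin (f x)) 1"
    and "0 < c" "0 < k"
  shows "pspace_computable D enc f"
proof -
  \<comment> \<open>The track number exceeds every register of the program and is at least 3, since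
    input symbols occupy three tracks.\<close>
  define K where "K = Max (insert 2 (regs p)) + 1"
  have K3: "3 \<le> K" using finite_regs[of p] unfolding K_def by (simp add: Max_ge_iff)
  have rK: "regs p \<subseteq> {..<K}" using finite_regs[of p] by (auto simp: K_def less_Suc_eq_le)
  let ?M = "tm_of K p"
  show ?thesis
    unfolding pspace_computable_def
  proof (rule exI[of _ ?M], rule exI[of _ c], rule exI[of _ k], intro conjI ballI)
  show "tm_wf ?M" using K3 by (rule tm_wf_tm_of)
  fix x w assume xw: "x \<in> D" "w \<in> enc x"
  note w = assms(1)[OF xw]
  obtain s where s: "exec (2 ^ (c * (length w + 1) ^ k)) p (input_regs w) s"
    "s 0 = track (bin (f x)) 0" "s 1 = track (bin (f x)) 1" using assms(2)[OF xw] by blast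
  define S where "S = c * (length w + 1) ^ k"
  \<comment> \<open>Positive c and k are needed here: the space bound must cover the pass over the
    input.\<close>
  have "length w + 1 \<le> (length w + 1) ^ k" using assms(4) self_le_power[of "length w + 1" k] by simp
  also have "\<dots> \<le> S" using assms(3) by (simp add: S_def)
  finally have lS: "int (length w) \<le> int S" by simp
  have tmd: "tm_halt ?M = to_nat ([] :: cmd list, 7::nat)" by (simp add: tm_of_def)
  have st: "(tm_start ?M, word_tape w, 0) = conf (p, 3) (word_tape w) 0"
    by (simp add: tm_of_def conf_def)
  let ?T = "{conf ([], 7) (word_tape (bin (f x))) h | h. True}"
  have "reach ?M (int S) (conf (p, 3) (word_tape w) 0) ?T"
  proof (rule init_phase[OF _ K3 _ lS])
    fix tp assume rp: "rep K (length w) (input_regs w) tp"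
    show "reach ?M (int S) (conf (p, 0) tp 0) ?T"
    proof (rule exec_simulation[OF s(1) _ rK rp lS])
      fix E tp' assume rp': "rep K E s tp'" and ES: "int E \<le> int S"
      have pc: "partly_cleaned K E 0 s tp'" unfolding partly_cleaned_def using rp' by auto
      show "reach ?M (int S) (conf ([], 0) tp' 0) ?T"
      proof (rule final_scan[OF pc _ ES])
        fix tp'' h assume pc: "partly_cleaned K E E s tp''" and h: "h \<le> E"
        from pc have "tp'' = word_tape (bin (f x))"
          by (rule cleaned_word_tape) (use K3 bin_symbols s in auto)
        then show "reach ?M (int S) (conf ([], 7) tp'' h) ?T"
          using h ES by (intro reach_refl) (auto simp: conf_def)
      qed (use K3 in auto)
    qed (simp only: S_def nat_int order_refl)
  qed (use w in auto)
  then have R: "(\<exists>t. tm_run ?M w t \<in> ?T) \<and> (\<forall>t. \<bar>snd (snd (tm_run ?M w t))\<bar> \<le> int S)"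
    unfolding tm_run_def st by (rule reach_halt) (auto simp: conf_def tmd)
  then obtain t h where "tm_run ?M w t = conf ([], 7) (word_tape (bin (f x))) h" by blast
  then have "tm_run ?M w t = (tm_halt ?M, word_tape (bin (f x)), int h)" by (simp add: conf_def tmd)
  then show "\<exists>t h. tm_run ?M w t = (tm_halt ?M, word_tape (bin (f x)), h)" by blast
  show "\<forall>t. \<bar>snd (snd (tm_run ?M w t))\<bar> \<le> int (c * (length w + 1) ^ k)"
    using R unfolding S_def by blast
  qed
qed

section \<open>Functions computable in polynomial space\<close>

lemma exec_eq: "(\<And>r. s' r = s r) \<Longrightarrow> exec B [] s s'"
  using exec_Nil[of B s] by (metis ext)

lemma exec_append: "exec B p s s1 \<Longrightarrow> exec B q s1 s2 \<Longrightarrow> exec B (p @ q) s s2"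
proof (induction rule: exec.induct)
  case (exec_WhileT s r b k s')
  then show ?case by (simp add: exec.exec_WhileT)
qed (auto intro: exec.intros)

lemma exec_While:
  assumes "\<And>i. i < n \<Longrightarrow> S i r \<noteq> 0" "\<And>i. i < n \<Longrightarrow> exec B b (S i) (S (Suc i))" "S n r = 0"
  shows "exec B [While r b] (S 0) (S n)"
proof -
  have "exec B [While r b] (S (n - j)) (S n)" if "j \<le> n" for j
    using that
  proof (induction j)
    case 0
    then show ?case using assms(3) by (auto intro: exec.intros)
  next
    case (Suc j)
    let ?i = "n - Suc j"
    have i: "?i < n" "Suc ?i = n - j" using Suc.prems by auto
    have "exec B (b @ [While r b]) (S ?i) (S n)"
      using exec_append[OF assms(2)[OF i(1)], of "[While r b]" "S n"] Suc i(2) by simp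
    then show ?case using assms(1)[OF i(1)] by (intro exec_WhileT) auto
  qed
  from this[of n] show ?thesis by simp
qed

text \<open>Allows a size bound for a computed value to be read off from the mere existence of a
  run.\<close>

lemma exec_bound: "exec B p s s' \<Longrightarrow> s' r \<le> s r \<or> s' r < B"
  by (induction rule: exec.induct) (auto split: if_splits)

definition clear :: "nat \<Rightarrow> cmd list" where
  "clear r = [While r [Dec r]]"

lemma exec_Inc1: "s r + 1 < B \<Longrightarrow> exec B [Inc r] s (s(r := s r + 1))"
  by (rule exec_Inc) (auto intro: exec_Nil)

lemma exec_Dec1: "s r \<noteq> 0 \<Longrightarrow> exec B [Dec r] s (s(r := s r - 1))"
  by (cases "s r") (auto intro: exec_Dec exec_Nil)

lemma exec_clear: "exec B (clear r) s (s(r := 0))"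
proof -
  let ?S = "\<lambda>i. s(r := s r - i)"
  have "exec B [While r [Dec r]] (?S 0) (?S (s r))"
  proof (rule exec_While)
    fix i assume "i < s r"
    then show "?S i r \<noteq> 0" "exec B [Dec r] (?S i) (?S (Suc i))"
      using exec_Dec1[of "?S i" r B] by auto
  qed simp
  then show ?thesis by (simp add: clear_def)
qed

definition copy :: "nat \<Rightarrow> nat \<Rightarrow> nat \<Rightarrow> cmd list" where
  "copy r q t = clear q @ [While r [Dec r, Inc q, Inc t]] @ [While t [Dec t, Inc r]]"

lemma exec_copy:
  assumes "r \<noteq> q" "t \<noteq> r" "t \<noteq> q" "s t = 0" "s r < B"
  shows "exec B (copy r q t) s (s(q := s r))"
proof -
  let ?S = "\<lambda>i. s(q := i, r := s r - i, t := i)"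
  let ?T = "\<lambda>i. s(q := s r, r := i, t := s r - i)"
  have 1: "exec B (clear q) s (?S 0)" using exec_clear[of B q s] assms by (simp add: fun_upd_idem)
  have 2: "exec B [While r [Dec r, Inc q, Inc t]] (?S 0) (?S (s r))"
  proof (rule exec_While)
    fix i assume i: "i < s r"
    show "?S i r \<noteq> 0" using i assms by simp
    have "exec B ([Dec r] @ [Inc q] @ [Inc t]) (?S i) (s(q := Suc i, r := s r - Suc i, t := Suc i))"
      apply (rule exec_append[OF exec_Dec1])
      using i assms apply simp
      apply (rule exec_append[OF exec_Inc1])
      using i assms apply simp
      apply (rule back_subst[where P="exec B _ _", OF exec_Inc1])
      using i assms by (auto simp: fun_eq_iff)
    then show "exec B [Dec r, Inc q, Inc t] (?S i) (?S (Suc i))" by simp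
  qed (use assms in simp)
  have 3: "exec B [While t [Dec t, Inc r]] (?T 0) (?T (s r))"
  proof (rule exec_While)
    fix i assume i: "i < s r"
    show "?T i t \<noteq> 0" using i assms by simp
    have "exec B ([Dec t] @ [Inc r]) (?T i) (?T (Suc i))"
      apply (rule exec_append[OF exec_Dec1])
      using i assms apply simp
      apply (rule back_subst[where P="exec B _ _", OF exec_Inc1])
      using i assms by (auto simp: fun_eq_iff)
    then show "exec B [Dec t, Inc r] (?T i) (?T (Suc i))" by simp
  qed (use assms in simp)
  have e: "?S (s r) = ?T 0" "?T (s r) = s(q := s r)" using assms by (auto simp: fun_eq_iff)
  show ?thesis unfolding copy_def
    using exec_append[OF 1 exec_append[OF 2 3[folded e(1)]]] e(2) by simp
qed

text \<open>Bit length, with value 0 at 0.\<close>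

definition bl :: "nat \<Rightarrow> nat" where
  "bl x = (LEAST k. x < 2 ^ k)"

lemma bl_le_iff: "bl x \<le> k \<longleftrightarrow> x < 2 ^ k"
proof
  assume "bl x \<le> k"
  moreover have "x < 2 ^ bl x" unfolding bl_def by (rule LeastI[of _ x]) (rule less_exp)
  ultimately show "x < 2 ^ k" by (meson less_le_trans one_le_numeral power_increasing)
qed (auto simp: bl_def intro: Least_le)

lemma less_power_bl: "x < 2 ^ bl x"
  using bl_le_iff by blast

lemma bl_mono: "x \<le> y \<Longrightarrow> bl x \<le> bl y"
  unfolding bl_le_iff using less_power_bl le_less_trans by blast

text \<open>Total input length. The summand 2 lets a higher power absorb sums and constants.\<close>

definition env_size :: "('e \<Rightarrow> nat) list \<Rightarrow> 'e \<Rightarrow> nat" where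
  "env_size vs e = (\<Sum>v\<leftarrow>vs. bl (v e)) + 2"

lemma env_size_ge2: "2 \<le> env_size vs e"
  by (simp add: env_size_def)

lemma power_env_size_mono:
  assumes "k \<le> k'"
  shows "(2::nat) ^ (env_size vs e ^ k) \<le> 2 ^ (env_size vs e ^ k')"
proof -
  have "env_size vs e ^ k \<le> env_size vs e ^ k'"
    using assms env_size_ge2[of vs e] by (intro power_increasing) auto
  then show ?thesis by (rule power_increasing) simp
qed

lemma bl_var_le: "v \<in> set vs \<Longrightarrow> bl (v e) \<le> env_size vs e"
  unfolding env_size_def by (induction vs) auto

text \<open>The value itself, not its bit length, is polynomially bounded in the input length. A
  number has polynomially many bits when its \<open>bl\<close> is small.\<close>

definition small :: "('e \<Rightarrow> nat) list \<Rightarrow> ('e \<Rightarrow> nat) \<Rightarrow> bool" where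
  "small vs g \<longleftrightarrow> (\<exists>k. \<forall>e. g e \<le> env_size vs e ^ k)"

lemma smallD:
  assumes "small vs g"
  obtains k where "\<And>e k'. k \<le> k' \<Longrightarrow> g e \<le> env_size vs e ^ k'"
proof -
  obtain k where "\<And>e. g e \<le> env_size vs e ^ k" using assms by (auto simp: small_def)
  moreover have "env_size vs e ^ k \<le> env_size vs e ^ k'" if "k \<le> k'" for e k'
    using that env_size_ge2[of vs e] by (intro power_increasing) auto
  ultimately show ?thesis using that le_trans by blast
qed

lemma small_mono: "small vs g \<Longrightarrow> (\<And>e. f e \<le> g e) \<Longrightarrow> small vs f"
  unfolding small_def using le_trans by blast

lemma small_add:
  assumes "small vs f" "small vs g"
  shows "small vs (\<lambda>e. f e + g e)"
proof -
  obtain k l where k: "\<And>e k'. k \<le> k' \<Longrightarrow> f e \<le> env_size vs e ^ k'"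
    and l: "\<And>e k'. l \<le> k' \<Longrightarrow> g e \<le> env_size vs e ^ k'" using assms by (elim smallD) blast
  have "f e + g e \<le> env_size vs e ^ (k + l + 1)" for e
  proof -
    have "f e + g e \<le> 2 * env_size vs e ^ (k + l)" using k[of "k+l" e] l[of "k+l" e] by simp
    also have "\<dots> \<le> env_size vs e * env_size vs e ^ (k + l)" using env_size_ge2[of vs e] by (intro mult_right_mono) auto
    finally show ?thesis by simp
  qed
  then show ?thesis unfolding small_def by blast
qed

lemma small_mult:
  assumes "small vs f" "small vs g"
  shows "small vs (\<lambda>e. f e * g e)"
proof -
  obtain k l where k: "\<And>e. f e \<le> env_size vs e ^ k"
    and l: "\<And>e. g e \<le> env_size vs e ^ l" using assms unfolding small_def by blast
  have "f e * g e \<le> env_size vs e ^ (k + l)" for e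
    using mult_mono[OF k[of e] l[of e]] by (simp add: power_add)
  then show ?thesis unfolding small_def by blast
qed

lemma small_const: "small vs (\<lambda>e. c)"
proof -
  have "c \<le> env_size vs e ^ c" for e
    using power_mono[OF env_size_ge2[of vs e], of c] less_exp[of c] by linarith
  then show ?thesis unfolding small_def by blast
qed

lemma small_power: "small vs f \<Longrightarrow> small vs (\<lambda>e. f e ^ k)"
  by (induction k) (auto intro: small_mult small_const)

lemma small_bl_var: "v \<in> set vs \<Longrightarrow> small vs (\<lambda>e. bl (v e))"
  unfolding small_def using bl_var_le by (metis power_one_right)

lemma small_env_size: "(\<And>w. w \<in> set ws \<Longrightarrow> small vs (\<lambda>e. bl (w (\<sigma> e)))) \<Longrightarrow> small vs (\<lambda>e. env_size ws (\<sigma> e))"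
proof (induction ws)
  case Nil
  then show ?case by (simp add: env_size_def small_const)
next
  case (Cons w ws)
  have "env_size (w # ws) (\<sigma> e) = bl (w (\<sigma> e)) + env_size ws (\<sigma> e)" for e by (simp add: env_size_def)
  then show ?case using Cons by (simp add: small_add)
qed

lemma small_power_env_size: "(\<And>w. w \<in> set ws \<Longrightarrow> small vs (\<lambda>e. bl (w (\<sigma> e)))) \<Longrightarrow> small ws g \<Longrightarrow> small vs (\<lambda>e. g (\<sigma> e))"
proof -
  assume a: "\<And>w. w \<in> set ws \<Longrightarrow> small vs (\<lambda>e. bl (w (\<sigma> e)))" and "small ws g"
  then obtain k where "\<And>e. g e \<le> env_size ws e ^ k" unfolding small_def by blast
  then show ?thesis by (intro small_mono[OF small_power[OF small_env_size[OF a], where k=k]])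
qed

text \<open>Registers from b on are scratch space, zero before and after the run; the arguments are read
from the registers rs and the result goes to q, which may be one of them.\<close>

definition computes :: "nat \<Rightarrow> ('e \<Rightarrow> nat) list \<Rightarrow> ('e \<Rightarrow> nat) \<Rightarrow> nat list \<Rightarrow> nat \<Rightarrow> nat \<Rightarrow> cmd list \<Rightarrow> bool" where
  "computes k vs f rs q b P \<longleftrightarrow> (\<forall>s e B. map s rs = map (\<lambda>v. v e) vs \<longrightarrow> (\<forall>r\<ge>b. s r = 0) \<longrightarrow>
     2 ^ (env_size vs e ^ k) \<le> B \<longrightarrow> exec B P s (s(q := f e)))"

text \<open>The functions in vs play the role of variables on an abstract environment type, so that binding a
variable is pairing the environment with a number.\<close>

definition PS :: "('e \<Rightarrow> nat) list \<Rightarrow> ('e \<Rightarrow> nat) \<Rightarrow> bool" where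
  "PS vs f \<longleftrightarrow> (\<exists>k. \<forall>rs q b. length rs = length vs \<longrightarrow> (\<forall>r\<in>set rs. r < b) \<longrightarrow> q < b \<longrightarrow>
     (\<exists>P. computes k vs f rs q b P))"

lemma computesD:
  "computes k vs f rs q b P \<Longrightarrow> map s rs = map (\<lambda>v. v e) vs \<Longrightarrow> (\<And>r. b \<le> r \<Longrightarrow> s r = 0) \<Longrightarrow>
    2 ^ (env_size vs e ^ k) \<le> B \<Longrightarrow> exec B P s (s(q := f e))"
  unfolding computes_def by blast

lemma computes_mono: "computes k vs f rs q b P \<Longrightarrow> k \<le> k' \<Longrightarrow> computes k' vs f rs q b P"
proof -
  assume c: "computes k vs f rs q b P" and k: "k \<le> k'"
  from k have "(2::nat) ^ (env_size vs e ^ k) \<le> 2 ^ (env_size vs e ^ k')" for e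
    by (rule power_env_size_mono)
  then show ?thesis using c unfolding computes_def using le_trans by meson
qed

text \<open>The exponent is fixed before the registers are chosen and may be enlarged, so the parts
  of a compound program can share one exponent.\<close>

lemma PS_D:
  assumes "PS vs f"
  obtains k where "\<And>k' rs q b. k \<le> k' \<Longrightarrow> length rs = length vs \<Longrightarrow> (\<And>r. r \<in> set rs \<Longrightarrow> r < b) \<Longrightarrow> q < b \<Longrightarrow>
     \<exists>P. computes k' vs f rs q b P"
  using assms unfolding PS_def using computes_mono by metis

text \<open>Run the program with a result register that starts at 0: its final value is then below
  the increment bound. Thus no size bounds have to be carried through compositions.\<close>

lemma PS_small:
  assumes "PS vs f"
  shows "small vs (\<lambda>e. bl (f e))"
proof -
  obtain k where k: "\<And>k' rs q b. k \<le> k' \<Longrightarrow> length rs = length vs \<Longrightarrow> (\<And>r. r \<in> set rs \<Longrightarrow> r < b) \<Longrightarrow> q < b \<Longrightarrow>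
     \<exists>P. computes k' vs f rs q b P" by (rule PS_D[OF assms]) blast
  let ?n = "length vs"
  obtain P where P: "computes k vs f [0..<?n] ?n (?n + 1) P" using k[of k "[0..<?n]" "?n+1" ?n] by auto
  have "bl (f e) \<le> env_size vs e ^ k" for e
  proof -
    let ?s = "\<lambda>r. if r < ?n then (vs ! r) e else 0"
    have "exec (2 ^ (env_size vs e ^ k)) P ?s (?s(?n := f e))"
      by (rule computesD[OF P]) (auto intro: nth_equalityI)
    from exec_bound[OF this, of ?n] show ?thesis by (auto simp: bl_le_iff)
  qed
  then show ?thesis unfolding small_def by blast
qed

lemma PS_I:
  assumes "\<And>rs q b. length rs = length vs \<Longrightarrow> (\<And>r. r \<in> set rs \<Longrightarrow> r < b) \<Longrightarrow> q < b \<Longrightarrow>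
     \<exists>P. \<forall>s e B. map s rs = map (\<lambda>v. v e) vs \<longrightarrow> (\<forall>r\<ge>b. s r = 0) \<longrightarrow> 2 ^ (env_size vs e ^ k) \<le> B \<longrightarrow>
        exec B P s (s((q::nat) := f e))"
  shows "PS vs f"
  unfolding PS_def computes_def using assms by blast

lemma PS_zero: "PS vs (\<lambda>e. 0)"
  by (rule PS_I) (auto intro: exec_clear)

lemma PS_var:
  assumes "v \<in> set vs"
  shows "PS vs v"
proof (rule PS_I[where k=1])
  fix rs :: "nat list" and q b :: nat assume rs: "length rs = length vs" "\<And>r. r \<in> set rs \<Longrightarrow> r < b" "q < b"
  obtain i where i: "i < length vs" "vs ! i = v" using assms by (auto simp: in_set_conv_nth)
  let ?r = "rs ! i"
  have r: "?r < b" using rs i by simp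
  show "\<exists>P. \<forall>s e B. map s rs = map (\<lambda>v. v e) vs \<longrightarrow> (\<forall>r\<ge>b. s r = 0) \<longrightarrow> 2 ^ (env_size vs e ^ 1) \<le> B \<longrightarrow>
        exec B P s (s(q := v e))"
  proof (intro exI[of _ "if ?r = q then [] else copy ?r q b"] allI impI)
    fix s e B assume s: "map s rs = map (\<lambda>v. v e) vs" "\<forall>r\<ge>b. s r = 0" "2 ^ (env_size vs e ^ 1) \<le> (B::nat)"
    have v: "s ?r = v e" using arg_cong[OF s(1), of "\<lambda>l. l ! i"] i rs(1) by simp
    have "bl (v e) \<le> env_size vs e" by (rule bl_var_le[OF assms])
    then have "v e < 2 ^ env_size vs e" by (simp only: bl_le_iff)
    then have vB: "v e < B" using s(3) by simp
    show "exec B (if ?r = q then [] else copy ?r q b) s (s(q := v e))"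
    proof (cases "?r = q")
      case True
      then have "s(q := v e) = s" using v by (metis fun_upd_triv)
      then show ?thesis using True exec_Nil by simp
    next
      case False
      then show ?thesis using exec_copy[of ?r q b s B] v vB r rs(3) s(2) by simp
    qed
  qed
qed

lemma PS_Suc:
  assumes "PS vs f"
  shows "PS vs (\<lambda>e. Suc (f e))"
proof -
  obtain k where k: "\<And>k' rs q b. k \<le> k' \<Longrightarrow> length rs = length vs \<Longrightarrow> (\<And>r. r \<in> set rs \<Longrightarrow> r < b) \<Longrightarrow> q < b \<Longrightarrow>
     \<exists>P. computes k' vs f rs q b P" by (rule PS_D[OF assms]) blast
  obtain l where l: "\<And>e k'. l \<le> k' \<Longrightarrow> bl (f e) + 1 \<le> env_size vs e ^ k'"
    using small_add[OF PS_small[OF assms] small_const[of _ 1]] by (elim smallD) blast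
  show ?thesis
  proof (rule PS_I[where k="k + l"])
    fix rs :: "nat list" and q b :: nat assume rs: "length rs = length vs" "\<And>r. r \<in> set rs \<Longrightarrow> r < b" "q < b"
    obtain P where P: "computes (k + l) vs f rs q b P" using k[of "k+l", OF _ rs] by auto
    show "\<exists>P. \<forall>s e B. map s rs = map (\<lambda>v. v e) vs \<longrightarrow> (\<forall>r\<ge>b. s r = 0) \<longrightarrow> 2 ^ (env_size vs e ^ (k + l)) \<le> B \<longrightarrow>
        exec B P s (s(q := Suc (f e)))"
    proof (intro exI[of _ "P @ [Inc q]"] allI impI)
      fix s e B assume s: "map s rs = map (\<lambda>v. v e) vs" "\<forall>r\<ge>b. s r = 0" "2 ^ (env_size vs e ^ (k + l)) \<le> (B::nat)"
      have 1: "exec B P s (s(q := f e))" using computesD[OF P s(1) _ s(3)] s(2) by blast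
      have "f e < 2 ^ bl (f e)" by (rule less_power_bl)
      then have "f e + 1 < 2 ^ (bl (f e) + 1)" by simp
      also have "\<dots> \<le> 2 ^ (env_size vs e ^ (k + l))" using l[of "k+l" e] by (intro power_increasing) auto
      finally have "exec B [Inc q] (s(q := f e)) (s(q := Suc (f e)))"
        using exec_Inc1[of "s(q := f e)" q B] s(3) by simp
      then show "exec B (P @ [Inc q]) s (s(q := Suc (f e)))" using exec_append[OF 1] by blast
    qed
  qed
qed

text \<open>The values go to consecutive scratch registers from b on; after each one the scratch
  area of the remaining programs starts one register later.\<close>

lemma exec_multi:
  assumes "\<And>w. w \<in> set ws \<Longrightarrow> PS vs (\<lambda>e. w (\<sigma> e))"
  shows "\<exists>k. \<forall>rs (b::nat). length rs = length vs \<longrightarrow> (\<forall>r\<in>set rs. r < b) \<longrightarrow>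
    (\<exists>P. \<forall>s e B. map s rs = map (\<lambda>v. v e) vs \<longrightarrow> (\<forall>r\<ge>b. s r = 0) \<longrightarrow> 2 ^ (env_size vs e ^ k) \<le> B \<longrightarrow>
      exec B P s (\<lambda>r. if b \<le> r \<and> r < b + length ws then (ws ! (r - b)) (\<sigma> e) else s r))"
  using assms
proof (induction ws)
  case Nil
  show ?case
  proof (rule exI[of _ 0], intro allI impI, rule exI[of _ "[]"], intro allI impI, rule exec_eq)
    fix b r :: nat and s :: "nat \<Rightarrow> nat" and e
    show "(if b \<le> r \<and> r < b + length [] then ([] ! (r - b)) (\<sigma> e) else s r) = s r" by simp
  qed
next
  case (Cons w ws)
  obtain k where k: "\<And>k' rs q b. k \<le> k' \<Longrightarrow> length rs = length vs \<Longrightarrow> (\<And>r. r \<in> set rs \<Longrightarrow> r < b) \<Longrightarrow> q < b \<Longrightarrow>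
     \<exists>P. computes k' vs (\<lambda>e. w (\<sigma> e)) rs q b P" by (rule PS_D[OF Cons.prems[of w]]) (simp, blast)
  have "\<exists>l. \<forall>rs (b::nat). length rs = length vs \<longrightarrow> (\<forall>r\<in>set rs. r < b) \<longrightarrow>
    (\<exists>P. \<forall>s e B. map s rs = map (\<lambda>v. v e) vs \<longrightarrow> (\<forall>r\<ge>b. s r = 0) \<longrightarrow> 2 ^ (env_size vs e ^ l) \<le> B \<longrightarrow>
      exec B P s (\<lambda>r. if b \<le> r \<and> r < b + length ws then (ws ! (r - b)) (\<sigma> e) else s r))"
    by (rule Cons.IH) (use Cons.prems in simp)
  then obtain l where l: "\<forall>rs (b::nat). length rs = length vs \<longrightarrow> (\<forall>r\<in>set rs. r < b) \<longrightarrow>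
    (\<exists>P. \<forall>s e B. map s rs = map (\<lambda>v. v e) vs \<longrightarrow> (\<forall>r\<ge>b. s r = 0) \<longrightarrow> 2 ^ (env_size vs e ^ l) \<le> B \<longrightarrow>
      exec B P s (\<lambda>r. if b \<le> r \<and> r < b + length ws then (ws ! (r - b)) (\<sigma> e) else s r))"
    by (elim exE) (rule that)
  show ?case
  proof (intro exI[of _ "k + l"] allI impI)
    fix rs :: "nat list" and b :: nat assume rs: "length rs = length vs" "\<forall>r\<in>set rs. r < b"
    then have rs': "\<And>r. r \<in> set rs \<Longrightarrow> r < b + 1" by fastforce
    obtain P where P: "computes (k + l) vs (\<lambda>e. w (\<sigma> e)) rs b (b + 1) P"
      using k[of "k + l", OF _ rs(1) rs', of b] by auto
    obtain Q where Q: "\<And>s e B. map s rs = map (\<lambda>v. v e) vs \<Longrightarrow> (\<forall>r\<ge>b+1. s r = 0) \<Longrightarrow> 2 ^ (env_size vs e ^ l) \<le> B \<Longrightarrow>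
      exec B Q s (\<lambda>r. if b + 1 \<le> r \<and> r < b + 1 + length ws then (ws ! (r - (b + 1))) (\<sigma> e) else s r)"
      using l[rule_format, of rs "b + 1", OF rs(1) rs'] by blast
    show "\<exists>P. \<forall>s e B. map s rs = map (\<lambda>v. v e) vs \<longrightarrow> (\<forall>r\<ge>b. s r = 0) \<longrightarrow> 2 ^ (env_size vs e ^ (k + l)) \<le> B \<longrightarrow>
      exec B P s (\<lambda>r. if b \<le> r \<and> r < b + length (w # ws) then ((w # ws) ! (r - b)) (\<sigma> e) else s r)"
    proof (intro exI[of _ "P @ Q"] allI impI)
      fix s e B assume s: "map s rs = map (\<lambda>v. v e) vs" "\<forall>r\<ge>b. s r = 0" "2 ^ (env_size vs e ^ (k + l)) \<le> (B::nat)"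
      let ?s = "s(b := w (\<sigma> e))"
      have 1: "exec B P s ?s" using computesD[OF P s(1) _ s(3)] s(2) by simp
      have "map ?s rs = map s rs" using rs(2) by auto
      then have m: "map ?s rs = map (\<lambda>v. v e) vs" using s(1) by simp
      have "(2::nat) ^ (env_size vs e ^ l) \<le> 2 ^ (env_size vs e ^ (k + l))"
        by (rule power_env_size_mono) simp
      then have B: "2 ^ (env_size vs e ^ l) \<le> B" using s(3) by linarith
      have 2: "exec B Q ?s (\<lambda>r. if b + 1 \<le> r \<and> r < b + 1 + length ws then (ws ! (r - (b + 1))) (\<sigma> e) else ?s r)"
        by (rule Q[OF m _ B]) (use s(2) in simp)
      have "(\<lambda>r. if b + 1 \<le> r \<and> r < b + 1 + length ws then (ws ! (r - (b + 1))) (\<sigma> e) else ?s r) =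
        (\<lambda>r. if b \<le> r \<and> r < b + length (w # ws) then ((w # ws) ! (r - b)) (\<sigma> e) else s r)"
      proof
        fix r
        consider "r < b" | "r = b" | j where "r = Suc (b + j)" by (metis less_imp_Suc_add linorder_neqE_nat)
        then show "(if b + 1 \<le> r \<and> r < b + 1 + length ws then (ws ! (r - (b + 1))) (\<sigma> e) else ?s r) =
          (if b \<le> r \<and> r < b + length (w # ws) then ((w # ws) ! (r - b)) (\<sigma> e) else s r)"
        proof cases
          case 3
          then have "r - b = Suc j" "r - (b + 1) = j" by auto
          then show ?thesis using 3 by simp
        qed auto
      qed
      then show "exec B (P @ Q) s (\<lambda>r. if b \<le> r \<and> r < b + length (w # ws) then ((w # ws) ! (r - b)) (\<sigma> e) else s r)"
        using exec_append[OF 1 2] by simp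
    qed
  qed
qed

lemma exec_clears: "exec B (concat (map clear [b..<b+m])) s (\<lambda>r. if b \<le> r \<and> r < b + m then 0 else s r)"
proof (induction m)
  case 0
  then show ?case by (auto intro: exec_eq)
next
  case (Suc m)
  have "(\<lambda>r. if b \<le> r \<and> r < b + m then 0 else s r)(b + m := 0) = (\<lambda>r. if b \<le> r \<and> r < b + Suc m then 0 else s r)"
    by (auto simp: fun_eq_iff)
  then show ?case using exec_append[OF Suc exec_clear[of B "b + m"]] by simp
qed

text \<open>\<open>\<sigma>\<close> turns the outer environment into the one on which h works. By
  \<open>PS_small\<close> the inner environment has size polynomial in the outer one, and
  polynomials compose.\<close>

lemma PS_comp:
  assumes h: "PS ws h" and w: "\<And>w. w \<in> set ws \<Longrightarrow> PS vs (\<lambda>e. w (\<sigma> e))"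
  shows "PS vs (\<lambda>e. h (\<sigma> e))"
proof -
  obtain k where k: "\<And>rs q b. length rs = length ws \<Longrightarrow> (\<And>r. r \<in> set rs \<Longrightarrow> r < b) \<Longrightarrow> q < b \<Longrightarrow>
     \<exists>P. computes k ws h rs q b P" using PS_D[OF h] by (metis le_refl)
  have "\<exists>l. \<forall>rs (b::nat). length rs = length vs \<longrightarrow> (\<forall>r\<in>set rs. r < b) \<longrightarrow>
    (\<exists>P. \<forall>s e B. map s rs = map (\<lambda>v. v e) vs \<longrightarrow> (\<forall>r\<ge>b. s r = 0) \<longrightarrow> 2 ^ (env_size vs e ^ l) \<le> B \<longrightarrow>
      exec B P s (\<lambda>r. if b \<le> r \<and> r < b + length ws then (ws ! (r - b)) (\<sigma> e) else s r))"
    by (rule exec_multi) (rule w)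
  then obtain l where l: "\<forall>rs (b::nat). length rs = length vs \<longrightarrow> (\<forall>r\<in>set rs. r < b) \<longrightarrow>
    (\<exists>P. \<forall>s e B. map s rs = map (\<lambda>v. v e) vs \<longrightarrow> (\<forall>r\<ge>b. s r = 0) \<longrightarrow> 2 ^ (env_size vs e ^ l) \<le> B \<longrightarrow>
      exec B P s (\<lambda>r. if b \<le> r \<and> r < b + length ws then (ws ! (r - b)) (\<sigma> e) else s r))"
    by (elim exE) (rule that)
  obtain m where m: "\<And>e k'. m \<le> k' \<Longrightarrow> env_size ws (\<sigma> e) ^ k \<le> env_size vs e ^ k'"
  proof -
    have "small vs (\<lambda>e. env_size ws (\<sigma> e) ^ k)"
      by (intro small_power small_env_size PS_small w)
    then show ?thesis using that by (elim smallD) blast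
  qed
  show ?thesis
  proof (rule PS_I[where k="l + m"])
    fix rs :: "nat list" and q b :: nat assume rs: "length rs = length vs" "\<And>r. r \<in> set rs \<Longrightarrow> r < b" "q < b"
    let ?n = "length ws"
    obtain P where P: "\<And>s e B. map s rs = map (\<lambda>v. v e) vs \<Longrightarrow> (\<forall>r\<ge>b. s r = 0) \<Longrightarrow> 2 ^ (env_size vs e ^ l) \<le> B \<Longrightarrow>
      exec B P s (\<lambda>r. if b \<le> r \<and> r < b + ?n then (ws ! (r - b)) (\<sigma> e) else s r)"
      using l[rule_format, OF rs(1,2)] by blast
    obtain Q where Q: "computes k ws h [b..<b + ?n] q (b + ?n) Q" using k[of "[b..<b + ?n]" "b + ?n" q] rs(3) by auto
    show "\<exists>P. \<forall>s e B. map s rs = map (\<lambda>v. v e) vs \<longrightarrow> (\<forall>r\<ge>b. s r = 0) \<longrightarrow> 2 ^ (env_size vs e ^ (l + m)) \<le> B \<longrightarrow>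
        exec B P s (s(q := h (\<sigma> e)))"
    proof (intro exI[of _ "P @ Q @ concat (map clear [b..<b + ?n])"] allI impI)
      fix s e B assume s: "map s rs = map (\<lambda>v. v e) vs" "\<forall>r\<ge>b. s r = 0" "2 ^ (env_size vs e ^ (l + m)) \<le> (B::nat)"
      let ?s = "\<lambda>r. if b \<le> r \<and> r < b + ?n then (ws ! (r - b)) (\<sigma> e) else s r"
      have "(2::nat) ^ (env_size vs e ^ l) \<le> 2 ^ (env_size vs e ^ (l + m))"
        by (rule power_env_size_mono) simp
      then have 1: "exec B P s ?s" using P[OF s(1,2), of B] s(3) by linarith
      have "(2::nat) ^ (env_size ws (\<sigma> e) ^ k) \<le> 2 ^ (env_size vs e ^ (l + m))" using m[of "l + m" e] by (intro power_increasing) auto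
      then have B: "2 ^ (env_size ws (\<sigma> e) ^ k) \<le> B" using s(3) by linarith
      have 2: "exec B Q ?s (?s(q := h (\<sigma> e)))"
        by (rule computesD[OF Q _ _ B]) (use s(2) in \<open>auto intro!: nth_equalityI\<close>)
      have "(\<lambda>r. if b \<le> r \<and> r < b + ?n then 0 else (?s(q := h (\<sigma> e))) r) = s(q := h (\<sigma> e))"
        using s(2) rs(3) by (auto simp: fun_eq_iff)
      then show "exec B (P @ Q @ concat (map clear [b..<b + ?n])) s (s(q := h (\<sigma> e)))"
        using exec_append[OF 1 exec_append[OF 2 exec_clears[of B b ?n]]] by simp
    qed
  qed
qed

text \<open>Recursion in which only the lengths of the intermediate values are restricted; n may be
  exponential in the input length, as time does not count. Registers b, b + 1 and b + 2 hold the
  remaining rounds, the index and the accumulator.\<close>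

lemma PS_rec:
  fixes F :: "nat \<Rightarrow> 'e \<Rightarrow> nat"
  assumes n: "PS vs n" and g: "PS vs g"
    and h: "PS ((\<lambda>x. fst x) # (\<lambda>x. fst (snd x)) # map (\<lambda>v x. v (snd (snd x))) vs) h"
    and F0: "\<And>e. F 0 e = g e" and FS: "\<And>i e. F (Suc i) e = h (i, F i e, e)"
    and bd: "small vs bd" "\<And>i e. i \<le> n e \<Longrightarrow> bl (F i e) \<le> bd e"
  shows "PS vs (\<lambda>e. F (n e) e)"
proof -
  let ?hv = "(\<lambda>x. fst x) # (\<lambda>x. fst (snd x)) # map (\<lambda>v x. v (snd (snd x))) vs"
  obtain kn where kn: "\<And>k' rs q b. kn \<le> k' \<Longrightarrow> length rs = length vs \<Longrightarrow> (\<And>r. r \<in> set rs \<Longrightarrow> r < b) \<Longrightarrow> q < b \<Longrightarrow>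
     \<exists>P. computes k' vs n rs q b P" by (rule PS_D[OF n]) blast
  obtain kg where kg: "\<And>k' rs q b. kg \<le> k' \<Longrightarrow> length rs = length vs \<Longrightarrow> (\<And>r. r \<in> set rs \<Longrightarrow> r < b) \<Longrightarrow> q < b \<Longrightarrow>
     \<exists>P. computes k' vs g rs q b P" by (rule PS_D[OF g]) blast
  obtain kh where kh: "\<And>rs q b. length rs = length ?hv \<Longrightarrow> (\<And>r. r \<in> set rs \<Longrightarrow> r < b) \<Longrightarrow> q < b \<Longrightarrow>
     \<exists>P. computes kh ?hv h rs q b P" using PS_D[OF h] by (metis le_refl)
  \<comment> \<open>Dominates the size of every environment \<open>(i, F i e, e)\<close> in which h
    is run.\<close>
  define sz where "sz e = bl (n e) + bd e + env_size vs e" for e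
  have "small vs (\<lambda>e. env_size vs e)" unfolding small_def by (metis le_refl power_one_right)
  then have "small vs (\<lambda>e. sz e)" unfolding sz_def by (intro small_add PS_small n bd)
  then have "small vs (\<lambda>e. sz e ^ kh + sz e)" by (intro small_add small_power)
  then obtain m where m: "\<And>e k'. m \<le> k' \<Longrightarrow> sz e ^ kh + sz e \<le> env_size vs e ^ k'" by (elim smallD) blast
  let ?k = "kn + kg + m"
  show ?thesis
  proof (rule PS_I[where k="?k"])
    fix rs :: "nat list" and q b :: nat assume rs: "length rs = length vs" "\<And>r. r \<in> set rs \<Longrightarrow> r < b" "q < b"
    have rs3: "r < b + 3" if "r \<in> set rs" for r using rs(2)[OF that] by simp
    have hr: "r < b + 3" if "r \<in> set ((b + 1) # (b + 2) # rs)" for r using that rs3 by auto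
    obtain Pn where Pn: "computes ?k vs n rs b (b + 3) Pn" using kn[of ?k, OF _ rs(1) rs3, of b] by auto
    obtain Pg where Pg: "computes ?k vs g rs (b + 2) (b + 3) Pg" using kg[of ?k, OF _ rs(1) rs3, of "b + 2"] by auto
    obtain Ph where Ph: "computes kh ?hv h ((b + 1) # (b + 2) # rs) (b + 2) (b + 3) Ph"
      using kh[where rs="(b + 1) # (b + 2) # rs" and q="b + 2", OF _ hr] rs(1) by auto
    \<comment> \<open>The result is copied to q only at the end, because q may be an argument
      register and the arguments are read in every round.\<close>
    let ?P = "Pn @ Pg @ [While b (Ph @ [Dec b] @ [Inc (b + 1)])] @ copy (b + 2) q (b + 3) @ clear (b + 1) @ clear (b + 2)"
    show "\<exists>P. \<forall>s e B. map s rs = map (\<lambda>v. v e) vs \<longrightarrow> (\<forall>r\<ge>b. s r = 0) \<longrightarrow> 2 ^ (env_size vs e ^ ?k) \<le> B \<longrightarrow>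
        exec B P s (s(q := F (n e) e))"
    proof (intro exI[of _ ?P] allI impI)
      fix s e B assume s: "map s rs = map (\<lambda>v. v e) vs" "\<forall>r\<ge>b. s r = 0" "2 ^ (env_size vs e ^ ?k) \<le> (B::nat)"
      have szB: "2 ^ (sz e ^ kh) \<le> B" "2 ^ (sz e) \<le> B"
      proof -
        have "sz e ^ kh + sz e \<le> env_size vs e ^ ?k" using m[of ?k e] by simp
        then have "(2::nat) ^ (sz e ^ kh) \<le> 2 ^ (env_size vs e ^ ?k)" "(2::nat) ^ sz e \<le> 2 ^ (env_size vs e ^ ?k)"
          by (auto intro!: power_increasing)
        then show "2 ^ (sz e ^ kh) \<le> B" "2 ^ (sz e) \<le> B" using s(3) by linarith+
      qed
      have FB: "F i e < B" if "i \<le> n e" for i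
      proof -
        have "bl (F i e) \<le> sz e" using bd(2)[OF that] by (simp add: sz_def)
        then show ?thesis using szB(2) by (simp add: bl_le_iff)
      qed
      have nB: "n e < B"
      proof -
        have "bl (n e) \<le> sz e" by (simp add: sz_def)
        then show ?thesis using szB(2) by (simp add: bl_le_iff)
      qed
      let ?S = "\<lambda>i. s(b := n e - i, b + 1 := i, b + 2 := F i e)"
      have mp: "map (s(b := x, b + 1 := y, b + 2 := z)) rs = map (\<lambda>v. v e) vs" for x y z
      proof -
        have "map (s(b := x, b + 1 := y, b + 2 := z)) rs = map s rs" using rs(2) by fastforce
        then show ?thesis using s(1) by simp
      qed
      have 1: "exec B Pn s (s(b := n e))"
        by (rule computesD[OF Pn s(1) _ s(3)]) (use s(2) in simp)
      have sb: "s(b := n e) = s(b := n e, b + 1 := 0, b + 2 := 0)" using s(2) by (auto simp: fun_eq_iff)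
      have "exec B Pg (s(b := n e)) ((s(b := n e))(b + 2 := g e))"
        by (rule computesD[OF Pg _ _ s(3)]) (use s(2) mp[of "n e" 0 0] sb in auto)
      moreover have "(s(b := n e))(b + 2 := g e) = ?S 0" using s(2) by (auto simp: fun_eq_iff F0)
      ultimately have 2: "exec B Pg (s(b := n e)) (?S 0)" by simp
      have 3: "exec B [While b (Ph @ [Dec b] @ [Inc (b + 1)])] (?S 0) (?S (n e))"
      proof (rule exec_While)
        fix i assume i: "i < n e"
        show "?S i b \<noteq> 0" using i by simp
        have "exec B Ph (?S i) ((?S i)(b + 2 := h (i, F i e, e)))"
        proof (rule computesD[OF Ph])
          show "map (?S i) ((b + 1) # (b + 2) # rs) = map (\<lambda>v. v (i, F i e, e)) ?hv" using mp by simp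
          show "?S i r = 0" if "b + 3 \<le> r" for r using that s(2) by auto
          have "env_size ?hv (i, F i e, e) = bl i + bl (F i e) + env_size vs e" by (simp add: env_size_def o_def)
          also have "\<dots> \<le> sz e" unfolding sz_def using bl_mono[of i "n e"] bd(2)[of i e] i by simp
          finally have "env_size ?hv (i, F i e, e) ^ kh \<le> sz e ^ kh" by (intro power_mono) auto
          then have "(2::nat) ^ (env_size ?hv (i, F i e, e) ^ kh) \<le> 2 ^ (sz e ^ kh)" by (intro power_increasing) auto
          then show "2 ^ (env_size ?hv (i, F i e, e) ^ kh) \<le> B" using szB(1) by linarith
        qed
        then have a: "exec B Ph (?S i) ((?S i)(b + 2 := F (Suc i) e))" by (simp add: FS)
        have b: "exec B [Dec b] ((?S i)(b + 2 := F (Suc i) e)) (s(b := n e - Suc i, b + 1 := i, b + 2 := F (Suc i) e))"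
          by (rule back_subst[where P="exec B _ _", OF exec_Dec1]) (use i in \<open>auto simp: fun_eq_iff\<close>)
        have c: "exec B [Inc (b + 1)] (s(b := n e - Suc i, b + 1 := i, b + 2 := F (Suc i) e)) (?S (Suc i))"
          by (rule back_subst[where P="exec B _ _", OF exec_Inc1]) (use i nB in \<open>auto simp: fun_eq_iff\<close>)
        show "exec B (Ph @ [Dec b] @ [Inc (b + 1)]) (?S i) (?S (Suc i))"
          by (rule exec_append[OF a exec_append[OF b c]])
      qed simp
      have 4: "exec B (copy (b + 2) q (b + 3)) (?S (n e)) ((?S (n e))(q := F (n e) e))"
        using exec_copy[of "b + 2" q "b + 3" "?S (n e)" B] rs(3) s(2) FB[of "n e"] by simp
      have 5: "exec B (clear (b + 1) @ clear (b + 2)) ((?S (n e))(q := F (n e) e)) (((?S (n e))(q := F (n e) e))(b + 1 := 0, b + 2 := 0))"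
        by (rule exec_append[OF exec_clear exec_clear])
      have e: "((?S (n e))(q := F (n e) e))(b + 1 := 0, b + 2 := 0) = s(q := F (n e) e)"
        using s(2) rs(3) by (auto simp: fun_eq_iff)
      show "exec B ?P s (s(q := F (n e) e))"
        using exec_append[OF 1 exec_append[OF 2 exec_append[OF 3 exec_append[OF 4 5]]]] e by simp
    qed
  qed
qed

lemma PS_cong: "PS vs f \<Longrightarrow> (\<And>e. g e = f e) \<Longrightarrow> PS vs g"
  by (metis ext)

lemma PS_comp1: "PS [\<lambda>x. x] F \<Longrightarrow> PS vs a \<Longrightarrow> PS vs (\<lambda>e. F (a e))"
  by (rule PS_comp[where h=F and \<sigma>="\<lambda>e. a e"]) auto

lemma PS_comp2:
  assumes "PS [\<lambda>x. fst x, \<lambda>x. snd x] (\<lambda>x. F (fst x) (snd x))" "PS vs a" "PS vs b"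
  shows "PS vs (\<lambda>e. F (a e) (b e))"
proof -
  have "PS vs (\<lambda>e. (\<lambda>x. F (fst x) (snd x)) (a e, b e))"
    by (rule PS_comp[OF assms(1)]) (use assms in auto)
  then show ?thesis by simp
qed

lemma PS_comp3:
  assumes "PS [\<lambda>x. fst x, \<lambda>x. fst (snd x), \<lambda>x. snd (snd x)] (\<lambda>x. F (fst x) (fst (snd x)) (snd (snd x)))"
    "PS vs a" "PS vs b" "PS vs c"
  shows "PS vs (\<lambda>e. F (a e) (b e) (c e))"
proof -
  have "PS vs (\<lambda>e. (\<lambda>x. F (fst x) (fst (snd x)) (snd (snd x))) (a e, b e, c e))"
    by (rule PS_comp[OF assms(1)]) (use assms in auto)
  then show ?thesis by simp
qed

lemma PS_comp4:
  assumes "PS [\<lambda>x. fst x, \<lambda>x. fst (snd x), \<lambda>x. fst (snd (snd x)), \<lambda>x. snd (snd (snd x))]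
      (\<lambda>x. F (fst x) (fst (snd x)) (fst (snd (snd x))) (snd (snd (snd x))))"
    "PS vs a" "PS vs b" "PS vs c" "PS vs d"
  shows "PS vs (\<lambda>e. F (a e) (b e) (c e) (d e))"
proof -
  have "PS vs (\<lambda>e. (\<lambda>x. F (fst x) (fst (snd x)) (fst (snd (snd x))) (snd (snd (snd x)))) (a e, b e, c e, d e))"
    by (rule PS_comp[OF assms(1)]) (use assms in auto)
  then show ?thesis by simp
qed

lemma PS_comp5:
  assumes "PS [\<lambda>x. fst x, \<lambda>x. fst (snd x), \<lambda>x. fst (snd (snd x)), \<lambda>x. fst (snd (snd (snd x))), \<lambda>x. snd (snd (snd (snd x)))]
      (\<lambda>x. F (fst x) (fst (snd x)) (fst (snd (snd x))) (fst (snd (snd (snd x)))) (snd (snd (snd (snd x)))))"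
    "PS vs a" "PS vs b" "PS vs c" "PS vs d" "PS vs f"
  shows "PS vs (\<lambda>e. F (a e) (b e) (c e) (d e) (f e))"
proof -
  have "PS vs (\<lambda>e. (\<lambda>x. F (fst x) (fst (snd x)) (fst (snd (snd x))) (fst (snd (snd (snd x)))) (snd (snd (snd (snd x))))) (a e, b e, c e, d e, f e))"
    by (rule PS_comp[OF assms(1)]) (use assms in auto)
  then show ?thesis by simp
qed

section \<open>Arithmetic, bounded quantifiers and bounded search\<close>

named_theorems PS_intros

lemma PS_const [PS_intros]: "PS vs (\<lambda>e. c)"
  by (induction c) (auto intro: PS_zero PS_Suc)

declare PS_Suc [PS_intros]

lemma bl_add: "bl (x + y) \<le> bl x + bl y + 1"
  unfolding bl_le_iff
proof -
  have "x + y < 2 ^ bl x + 2 ^ bl y" using less_power_bl[of x] less_power_bl[of y] by linarith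
  also have "\<dots> \<le> 2 ^ (bl x + bl y) + 2 ^ (bl x + bl y)" by (intro add_mono power_increasing) auto
  finally show "x + y < 2 ^ (bl x + bl y + 1)" by simp
qed

lemma bl_mult: "bl (x * y) \<le> bl x + bl y"
  unfolding bl_le_iff power_add by (rule mult_strict_mono) (auto simp: less_power_bl)

lemma small_bl: "PS vs f \<Longrightarrow> small vs (\<lambda>e. bl (f e))"
  by (rule PS_small)

lemma PS_add [PS_intros]: "PS vs a \<Longrightarrow> PS vs b \<Longrightarrow> PS vs (\<lambda>e. a e + b e)"
proof (rule PS_comp2[where F="(+)"])
  let ?vs = "[\<lambda>x. fst x, \<lambda>x. snd x] :: (nat \<times> nat \<Rightarrow> nat) list"
  show "PS ?vs (\<lambda>x. fst x + snd x)"
  proof (rule PS_rec[where F="\<lambda>i e. fst e + i" and h="\<lambda>x. Suc (fst (snd x))" and g=fst])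
    show "small ?vs (\<lambda>e. bl (fst e) + bl (snd e) + 1)"
      by (intro small_add small_bl small_const PS_var) simp_all
    show "bl (fst e + i) \<le> bl (fst e) + bl (snd e) + 1" if "i \<le> snd e" for i and e :: "nat \<times> nat"
      using bl_add[of "fst e" "snd e"] bl_mono[of "fst e + i" "fst e + snd e"] that by linarith
  qed (((rule PS_var, (simp; fail)) | rule PS_intros | simp)+)
qed auto

lemma PS_pred: "PS vs a \<Longrightarrow> PS vs (\<lambda>e. a e - 1)"
proof (rule PS_comp1[where F="\<lambda>x. x - 1"])
  let ?vs = "[\<lambda>x. x] :: (nat \<Rightarrow> nat) list"
  show "PS ?vs (\<lambda>x. x - 1)"
  proof (rule PS_rec[where F="\<lambda>i e. i - 1" and h="\<lambda>x. fst x" and g="\<lambda>e. 0"])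
    show "small ?vs (\<lambda>e. bl e)" by (intro small_bl PS_var) simp
    show "bl (i - 1) \<le> bl e" if "i \<le> e" for i e using that by (intro bl_mono) simp
  qed (auto intro!: PS_zero PS_var)
qed auto

lemma PS_diff [PS_intros]: "PS vs a \<Longrightarrow> PS vs b \<Longrightarrow> PS vs (\<lambda>e. a e - b e)"
proof (rule PS_comp2[where F="(-)"])
  let ?vs = "[\<lambda>x. fst x, \<lambda>x. snd x] :: (nat \<times> nat \<Rightarrow> nat) list"
  show "PS ?vs (\<lambda>x. fst x - snd x)"
  proof (rule PS_rec[where F="\<lambda>i e. fst e - i" and h="\<lambda>x. fst (snd x) - 1" and g=fst])
    show "small ?vs (\<lambda>e. bl (fst e))" by (intro small_bl PS_var) simp
    show "bl (fst e - i) \<le> bl (fst e)" for i and e :: "nat \<times> nat" by (intro bl_mono) simp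
  qed (((rule PS_var, (simp; fail)) | rule PS_pred PS_intros | simp)+)
qed auto

lemma PS_mult [PS_intros]: "PS vs a \<Longrightarrow> PS vs b \<Longrightarrow> PS vs (\<lambda>e. a e * b e)"
proof (rule PS_comp2[where F="(*)"])
  let ?vs = "[\<lambda>x. fst x, \<lambda>x. snd x] :: (nat \<times> nat \<Rightarrow> nat) list"
  show "PS ?vs (\<lambda>x. fst x * snd x)"
  proof (rule PS_rec[where F="\<lambda>i e. fst e * i" and h="\<lambda>x. fst (snd (snd x)) + fst (snd x)" and g="\<lambda>e. 0"])
    show "small ?vs (\<lambda>e. bl (fst e) + bl (snd e))" by (intro small_add small_bl PS_var) simp_all
    show "bl (fst e * i) \<le> bl (fst e) + bl (snd e)" if "i \<le> snd e" for i and e :: "nat \<times> nat"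
      using bl_mult[of "fst e" "snd e"] bl_mono[of "fst e * i" "fst e * snd e"] that by fastforce
  qed (((rule PS_var, (simp; fail)) | rule PS_intros | simp)+)
qed auto

definition PSP :: "('e \<Rightarrow> nat) list \<Rightarrow> ('e \<Rightarrow> bool) \<Rightarrow> bool" where
  "PSP vs P \<longleftrightarrow> PS vs (\<lambda>e. of_bool (P e))"

lemma PS_of_bool [PS_intros]: "PSP vs P \<Longrightarrow> PS vs (\<lambda>e. of_bool (P e))"
  by (simp add: PSP_def)

lemma PSP_comp3:
  "PSP [\<lambda>x. fst x, \<lambda>x. fst (snd x), \<lambda>x. snd (snd x)] (\<lambda>x. F (fst x) (fst (snd x)) (snd (snd x))) \<Longrightarrow>
    PS vs a \<Longrightarrow> PS vs b \<Longrightarrow> PS vs c \<Longrightarrow> PSP vs (\<lambda>e. F (a e) (b e) (c e))"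
  unfolding PSP_def by (rule PS_comp3[where F="\<lambda>x y z. of_bool (F x y z)"])

lemma PSP_comp4:
  "PSP [\<lambda>x. fst x, \<lambda>x. fst (snd x), \<lambda>x. fst (snd (snd x)), \<lambda>x. snd (snd (snd x))]
      (\<lambda>x. F (fst x) (fst (snd x)) (fst (snd (snd x))) (snd (snd (snd x)))) \<Longrightarrow>
    PS vs a \<Longrightarrow> PS vs b \<Longrightarrow> PS vs c \<Longrightarrow> PS vs d \<Longrightarrow> PSP vs (\<lambda>e. F (a e) (b e) (c e) (d e))"
  unfolding PSP_def by (rule PS_comp4[where F="\<lambda>x y z w. of_bool (F x y z w)"])

lemma PSP_comp5:
  "PSP [\<lambda>x. fst x, \<lambda>x. fst (snd x), \<lambda>x. fst (snd (snd x)), \<lambda>x. fst (snd (snd (snd x))), \<lambda>x. snd (snd (snd (snd x)))]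
      (\<lambda>x. F (fst x) (fst (snd x)) (fst (snd (snd x))) (fst (snd (snd (snd x)))) (snd (snd (snd (snd x))))) \<Longrightarrow>
    PS vs a \<Longrightarrow> PS vs b \<Longrightarrow> PS vs c \<Longrightarrow> PS vs d \<Longrightarrow> PS vs f \<Longrightarrow> PSP vs (\<lambda>e. F (a e) (b e) (c e) (d e) (f e))"
  unfolding PSP_def by (rule PS_comp5[where F="\<lambda>x y z w u. of_bool (F x y z w u)"])

lemma PSP_le [PS_intros]: "PS vs a \<Longrightarrow> PS vs b \<Longrightarrow> PSP vs (\<lambda>e. a e \<le> b e)"
  unfolding PSP_def by (rule PS_cong[where f="\<lambda>e. 1 - (a e - b e)"]) (auto intro!: PS_intros)

lemma PSP_less [PS_intros]: "PS vs a \<Longrightarrow> PS vs b \<Longrightarrow> PSP vs (\<lambda>e. a e < b e)"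
  unfolding PSP_def by (rule PS_cong[where f="\<lambda>e. 1 - (Suc (a e) - b e)"]) (auto intro!: PS_intros)

lemma PSP_const [PS_intros]: "PSP vs (\<lambda>e. P)"
  unfolding PSP_def by (rule PS_const)

lemma PSP_not [PS_intros]: "PSP vs P \<Longrightarrow> PSP vs (\<lambda>e. \<not> P e)"
  unfolding PSP_def by (rule PS_cong, rule PS_diff[OF PS_const[of vs 1]], assumption) simp

lemma PSP_conj [PS_intros]: "PSP vs P \<Longrightarrow> PSP vs Q \<Longrightarrow> PSP vs (\<lambda>e. P e \<and> Q e)"
  unfolding PSP_def by (rule PS_cong, rule PS_mult, assumption+) (simp add: of_bool_conj)

lemma PSP_disj [PS_intros]: "PSP vs P \<Longrightarrow> PSP vs Q \<Longrightarrow> PSP vs (\<lambda>e. P e \<or> Q e)"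
  using PSP_not[OF PSP_conj[OF PSP_not PSP_not], of vs P Q] by simp

lemma PSP_imp [PS_intros]: "PSP vs P \<Longrightarrow> PSP vs Q \<Longrightarrow> PSP vs (\<lambda>e. P e \<longrightarrow> Q e)"
  unfolding imp_conv_disj by (rule PSP_disj[OF PSP_not])

lemma PSP_iff [PS_intros]: "PSP vs P \<Longrightarrow> PSP vs Q \<Longrightarrow> PSP vs (\<lambda>e. P e \<longleftrightarrow> Q e)"
  unfolding iff_conv_conj_imp by (rule PSP_conj[OF PSP_imp PSP_imp])

lemma PSP_eq [PS_intros]: "PS vs a \<Longrightarrow> PS vs b \<Longrightarrow> PSP vs (\<lambda>e. a e = (b e :: nat))"
  unfolding order_eq_iff by (rule PSP_conj[OF PSP_le PSP_le])

lemma PS_if [PS_intros]: "PSP vs P \<Longrightarrow> PS vs a \<Longrightarrow> PS vs b \<Longrightarrow> PS vs (\<lambda>e. if P e then a e else b e)"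
  by (rule PS_cong[where f="\<lambda>e. of_bool (P e) * a e + of_bool (\<not> P e) * b e"])
    (intro PS_add PS_mult PS_of_bool PSP_not, assumption+, simp)

abbreviation ext_vars :: "('e \<Rightarrow> nat) list \<Rightarrow> (nat \<times> 'e \<Rightarrow> nat) list" where
  "ext_vars vs \<equiv> (\<lambda>x. fst x) # map (\<lambda>v x. v (snd x)) vs"

lemma PS_weaken:
  assumes "PS vs f"
  shows "PS (ext_vars vs) (\<lambda>x. f (snd x))"
  by (rule PS_comp[OF assms, where \<sigma>=snd]) (rule PS_var, auto)

text \<open>Adapts a function of a bound variable and an environment to the format of
  \<open>PS_rec\<close>, where the accumulator sits between the two.\<close>

lemma PS_acc:
  assumes "PS (ext_vars vs) f"
  shows "PS ((\<lambda>x. fst x) # (\<lambda>x. fst (snd x)) # map (\<lambda>v x. v (snd (snd x))) vs) (\<lambda>x. f (fst x, snd (snd x)))"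
  by (rule PS_comp[OF assms, where \<sigma>="\<lambda>x. (fst x, snd (snd x))"]) (auto intro!: PS_var)

lemma PSP_acc: "PSP (ext_vars vs) f \<Longrightarrow>
    PSP ((\<lambda>x. fst x) # (\<lambda>x. fst (snd x)) # map (\<lambda>v x. v (snd (snd x))) vs) (\<lambda>x. f (fst x, snd (snd x)))"
  unfolding PSP_def by (rule PS_acc)

lemma PSP_ex [PS_intros]:
  assumes "PS vs b" "PSP (ext_vars vs) (\<lambda>x. P (fst x) (snd x))"
  shows "PSP vs (\<lambda>e. \<exists>y<b e. P y e)"
  unfolding PSP_def
proof (rule PS_rec[where F="\<lambda>i e. of_bool (\<exists>y<i. P y e)" and g="\<lambda>e. 0" and h="\<lambda>x. if P (fst x) (snd (snd x)) then 1 else fst (snd x)"])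
  show "PS ((\<lambda>x. fst x) # (\<lambda>x. fst (snd x)) # map (\<lambda>v x. v (snd (snd x))) vs)
     (\<lambda>x. if P (fst x) (snd (snd x)) then 1 else fst (snd x))"
    using PSP_acc[OF assms(2)] by (intro PS_intros) (auto intro: PS_var)
  show "small vs (\<lambda>e. 1)" by (rule small_const)
qed (use assms in \<open>auto simp: PS_zero less_Suc_eq bl_le_iff\<close>)

lemma PSP_all [PS_intros]:
  assumes "PS vs b" "PSP (ext_vars vs) (\<lambda>x. P (fst x) (snd x))"
  shows "PSP vs (\<lambda>e. \<forall>y<b e. P y e)"
proof -
  have "PSP vs (\<lambda>e. \<not> (\<exists>y<b e. \<not> P y e))" by (intro PSP_not PSP_ex assms)
  then show ?thesis unfolding not_ex de_Morgan_conj not_not imp_conv_disj .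
qed

text \<open>Bounded minimisation with the bound itself as default value.\<close>

definition bmin :: "nat \<Rightarrow> (nat \<Rightarrow> bool) \<Rightarrow> nat" where
  "bmin b P = (if \<exists>i<b. P i then LEAST i. P i else b)"

lemma bmin_le: "bmin b P \<le> b"
  unfolding bmin_def using not_less_Least by (auto intro: less_imp_le le_less_trans[OF Least_le])

text \<open>The running value equals i exactly while nothing below i has been found, so the minimum
  needs no separate flag in the recursion.\<close>

lemma bmin_Suc: "bmin (Suc i) P = (if bmin i P < i then bmin i P else if P i then i else Suc i)"
proof (cases "\<exists>j<i. P j")
  case True
  then have "(LEAST j. P j) < i" by (auto intro: le_less_trans[OF Least_le])
  then show ?thesis using True by (auto simp: bmin_def less_Suc_eq)
next
  case False
  have "(LEAST j. P j) = i" if "P i" using that False by (intro Least_equality) (auto simp: not_less[symmetric])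
  then show ?thesis using False by (auto simp: bmin_def less_Suc_eq)
qed

lemma bmin_eq_Least: "\<exists>i<b. P i \<Longrightarrow> bmin b P = (LEAST i. P i)"
  by (simp add: bmin_def)

lemma PS_bmin [PS_intros]:
  assumes "PS vs b" "PSP (ext_vars vs) (\<lambda>x. P (fst x) (snd x))"
  shows "PS vs (\<lambda>e. bmin (b e) (\<lambda>y. P y e))"
proof (rule PS_rec[where F="\<lambda>i e. bmin i (\<lambda>y. P y e)" and g="\<lambda>e. 0"
      and h="\<lambda>x. if fst (snd x) < fst x then fst (snd x) else if P (fst x) (snd (snd x)) then fst x else Suc (fst x)"])
  show "PS ((\<lambda>x. fst x) # (\<lambda>x. fst (snd x)) # map (\<lambda>v x. v (snd (snd x))) vs)
     (\<lambda>x. if fst (snd x) < fst x then fst (snd x) else if P (fst x) (snd (snd x)) then fst x else Suc (fst x))"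
    using PSP_acc[OF assms(2)] by (intro PS_intros) (auto intro: PS_var)
  show "small vs (\<lambda>e. bl (b e))" using assms(1) by (rule small_bl)
  show "bl (bmin i (\<lambda>y. P y e)) \<le> bl (b e)" if "i \<le> b e" for i e
    using bmin_le[of i "\<lambda>y. P y e"] that by (intro bl_mono) linarith
qed (use assms in \<open>auto simp: PS_zero bmin_Suc bmin_def[of 0]\<close>)

lemma PS_div [PS_intros]: "PS vs a \<Longrightarrow> PS vs b \<Longrightarrow> PS vs (\<lambda>e. a e div b e)"
proof (rule PS_comp2[where F="(div)"])
  let ?vs = "[\<lambda>x. fst x, \<lambda>x. snd x] :: (nat \<times> nat \<Rightarrow> nat) list"
  \<comment> \<open>The quotient is the least q whose successor overshoots x.\<close>
  have e: "(x::nat) div y = (if y = 0 then 0 else bmin (Suc x) (\<lambda>q. x < Suc q * y))" for x y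
  proof (cases "y = 0")
    case False
    have i: "x < Suc q * y \<longleftrightarrow> x div y < Suc q" for q using False by (simp add: div_less_iff_less_mult)
    have "(LEAST q. x < Suc q * y) = x div y" unfolding i by (rule Least_equality) auto
    moreover have "\<exists>q<Suc x. x < Suc q * y" unfolding i by (rule exI[of _ "x div y"]) (auto simp: less_Suc_eq_le)
    ultimately show ?thesis using False by (simp add: bmin_eq_Least del: mult_Suc)
  qed simp
  show "PS ?vs (\<lambda>x. fst x div snd x)"
    unfolding e by (intro PS_intros; rule PS_var, simp)
qed auto

lemma PS_mod [PS_intros]: "PS vs a \<Longrightarrow> PS vs b \<Longrightarrow> PS vs (\<lambda>e. a e mod b e)"
  unfolding modulo_nat_def by (intro PS_intros)

lemma PS_shiftr: "PS vs a \<Longrightarrow> PS vs b \<Longrightarrow> PS vs (\<lambda>e. a e div 2 ^ b e)"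
proof (rule PS_comp2[where F="\<lambda>x y. x div 2 ^ y"])
  let ?vs = "[\<lambda>x. fst x, \<lambda>x. snd x] :: (nat \<times> nat \<Rightarrow> nat) list"
  show "PS ?vs (\<lambda>x. fst x div 2 ^ snd x)"
  proof (rule PS_rec[where F="\<lambda>i e. fst e div 2 ^ i" and g=fst and h="\<lambda>x. fst (snd x) div 2"])
    show "small ?vs (\<lambda>e. bl (fst e))" by (intro small_bl PS_var) simp
    show "bl (fst e div 2 ^ i) \<le> bl (fst e)" for i and e :: "nat \<times> nat" by (intro bl_mono) simp
    show "fst e div 2 ^ Suc i = fst (snd (i, fst e div 2 ^ i, e)) div 2" for i and e :: "nat \<times> nat"
      by (simp only: power_Suc2 div_mult2_eq fst_conv snd_conv)
  qed (((rule PS_var, (simp; fail)) | rule PS_intros | simp)+)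
qed auto

lemma PSP_bit [PS_intros]: "PS vs a \<Longrightarrow> PS vs b \<Longrightarrow> PSP vs (\<lambda>e. bit (a e) (b e))"
  unfolding bit_iff_odd odd_iff_mod_2_eq_one by (intro PS_intros PS_shiftr)

lemma PS_bl [PS_intros]: "PS vs a \<Longrightarrow> PS vs (\<lambda>e. bl (a e))"
proof (rule PS_comp1[where F=bl])
  \<comment> \<open>Stated by shifting x rather than by comparing with \<open>2 ^ k\<close>: the
    search bound is x itself, and such powers would be exponentially long.\<close>
  have e: "bl x = bmin (Suc x) (\<lambda>k. x div 2 ^ k < 1)" for x
  proof -
    have i: "x div 2 ^ k < 1 \<longleftrightarrow> x < 2 ^ k" for k by (simp add: div_eq_0_iff)
    show ?thesis unfolding i
      by (subst bmin_eq_Least) (auto simp: bl_def intro!: exI[of _ x])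
  qed
  show "PS [\<lambda>x. x] bl" unfolding e
    by (intro PS_intros PS_shiftr; rule PS_var, simp)
qed auto

text \<open>The exponent must be polynomially bounded as a number, since it is the length of the
  result.\<close>

lemma PS_power2:
  assumes "PS vs n" "small vs n"
  shows "PS vs (\<lambda>e. 2 ^ n e)"
proof (rule PS_rec[where F="\<lambda>i e. 2 ^ i" and g="\<lambda>e. 1" and h="\<lambda>x. 2 * fst (snd x)"])
  show "small vs (\<lambda>e. n e + 1)" by (intro small_add small_const assms)
  show "bl (2 ^ i) \<le> n e + 1" if "i \<le> n e" for i e
    unfolding bl_le_iff using that by (intro power_strict_increasing) auto
qed (((rule PS_var, (simp; fail)) | rule PS_intros assms | simp)+)

text \<open>Set comprehension for bit maps: the number whose bits below n are given by P.\<close>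

definition compr :: "nat \<Rightarrow> (nat \<Rightarrow> bool) \<Rightarrow> nat" where
  "compr n P = horner_sum of_bool 2 (map P [0..<n])"

lemma bit_compr: "bit (compr n P) i \<longleftrightarrow> i < n \<and> P i"
  by (auto simp: compr_def bit_horner_sum_bit_iff)

lemma compr_less: "compr n P < 2 ^ n"
  unfolding less_power2_iff_bit by (simp add: bit_compr)

text \<open>Horner's scheme from the highest bit downwards: after j rounds the accumulator consists
  of the top j bits. Beyond n rounds the step is the identity, because the recursion equation must
  hold for every index.\<close>

lemma PS_compr:
  assumes "PS vs n" "small vs n" "PSP (ext_vars vs) (\<lambda>x. P (fst x) (snd x))"
  shows "PS vs (\<lambda>e. compr (n e) (\<lambda>i. P i e))"
proof -
  let ?F = "\<lambda>j e. horner_sum of_bool 2 (map (\<lambda>i. P i e) [n e - j..<n e]) :: nat"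
  let ?h = "\<lambda>x. if fst x < n (snd (snd x)) then of_bool (P (n (snd (snd x)) - Suc (fst x)) (snd (snd x))) + 2 * fst (snd x)
    else fst (snd x)"
  let ?ws = "(\<lambda>x. fst x) # (\<lambda>x. fst (snd x)) # map (\<lambda>v x. v (snd (snd x))) vs"
  have n: "PS ?ws (\<lambda>x. n (snd (snd x)))" using PS_acc[OF PS_weaken[OF assms(1)]] by simp
  have v: "PS ?ws fst" "\<And>v. v \<in> set vs \<Longrightarrow> PS ?ws (\<lambda>x. v (snd (snd x)))"
    by (rule PS_var, simp)+
  have Pn: "PSP ?ws (\<lambda>x. P (n (snd (snd x)) - Suc (fst x)) (snd (snd x)))"
    unfolding PSP_def
    by (rule PS_comp[OF assms(3)[unfolded PSP_def], where \<sigma>="\<lambda>x. (n (snd (snd x)) - Suc (fst x), snd (snd x))", simplified])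
      (auto intro!: PS_diff n PS_Suc v)
  have h: "PS ?ws ?h" by (rule Pn n | (rule PS_var, (simp; fail)) | rule PS_intros)+
  have "PS vs (\<lambda>e. ?F (n e) e)"
  proof (rule PS_rec[where F="?F" and g="\<lambda>e. 0" and h="?h", OF assms(1) PS_zero h])
    show "?F (Suc i) e = ?h (i, ?F i e, e)" for i e
    proof (cases "i < n e")
      case True
      then have "[n e - Suc i..<n e] = (n e - Suc i) # [n e - i..<n e]" by (subst upt_conv_Cons) (auto simp: Suc_diff_Suc)
      then show ?thesis using True by simp
    qed simp
    show "small vs n" by (rule assms)
    show "bl (?F i e) \<le> n e" for i e
      unfolding bl_le_iff less_power2_iff_bit by (auto simp: bit_horner_sum_bit_iff)
  qed simp
  then show ?thesis by (simp add: compr_def)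
qed

section \<open>Savitch's reachability procedure\<close>

text \<open>Savitch's recursion is run as a counter. The call stack at a leaf is a number D with m digits in base
W = 2 * N, most significant digit first; digit 2 * w + b means that w is the guessed midpoint and that half b of
the path is being checked. The pair of endpoints at the leaf is determined by the lowest odd and the lowest even digit. A
successful leaf strips trailing odd digits and moves to the second half of the next call (next_true);
a failing leaf strips exhausted midpoints and advances the next one (next_false).\<close>

fun dfold :: "nat \<Rightarrow> (nat \<Rightarrow> nat \<Rightarrow> nat \<Rightarrow> nat) \<Rightarrow> nat \<Rightarrow> nat \<Rightarrow> nat \<Rightarrow> nat \<Rightarrow> nat" where
  "dfold W h z k 0 P = z"
| "dfold W h z k (Suc r) P = h k P (dfold W h z (Suc k) r (P div W))"

fun left_end :: "nat \<Rightarrow> nat \<Rightarrow> nat \<Rightarrow> nat \<Rightarrow> nat" where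
  "left_end W u 0 P = u"
| "left_end W u (Suc r) P = (if odd (P mod W) then P mod W div 2 else left_end W u r (P div W))"

fun right_end :: "nat \<Rightarrow> nat \<Rightarrow> nat \<Rightarrow> nat \<Rightarrow> nat" where
  "right_end W v 0 P = v"
| "right_end W v (Suc r) P = (if even (P mod W) then P mod W div 2 else right_end W v r (P div W))"

fun next_true :: "nat \<Rightarrow> nat \<Rightarrow> nat \<Rightarrow> nat \<Rightarrow> nat" where
  "next_true W k 0 P = 1"
| "next_true W k (Suc r) P = (if even P then (P + 1) * W ^ k + 2 else next_true W (Suc k) r (P div W))"

fun next_false :: "nat \<Rightarrow> nat \<Rightarrow> nat \<Rightarrow> nat \<Rightarrow> nat" where
  "next_false W k 0 P = 0"
| "next_false W k (Suc r) P = (if P mod W + 2 < W then (P + 2 - P mod 2) * W ^ k + 2 else next_false W (Suc k) r (P div W))"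

lemma left_end_dfold: "left_end W u r P = dfold W (\<lambda>k P a. if odd (P mod W) then P mod W div 2 else a) u k r P"
  by (induction r arbitrary: k P) auto

lemma right_end_dfold: "right_end W u r P = dfold W (\<lambda>k P a. if even (P mod W) then P mod W div 2 else a) u k r P"
  by (induction r arbitrary: k P) auto

text \<open>States: 0 is rejection, 1 is acceptance, D + 2 is the leaf D.\<close>

definition savitch_step :: "nat \<Rightarrow> nat \<Rightarrow> (nat \<Rightarrow> nat \<Rightarrow> bool) \<Rightarrow> nat \<Rightarrow> nat \<Rightarrow> nat \<Rightarrow> nat" where
  "savitch_step W m E u v s = (if s < 2 then s
     else if E (left_end W u m (s - 2)) (right_end W v m (s - 2)) then next_true W 0 m (s - 2) else next_false W 0 m (s - 2))"

fun savitch :: "nat \<Rightarrow> (nat \<Rightarrow> nat \<Rightarrow> bool) \<Rightarrow> nat \<Rightarrow> nat \<Rightarrow> nat \<Rightarrow> bool" where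
  "savitch N E 0 u v = E u v"
| "savitch N E (Suc k) u v = (\<exists>w<N. savitch N E k u w \<and> savitch N E k w v)"

text \<open>The start state is the first leaf below the call whose r leading digits form P, with k
  levels still to come. The run leaves this subtree exactly as a leaf with the verdict of the whole
  call would.\<close>

lemma savitch_step_run:
  assumes W: "W = 2 * N" and N: "0 < N" and "r + k = m"
  shows "\<exists>n. (savitch_step W m E u v ^^ n) (P * W ^ k + 2) =
    (if savitch N E k (left_end W u r P) (right_end W v r P) then next_true W k r P else next_false W k r P)"
  using assms(3)
proof (induction k arbitrary: r P)
  case 0
  then show ?case by (intro exI[of _ 1]) (simp add: savitch_step_def)
next
  case (Suc k)
  let ?st = "savitch_step W m E u v" and ?A = "left_end W u r P" and ?B = "right_end W v r P"
  have r: "Suc r + k = m" using Suc.prems by simp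
  have run_trans: "\<exists>n. (?st ^^ n) x = z" if "\<exists>n. (?st ^^ n) x = y" "\<exists>n. (?st ^^ n) y = z" for x y z
  proof -
    from that(1) obtain a where "(?st ^^ a) x = y" ..
    moreover from that(2) obtain b where "(?st ^^ b) y = z" ..
    ultimately have "(?st ^^ (b + a)) x = z" by (simp add: funpow_add)
    then show ?thesis ..
  qed
  \<comment> \<open>Generalised to an arbitrary first midpoint w, so that the search through the
    midpoints becomes an induction on N - w.\<close>
  have c: "\<exists>n. (?st ^^ n) ((P * W + 2 * w) * W ^ k + 2) =
      (if \<exists>x\<ge>w. x < N \<and> savitch N E k ?A x \<and> savitch N E k x ?B then next_true W (Suc k) r P else next_false W (Suc k) r P)"
    if "w < N" for w
    using that
  proof (induction "N - w" arbitrary: w rule: less_induct)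
    case less
    let ?P0 = "P * W + 2 * w" and ?P1 = "P * W + 2 * w + 1"
    have "2 * w + 1 < W" using less.prems W by linarith
    then have w: "2 * w < W" "2 * w + 1 < W" by linarith+
    have g: "(x + P * W) mod W = x" "(x + P * W) div W = P" if "x < W" for x using that by simp_all
    from g[OF w(1)] g[OF w(2)] have d0: "?P0 mod W = 2 * w" "?P0 div W = P" and d1: "?P1 mod W = 2 * w + 1" "?P1 div W = P"
      by (simp_all only: add_ac)
    have e0: "even ?P0" "odd ?P1" by (simp_all add: W)
    have m0: "?P0 mod 2 = 0" "?P1 mod 2 = 1" using e0 by presburger+
    have c2: "2 * w + 2 < W \<longleftrightarrow> w + 1 < N" "2 * w + 1 + 2 < W \<longleftrightarrow> w + 1 < N" unfolding W by linarith+
    have ev: "even (2 * w)" "odd (2 * w + 1)" "2 * w div 2 = w" "(2 * w + 1) div 2 = w" by simp_all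
    have ar: "?P0 + 2 - 0 = P * W + 2 * (w + 1)" "?P1 + 2 - 1 = P * W + 2 * (w + 1)" by simp_all
    \<comment> \<open>The even digit \<open>2 * w\<close> makes w the right end and leaves the left
      end to P. Success raises the digit to \<open>2 * w + 1\<close>, the second half; failure
      passes to the next midpoint or, if there is none, out of the call.\<close>
    have next0: "\<exists>n. (?st ^^ n) (?P0 * W ^ k + 2) = (if savitch N E k ?A w then ?P1 * W ^ k + 2
        else if w + 1 < N then (P * W + 2 * (w + 1)) * W ^ k + 2 else next_false W (Suc k) r P)"
      using Suc.IH[OF r, of ?P0] unfolding left_end.simps right_end.simps next_true.simps next_false.simps d0 m0 c2 ar
      using e0 ev by (simp only: if_True if_False not_False_eq_True simp_thms)
    have next1: "\<exists>n. (?st ^^ n) (?P1 * W ^ k + 2) = (if savitch N E k w ?B then next_true W (Suc k) r P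
        else if w + 1 < N then (P * W + 2 * (w + 1)) * W ^ k + 2 else next_false W (Suc k) r P)"
      using Suc.IH[OF r, of ?P1] unfolding left_end.simps right_end.simps next_true.simps next_false.simps d1 m0 c2 ar
      using e0 ev by (simp only: if_True if_False not_False_eq_True simp_thms)
    have both: "\<exists>n. (?st ^^ n) (?P0 * W ^ k + 2) = (if savitch N E k ?A w \<and> savitch N E k w ?B then next_true W (Suc k) r P
        else if w + 1 < N then (P * W + 2 * (w + 1)) * W ^ k + 2 else next_false W (Suc k) r P)"
    proof (cases "savitch N E k ?A w")
      case True
      then show ?thesis using run_trans[OF _ next1, of "?P0 * W ^ k + 2"] next0 by simp
    next
      case False
      then show ?thesis using next0 by simp
    qed
    have split: "(\<exists>x\<ge>w. x < N \<and> savitch N E k ?A x \<and> savitch N E k x ?B) \<longleftrightarrow>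
        (savitch N E k ?A w \<and> savitch N E k w ?B) \<or> (\<exists>x\<ge>w + 1. x < N \<and> savitch N E k ?A x \<and> savitch N E k x ?B)"
      using less.prems by (metis Suc_eq_plus1 Suc_leD le_less Suc_leI le_refl)
    show ?case
    proof (cases "savitch N E k ?A w \<and> savitch N E k w ?B")
      case True
      then show ?thesis using both less.prems by auto
    next
      case False
      show ?thesis
      proof (cases "w + 1 < N")
        case True
        have "\<exists>n. (?st ^^ n) (?P0 * W ^ k + 2) = (P * W + 2 * (w + 1)) * W ^ k + 2" using both False True by auto
        moreover have "N - (w + 1) < N - w" using True by linarith
        moreover have "(\<exists>x\<ge>w. x < N \<and> savitch N E k ?A x \<and> savitch N E k x ?B) \<longleftrightarrow>
            (\<exists>x\<ge>w + 1. x < N \<and> savitch N E k ?A x \<and> savitch N E k x ?B)" unfolding split using False by blast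
        ultimately show ?thesis using run_trans[OF _ less.hyps[OF _ True]] by (simp only:)
      next
        case F: False
        then have "\<not> (\<exists>x\<ge>w + 1. x < N \<and> savitch N E k ?A x \<and> savitch N E k x ?B)" by auto
        then have n: "\<not> (\<exists>x\<ge>w. x < N \<and> savitch N E k ?A x \<and> savitch N E k x ?B)" unfolding split using False by blast
        show ?thesis using both unfolding if_not_P[OF n] if_not_P[OF False] if_not_P[OF F] .
      qed
    qed
  qed
  from c[OF N] show ?case by (simp add: mult.assoc)
qed

text \<open>For k = 0 this says that a step either reaches a verdict or moves to a strictly larger
  leaf, which bounds the number of steps.\<close>

lemma next_true_lower: "0 < W \<Longrightarrow> next_true W k r P \<le> 1 \<or> (P + 1) * W ^ k + 2 \<le> next_true W k r P"
proof (induction r arbitrary: k P)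
  case (Suc r)
  have "P < (P div W + 1) * W" using Suc.prems by (metis dividend_less_div_times mult.commute add.commute mult_Suc Suc_eq_plus1 mult_Suc_right)
  then have "(P + 1) * W ^ k \<le> (P div W + 1) * W * W ^ k" by (intro mult_right_mono) auto
  then have "(P + 1) * W ^ k \<le> (P div W + 1) * W ^ Suc k" by (simp only: power_Suc mult.assoc)
  then show ?case using Suc.IH[OF Suc.prems, of "Suc k" "P div W"] unfolding next_true.simps
    by (cases "even P") (simp_all only: if_True if_False simp_thms, linarith+)
qed simp

lemma next_false_lower: "0 < W \<Longrightarrow> next_false W k r P \<le> 1 \<or> (P + 1) * W ^ k + 2 \<le> next_false W k r P"
proof (induction r arbitrary: k P)
  case (Suc r)
  have "P < (P div W + 1) * W" using Suc.prems by (metis dividend_less_div_times mult.commute add.commute mult_Suc Suc_eq_plus1 mult_Suc_right)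
  then have "(P + 1) * W ^ k \<le> (P div W + 1) * W * W ^ k" by (intro mult_right_mono) auto
  then have 1: "(P + 1) * W ^ k \<le> (P div W + 1) * W ^ Suc k" by (simp only: power_Suc mult.assoc)
  have 2: "(P + 1) * W ^ k \<le> (P + 2 - P mod 2) * W ^ k" by (intro mult_right_mono) auto
  show ?case using Suc.IH[OF Suc.prems, of "Suc k" "P div W"] 1 2 unfolding next_false.simps
    by (cases "P mod W + 2 < W") (simp_all only: if_True if_False simp_thms, linarith+)
qed simp

text \<open>A crude bound without any assumption on P, for the lengths of the intermediate values
  when the digits are folded by recursion.\<close>

lemma next_true_upper: "2 \<le> W \<Longrightarrow> next_true W k r P \<le> P * W ^ k + W ^ (k + r) + 2"
proof (induction r arbitrary: k P)
  case (Suc r)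
  have 1: "(P div W) * W ^ Suc k \<le> P * W ^ k"
    using mult_right_mono[OF div_times_less_eq_dividend[of P W], of "W ^ k"] by (simp add: mult.assoc)
  have 2: "W ^ k \<le> W ^ (k + Suc r)" using Suc.prems by (intro power_increasing) auto
  have 3: "(P + 1) * W ^ k = P * W ^ k + W ^ k" by simp
  have 4: "Suc k + r = k + Suc r" by simp
  note IH = Suc.IH[OF Suc.prems, of "Suc k" "P div W", unfolded 4]
  show ?case
  proof (cases "even P")
    case True
    then have "next_true W k (Suc r) P = (P + 1) * W ^ k + 2" by simp
    then show ?thesis using 2 3 by linarith
  next
    case False
    then have "next_true W k (Suc r) P = next_true W (Suc k) r (P div W)" by simp
    then show ?thesis using IH 1 by linarith
  qed
qed simp

lemma next_false_upper: "2 \<le> W \<Longrightarrow> next_false W k r P \<le> P * W ^ k + W ^ (k + r) + 2"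
proof (induction r arbitrary: k P)
  case (Suc r)
  have 1: "(P div W) * W ^ Suc k \<le> P * W ^ k"
    using mult_right_mono[OF div_times_less_eq_dividend[of P W], of "W ^ k"] by (simp add: mult.assoc)
  have "(P + 2 - P mod 2) * W ^ k \<le> (P + W) * W ^ k" using Suc.prems by (intro mult_right_mono) auto
  then have 3: "(P + 2 - P mod 2) * W ^ k \<le> P * W ^ k + W ^ Suc k" by (simp add: algebra_simps)
  have 2: "W ^ Suc k \<le> W ^ (k + Suc r)" using Suc.prems by (intro power_increasing) auto
  show ?case
  proof (cases "P mod W + 2 < W")
    case True
    then show ?thesis using 2 3 unfolding next_false.simps by (simp only: if_True)
  next
    case False
    moreover have "Suc k + r = k + Suc r" by simp
    ultimately show ?thesis using Suc.IH[OF Suc.prems, of "Suc k" "P div W"] 1 unfolding next_false.simps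
      by (simp only: if_False)
  qed
qed simp

lemma div_less_power: "P < W ^ Suc r \<Longrightarrow> P div W < (W::nat) ^ r"
  by (simp add: less_mult_imp_div_less mult.commute)

text \<open>The base is even, so an even P below a positive power of it is not the last number below
  that power, and P + 1 still fits.\<close>

lemma next_true_less: "even W \<Longrightarrow> 0 < W \<Longrightarrow> P < W ^ r \<Longrightarrow> next_true W k r P < W ^ (k + r) + 2"
proof (induction r arbitrary: k P)
  case (Suc r)
  show ?case
  proof (cases "even P")
    case True
    have "even (W ^ Suc r)" using Suc.prems by simp
    then have "P + 1 < W ^ Suc r" using True Suc.prems(3) by (metis Suc_eq_plus1 Suc_lessI even_Suc)
    then have "(P + 1) * W ^ k < W ^ Suc r * W ^ k" using Suc.prems by (intro mult_strict_right_mono) auto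
    then show ?thesis using True by (simp add: power_add mult_ac)
  next
    case False
    then show ?thesis using Suc.IH[OF Suc.prems(1,2) div_less_power[OF Suc.prems(3)], of "Suc k"] by simp
  qed
qed simp

lemma next_false_less: "even W \<Longrightarrow> 0 < W \<Longrightarrow> P < W ^ r \<Longrightarrow> next_false W k r P < W ^ (k + r) + 2"
proof (induction r arbitrary: k P)
  case (Suc r)
  note q = div_less_power[OF Suc.prems(3)]
  show ?case
  proof (cases "P mod W + 2 < W")
    case True
    have "(P div W + 1) * W = P div W * W + W" by simp
    then have "P + 2 < (P div W + 1) * W" using True div_mult_mod_eq[of P W] by linarith
    also have "\<dots> \<le> W ^ r * W" using q by (intro mult_right_mono) auto
    finally have "P + 2 - P mod 2 < W ^ Suc r" by (simp add: mult.commute)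
    then have "(P + 2 - P mod 2) * W ^ k < W ^ Suc r * W ^ k" using Suc.prems by (intro mult_strict_right_mono) auto
    then show ?thesis using True by (simp add: power_add mult_ac)
  next
    case False
    then show ?thesis using Suc.IH[OF Suc.prems(1,2) q, of "Suc k"] by simp
  qed
qed simp

text \<open>Leaf numbers increase strictly and stay below \<open>W ^ m\<close>, and verdicts are
  absorbing. Hence after \<open>W ^ m\<close> steps the verdict is present, and it agrees with the
  one reached at the unknown time supplied by \<open>savitch_step_run\<close>.\<close>

lemma savitch_iterate:
  assumes W: "W = 2 * N" and N: "0 < N"
  shows "(savitch_step W m E u v ^^ i) 2 < W ^ m + 2"
    and "(savitch_step W m E u v ^^ (W ^ m)) 2 = (if savitch N E m u v then 1 else 0)"
proof -
  let ?st = "savitch_step W m E u v" and ?s = "\<lambda>i. (savitch_step W m E u v ^^ i) 2"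
  have W': "even W" "0 < W" using W N by auto
  have s0: "?s 0 = 2" and sS: "?s (Suc i) = ?st (?s i)" for i by simp_all
  have st_less: "?st x = x" if "x < 2" for x using that by (simp add: savitch_step_def)
  have st_ge: "?st x = next_true W 0 m (x - 2) \<or> ?st x = next_false W 0 m (x - 2)" if "\<not> x < 2" for x
    using that by (simp add: savitch_step_def)
  have lt: "?s i < W ^ m + 2" for i
  proof (induction i)
    case 0
    then show ?case using W' by simp
  next
    case (Suc i)
    show ?case
    proof (cases "?s i < 2")
      case True
      then show ?thesis unfolding sS st_less[OF True] by linarith
    next
      case False
      then have "?s i - 2 < W ^ m" using Suc by linarith
      then show ?thesis unfolding sS
        using st_ge[OF False] next_true_less[OF W', of "?s i - 2" m 0] next_false_less[OF W', of "?s i - 2" m 0] by (metis add_0)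
    qed
  qed
  then show "?s i < W ^ m + 2" .
  have ge: "?s i < 2 \<or> 2 + i \<le> ?s i" for i
  proof (induction i)
    case 0
    then show ?case by simp
  next
    case (Suc i)
    show ?case
    proof (cases "?s i < 2")
      case True
      then show ?thesis unfolding sS st_less[OF True] by simp
    next
      case False
      have "?st (?s i) \<le> 1 \<or> (?s i - 2 + 1) * W ^ 0 + 2 \<le> ?st (?s i)"
        using st_ge[OF False] next_true_lower[OF W'(2), of 0 m "?s i - 2"] next_false_lower[OF W'(2), of 0 m "?s i - 2"] by metis
      then show ?thesis unfolding sS using False Suc by (simp only: power_0 mult_1_right simp_thms) linarith
    qed
  qed
  have fin: "?s (W ^ m) < 2" using ge[of "W ^ m"] lt[of "W ^ m"] by linarith
  have stay: "(?st ^^ j) x = x" if "x < 2" for j x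
    using that by (induction j) (simp_all add: st_less)
  obtain n where n: "?s n = (if savitch N E m u v then 1 else 0)"
    using savitch_step_run[OF W N, of 0 m m E u v 0]
    unfolding left_end.simps right_end.simps next_true.simps next_false.simps mult_0 add_0 by blast
  have "?s (W ^ m) = ?s n"
  proof (cases "n \<le> W ^ m")
    case True
    then have "?s (W ^ m) = (?st ^^ (W ^ m - n)) (?s n)" by (metis add.commute comp_apply funpow_add le_add_diff_inverse2)
    then show ?thesis using stay[of "?s n"] n by simp
  next
    case False
    then have "?s n = (?st ^^ (n - W ^ m)) (?s (W ^ m))" by (metis comp_apply funpow_add le_add_diff_inverse2 nat_le_linear)
    then show ?thesis using stay[OF fin] by simp
  qed
  then show "?s (W ^ m) = (if savitch N E m u v then 1 else 0)" using n by simp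
qed

section \<open>Reachability in a finite graph\<close>

definition edges_below :: "nat \<Rightarrow> (nat \<Rightarrow> nat \<Rightarrow> bool) \<Rightarrow> (nat \<times> nat) set" where
  "edges_below N E = {(x, y). x < N \<and> y < N \<and> E x y}"

lemma savitch_iff_relpow:
  "u < N \<Longrightarrow> v < N \<Longrightarrow> savitch N E k u v \<longleftrightarrow> (u, v) \<in> edges_below N E ^^ (2 ^ k)"
proof (induction k arbitrary: u v)
  case 0
  then show ?case by (simp add: edges_below_def)
next
  case (Suc k)
  \<comment> \<open>Midpoints of positive-length walks lie below N by themselves, so the bound in
    the recursion loses nothing.\<close>
  have sub: "y < N" if "(x, y) \<in> edges_below N E ^^ (2 ^ k)" "x < N" for x y
  proof -
    obtain j where "(2::nat) ^ k = Suc j" by (metis not0_implies_Suc power_not_zero zero_neq_numeral)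
    then show ?thesis using that by (auto simp: edges_below_def)
  qed
  have "(u, v) \<in> edges_below N E ^^ (2 ^ Suc k) \<longleftrightarrow>
      (\<exists>w. (u, w) \<in> edges_below N E ^^ (2 ^ k) \<and> (w, v) \<in> edges_below N E ^^ (2 ^ k))"
    by (simp add: mult_2 relpow_add relcomp_unfold)
  moreover have "savitch N E (Suc k) u v \<longleftrightarrow>
      (\<exists>w<N. (u, w) \<in> edges_below N E ^^ (2 ^ k) \<and> (w, v) \<in> edges_below N E ^^ (2 ^ k))"
    using Suc.IH Suc.prems by auto
  ultimately show ?case using sub[OF _ Suc.prems(1)] by blast
qed

text \<open>Reflexive edges let every walk be padded to the exact length \<open>2 ^ (2 * M)\<close>.
  This length suffices because a graph on \<open>2 ^ M\<close> vertices has at most that many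
  edges.\<close>

lemma savitch_iff_rtrancl:
  assumes "u < 2 ^ M" "v < 2 ^ M" and refl: "\<And>x. E x x"
  shows "savitch (2 ^ M) E (2 * M) u v \<longleftrightarrow> (u, v) \<in> (edges_below (2 ^ M) E)\<^sup>*"
proof -
  let ?R = "edges_below (2 ^ M) E"
  have "?R \<subseteq> {..<2 ^ M} \<times> {..<2 ^ M}" by (auto simp: edges_below_def)
  then have fin: "finite ?R" and c: "card ?R \<le> 2 ^ (2 * M)"
    using finite_subset card_mono[of "{..<2 ^ M} \<times> {..<2 ^ M}" ?R] by (auto simp: card_cartesian_product mult_2 power_add)
  have pad: "(u, v) \<in> ?R ^^ (i + d)" if "(u, v) \<in> ?R ^^ i" for i d
  proof (induction d)
    case 0
    then show ?case using that by simp
  next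
    case (Suc d)
    have "(v, v) \<in> ?R" using assms by (simp add: edges_below_def)
    then show ?case using Suc relpow_Suc_I by fastforce
  qed
  have "(u, v) \<in> ?R ^^ (2 ^ (2 * M)) \<longleftrightarrow> (u, v) \<in> ?R\<^sup>*"
  proof
    assume "(u, v) \<in> ?R\<^sup>*"
    then obtain n where n: "n \<le> card ?R" "(u, v) \<in> ?R ^^ n" unfolding rtrancl_finite_eq_relpow[OF fin] by blast
    then have "n + (2 ^ (2 * M) - n) = 2 ^ (2 * M)" using c by simp
    then show "(u, v) \<in> ?R ^^ (2 ^ (2 * M))" using pad[OF n(2), of "2 ^ (2 * M) - n"] by (simp only:)
  qed (rule relpow_imp_rtrancl)
  then show ?thesis using savitch_iff_relpow[OF assms(1,2)] by blast
qed


text \<open>The fold recurses towards the high digits, so it is evaluated from its innermost call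
  outwards: round j handles the number left after dropping m - j digits. The length bound is
  required only for parameters that occur in this way.\<close>

lemma PS_comp_digits:
  assumes h: "PS ((\<lambda>x. fst x) # (\<lambda>x. fst (snd x)) # (\<lambda>x. fst (snd (snd x))) # map (\<lambda>v x. v (snd (snd (snd x)))) vs)
      (\<lambda>x. h (snd (snd (snd x))) (fst x) (fst (snd x)) (fst (snd (snd x))))"
    and L: "PS vs L" and m: "PS vs m" and D: "PS vs D" and z: "PS vs z"
    and bd: "small vs bd" "\<And>e k r P. k + r = m e \<Longrightarrow> P * (2 ^ L e) ^ k \<le> D e \<Longrightarrow> bl (dfold (2 ^ L e) (h e) (z e) k r P) \<le> bd e"
  shows "PS vs (\<lambda>e. dfold (2 ^ L e) (h e) (z e) 0 (m e) (D e))"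
proof -
  let ?F = "\<lambda>j e. dfold (2 ^ L e) (h e) (z e) (m e - j) (min j (m e)) (D e div 2 ^ (L e * (m e - j)))"
  let ?k = "\<lambda>x. m (snd (snd x)) - Suc (fst x)"
  let ?P = "\<lambda>x. D (snd (snd x)) div 2 ^ (L (snd (snd x)) * (m (snd (snd x)) - Suc (fst x)))"
  let ?h = "\<lambda>x. if fst x < m (snd (snd x)) then h (snd (snd x)) (?k x) (?P x) (fst (snd x)) else fst (snd x)"
  let ?ws = "(\<lambda>x. fst x) # (\<lambda>x. fst (snd x)) # map (\<lambda>v x. v (snd (snd x))) vs"
  have v: "PS ?ws fst" "PS ?ws (\<lambda>x. fst (snd x))" "\<And>v. v \<in> set vs \<Longrightarrow> PS ?ws (\<lambda>x. v (snd (snd x)))"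
    by (rule PS_var, simp)+
  have w: "PS ?ws (\<lambda>x. L (snd (snd x)))" "PS ?ws (\<lambda>x. m (snd (snd x)))" "PS ?ws (\<lambda>x. D (snd (snd x)))"
    using PS_acc[OF PS_weaken[OF L]] PS_acc[OF PS_weaken[OF m]] PS_acc[OF PS_weaken[OF D]] by simp_all
  have k: "PS ?ws ?k" by (intro PS_diff PS_Suc v w)
  have P: "PS ?ws ?P" by (intro PS_shiftr PS_mult PS_diff PS_Suc v w)
  have "PS ?ws (\<lambda>x. (\<lambda>x. h (snd (snd (snd x))) (fst x) (fst (snd x)) (fst (snd (snd x)))) (?k x, ?P x, fst (snd x), snd (snd x)))"
    by (rule PS_comp[OF h]) (use k P v in auto)
  then have hh: "PS ?ws (\<lambda>x. h (snd (snd x)) (?k x) (?P x) (fst (snd x)))" by simp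
  have h': "PS ?ws ?h" by (intro PS_if PSP_less v w hh)
  have "PS vs (\<lambda>e. ?F (m e) e)"
  proof (rule PS_rec[where F="?F" and g=z and h="?h", OF m z h'])
    show "?F (Suc i) e = ?h (i, ?F i e, e)" for i e
    proof (cases "i < m e")
      case True
      then have s: "m e - i = Suc (m e - Suc i)" "min (Suc i) (m e) = Suc i" "min i (m e) = i" by auto
      have "L e * (m e - i) = L e * (m e - Suc i) + L e" unfolding s by simp
      then have "D e div 2 ^ (L e * (m e - i)) = D e div 2 ^ (L e * (m e - Suc i)) div 2 ^ L e"
        by (simp add: power_add div_mult2_eq)
      then show ?thesis using True s by simp
    qed simp
    show "bl (?F i e) \<le> bd e" if "i \<le> m e" for i e
    proof (rule bd(2))
      show "m e - i + min i (m e) = m e" using that by simp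
      show "D e div 2 ^ (L e * (m e - i)) * (2 ^ L e) ^ (m e - i) \<le> D e"
        by (simp add: power_mult[symmetric])
    qed
  qed (use bd(1) in simp_all)
  then show ?thesis by simp
qed

lemma bl_max_le: "x \<le> max y z \<Longrightarrow> bl x \<le> bl y + bl z"
  using bl_mono[of x y] bl_mono[of x z] by (auto simp: max_def split: if_splits)

lemma left_end_le: "0 < W \<Longrightarrow> left_end W u r P \<le> max u W"
  by (induction r arbitrary: P) (auto simp: le_max_iff_disj intro: le_trans[OF div_le_dividend] less_imp_le)

lemma right_end_le: "0 < W \<Longrightarrow> right_end W u r P \<le> max u W"
  by (induction r arbitrary: P) (auto simp: le_max_iff_disj intro: le_trans[OF div_le_dividend] less_imp_le)

text \<open>Capping the exponent keeps the digit function total with polynomially long values for arbitrary k.\<close>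

lemma next_true_dfold_min: "k + r \<le> m \<Longrightarrow>
    next_true (2 ^ L) k r P = dfold (2 ^ L) (\<lambda>k P a. if even P then (P + 1) * 2 ^ (L * min k m) + 2 else a) 1 k r P"
  by (induction r arbitrary: k P) (auto simp: power_mult min_absorb1)

lemma next_false_dfold_min: "k + r \<le> m \<Longrightarrow>
    next_false (2 ^ L) k r P = dfold (2 ^ L) (\<lambda>k P a. if P mod 2 ^ L + 2 < 2 ^ L then (P + 2 - P mod 2) * 2 ^ (L * min k m) + 2 else a) 0 k r P"
  by (induction r arbitrary: k P) (auto simp: power_mult min_absorb1)

abbreviation ext_vars3 :: "('e \<Rightarrow> nat) list \<Rightarrow> (nat \<times> nat \<times> nat \<times> 'e \<Rightarrow> nat) list" where
  "ext_vars3 vs \<equiv> (\<lambda>x. fst x) # (\<lambda>x. fst (snd x)) # (\<lambda>x. fst (snd (snd x))) # map (\<lambda>v x. v (snd (snd (snd x)))) vs"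

lemma PS_ext3: "PS (ext_vars3 vs) (\<lambda>x. fst x)" "PS (ext_vars3 vs) (\<lambda>x. fst (snd x))"
    "PS (ext_vars3 vs) (\<lambda>x. fst (snd (snd x)))"
  by (rule PS_var, simp)+

lemma PS_weaken3:
  assumes "PS vs f"
  shows "PS (ext_vars3 vs) (\<lambda>x. f (snd (snd (snd x))))"
  by (rule PS_comp[OF assms, where \<sigma>="\<lambda>x. snd (snd (snd x))"]) (rule PS_var, auto)

lemma small_weaken3: "small vs f \<Longrightarrow> small (ext_vars3 vs) (\<lambda>x. f (snd (snd (snd x))))"
  by (rule small_power_env_size[where \<sigma>="\<lambda>x. snd (snd (snd x))"]) (rule small_bl_var, auto)

lemma small_min_right: "small vs g \<Longrightarrow> small vs (\<lambda>e. min (f e) (g e))"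
  by (rule small_mono[where g=g]) auto

lemma PS_min: "PS vs a \<Longrightarrow> PS vs b \<Longrightarrow> PS vs (\<lambda>e. min (a e) (b e))"
  unfolding min_def by (intro PS_if PSP_le)

context
  fixes vs :: "('e \<Rightarrow> nat) list" and L m D :: "'e \<Rightarrow> nat"
  assumes L: "PS vs L" "small vs L" and m: "PS vs m" "small vs m" and D: "PS vs D"
    and L0: "\<And>e. 0 < L e"
begin

lemma PS_W: "PS vs (\<lambda>e. 2 ^ L e)"
  by (rule PS_power2[OF L])

lemma PS_W3: "PS (ext_vars3 vs) (\<lambda>x. 2 ^ L (snd (snd (snd x))))"
  by (rule PS_weaken3[OF PS_W])

lemma PS_Wk: "PS (ext_vars3 vs) (\<lambda>x. 2 ^ (L (snd (snd (snd x))) * min (fst x) (m (snd (snd (snd x))))))"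
  by (intro PS_power2 PS_mult PS_min PS_weaken3 small_mult small_min_right small_weaken3 PS_ext3 L m)

lemma PS_left_end: "PS vs u \<Longrightarrow> PS vs (\<lambda>e. left_end (2 ^ L e) (u e) (m e) (D e))"
  unfolding left_end_dfold[where k=0]
proof (rule PS_comp_digits[OF _ L(1) m(1) D])
  assume u: "PS vs u"
  show "PS (ext_vars3 vs) (\<lambda>x. if odd (fst (snd x) mod 2 ^ L (snd (snd (snd x)))) then fst (snd x) mod 2 ^ L (snd (snd (snd x))) div 2 else fst (snd (snd x)))"
    unfolding odd_iff_mod_2_eq_one by (intro PS_ext3 PS_W3 PS_if PSP_eq PS_mod PS_div PS_const)
  show "small vs (\<lambda>e. bl (u e) + bl (2 ^ L e))" by (intro small_add small_bl u PS_W)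
  show "bl (dfold (2 ^ L e) (\<lambda>k P a. if odd (P mod 2 ^ L e) then P mod 2 ^ L e div 2 else a) (u e) k r P) \<le> bl (u e) + bl (2 ^ L e)" for e k r P
    unfolding left_end_dfold[symmetric] by (rule bl_max_le, rule left_end_le) simp
qed

lemma PS_right_end: "PS vs u \<Longrightarrow> PS vs (\<lambda>e. right_end (2 ^ L e) (u e) (m e) (D e))"
  unfolding right_end_dfold[where k=0]
proof (rule PS_comp_digits[OF _ L(1) m(1) D])
  assume u: "PS vs u"
  show "PS (ext_vars3 vs) (\<lambda>x. if even (fst (snd x) mod 2 ^ L (snd (snd (snd x)))) then fst (snd x) mod 2 ^ L (snd (snd (snd x))) div 2 else fst (snd (snd x)))"
    unfolding even_iff_mod_2_eq_zero by (intro PS_ext3 PS_W3 PS_if PSP_eq PS_mod PS_div PS_const)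
  show "small vs (\<lambda>e. bl (u e) + bl (2 ^ L e))" by (intro small_add small_bl u PS_W)
  show "bl (dfold (2 ^ L e) (\<lambda>k P a. if even (P mod 2 ^ L e) then P mod 2 ^ L e div 2 else a) (u e) k r P) \<le> bl (u e) + bl (2 ^ L e)" for e k r P
    unfolding right_end_dfold[symmetric] by (rule bl_max_le, rule right_end_le) simp
qed

lemma small_pos_bound: "small vs (\<lambda>e. bl (D e + 2 ^ (L e * m e) + 2))"
  by (intro small_bl PS_add D PS_power2 PS_mult PS_const small_mult L m)

lemma W_ge2: "2 \<le> (2::nat) ^ L e"
  using L0[of e] self_le_power[of 2 "L e"] by simp

lemma PS_next_true: "PS vs (\<lambda>e. next_true (2 ^ L e) 0 (m e) (D e))"
proof -
  have "PS vs (\<lambda>e. dfold (2 ^ L e) (\<lambda>k P a. if even P then (P + 1) * 2 ^ (L e * min k (m e)) + 2 else a) 1 0 (m e) (D e))"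
  proof (rule PS_comp_digits[OF _ L(1) m(1) D PS_const small_pos_bound])
    show "PS (ext_vars3 vs) (\<lambda>x. if even (fst (snd x)) then (fst (snd x) + 1) * 2 ^ (L (snd (snd (snd x))) * min (fst x) (m (snd (snd (snd x))))) + 2 else fst (snd (snd x)))"
      unfolding even_iff_mod_2_eq_zero by (intro PS_ext3 PS_Wk PS_if PSP_eq PS_mod PS_add PS_mult PS_const)
    fix e k r P assume *: "k + r = m e" "P * (2 ^ L e) ^ k \<le> D e"
    show "bl (dfold (2 ^ L e) (\<lambda>k P a. if even P then (P + 1) * 2 ^ (L e * min k (m e)) + 2 else a) 1 k r P) \<le> bl (D e + 2 ^ (L e * m e) + 2)"
      unfolding next_true_dfold_min[OF eq_imp_le[OF *(1)], symmetric]
      using next_true_upper[OF W_ge2, of e k r P] * by (intro bl_mono) (simp add: power_mult)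
  qed
  then show ?thesis by (simp only: next_true_dfold_min[OF eq_imp_le[OF add_0]])
qed

lemma PS_next_false: "PS vs (\<lambda>e. next_false (2 ^ L e) 0 (m e) (D e))"
proof -
  have "PS vs (\<lambda>e. dfold (2 ^ L e) (\<lambda>k P a. if P mod 2 ^ L e + 2 < 2 ^ L e then (P + 2 - P mod 2) * 2 ^ (L e * min k (m e)) + 2 else a) 0 0 (m e) (D e))"
  proof (rule PS_comp_digits[OF _ L(1) m(1) D PS_const small_pos_bound])
    show "PS (ext_vars3 vs) (\<lambda>x. if fst (snd x) mod 2 ^ L (snd (snd (snd x))) + 2 < 2 ^ L (snd (snd (snd x))) then (fst (snd x) + 2 - fst (snd x) mod 2) * 2 ^ (L (snd (snd (snd x))) * min (fst x) (m (snd (snd (snd x))))) + 2 else fst (snd (snd x)))"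
      by (intro PS_ext3 PS_W3 PS_Wk PS_if PSP_less PS_mod PS_add PS_diff PS_mult PS_const)
    fix e k r P assume *: "k + r = m e" "P * (2 ^ L e) ^ k \<le> D e"
    show "bl (dfold (2 ^ L e) (\<lambda>k P a. if P mod 2 ^ L e + 2 < 2 ^ L e then (P + 2 - P mod 2) * 2 ^ (L e * min k (m e)) + 2 else a) 0 k r P) \<le> bl (D e + 2 ^ (L e * m e) + 2)"
      unfolding next_false_dfold_min[OF eq_imp_le[OF *(1)], symmetric]
      using next_false_upper[OF W_ge2, of e k r P] * by (intro bl_mono) (simp add: power_mult)
  qed
  then show ?thesis by (simp only: next_false_dfold_min[OF eq_imp_le[OF add_0]])
qed

end

lemma small_weaken: "small vs f \<Longrightarrow> small (ext_vars vs) (\<lambda>x. f (snd x))"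
  by (rule small_power_env_size[where \<sigma>=snd]) (rule small_bl_var, auto)

text \<open>With base \<open>2 ^ (M + 1)\<close>, twice the number of vertices, the counter has
  about (M + 1) * m bits; iterating it exponentially often is an instance of
  \<open>PS_rec\<close>.\<close>

lemma PSP_savitch:
  fixes vs :: "('e \<Rightarrow> nat) list"
  assumes M: "PS vs M" "small vs M" and m: "PS vs m" "small vs m" and u: "PS vs u" and v: "PS vs v"
    and E: "PSP (ext_vars (ext_vars vs)) (\<lambda>x. E (snd (snd x)) (fst (snd x)) (fst x))"
  shows "PSP vs (\<lambda>e. savitch (2 ^ M e) (E e) (m e) (u e) (v e))"
proof -
  let ?W = "\<lambda>e. 2 ^ (M e + 1) :: nat"
  have L: "PS vs (\<lambda>e. M e + 1)" "small vs (\<lambda>e. M e + 1)" by (intro PS_add PS_const small_add small_const M)+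
  let ?F = "\<lambda>i e. (savitch_step (?W e) (m e) (E e) (u e) (v e) ^^ i) 2"
  let ?ws = "ext_vars vs"
  have s: "PS ?ws (\<lambda>x. fst x - 2)" by (intro PS_diff PS_const PS_var) simp
  have l: "PS ?ws (\<lambda>x. left_end (?W (snd x)) (u (snd x)) (m (snd x)) (fst x - 2))"
    by (rule PS_left_end[OF PS_weaken[OF L(1)] small_weaken[OF L(2)] PS_weaken[OF m(1)] small_weaken[OF m(2)] s _ PS_weaken[OF u]]) simp
  have r: "PS ?ws (\<lambda>x. right_end (?W (snd x)) (v (snd x)) (m (snd x)) (fst x - 2))"
    by (rule PS_right_end[OF PS_weaken[OF L(1)] small_weaken[OF L(2)] PS_weaken[OF m(1)] small_weaken[OF m(2)] s _ PS_weaken[OF v]]) simp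
  have t: "PS ?ws (\<lambda>x. next_true (?W (snd x)) 0 (m (snd x)) (fst x - 2))"
    by (rule PS_next_true[OF PS_weaken[OF L(1)] small_weaken[OF L(2)] PS_weaken[OF m(1)] small_weaken[OF m(2)] s]) simp
  have f: "PS ?ws (\<lambda>x. next_false (?W (snd x)) 0 (m (snd x)) (fst x - 2))"
    by (rule PS_next_false[OF PS_weaken[OF L(1)] small_weaken[OF L(2)] PS_weaken[OF m(1)] small_weaken[OF m(2)] s]) simp
  have vv: "PS ?ws (\<lambda>x. w (snd x))" if "w \<in> set vs" for w by (rule PS_var) (use that in simp)
  have "PS ?ws (\<lambda>x. (\<lambda>y. of_bool (E (snd (snd y)) (fst (snd y)) (fst y)))
      (right_end (?W (snd x)) (v (snd x)) (m (snd x)) (fst x - 2), left_end (?W (snd x)) (u (snd x)) (m (snd x)) (fst x - 2), snd x))"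
    by (rule PS_comp[OF E[unfolded PSP_def]]) (use l r vv in auto)
  then have e: "PSP ?ws (\<lambda>x. E (snd x) (left_end (?W (snd x)) (u (snd x)) (m (snd x)) (fst x - 2)) (right_end (?W (snd x)) (v (snd x)) (m (snd x)) (fst x - 2)))"
    unfolding PSP_def by simp
  have st: "PS ?ws (\<lambda>x. savitch_step (?W (snd x)) (m (snd x)) (E (snd x)) (u (snd x)) (v (snd x)) (fst x))"
    unfolding savitch_step_def by (intro PS_if PSP_less PS_const e t f) (rule PS_var, simp)+
  let ?ws3 = "(\<lambda>x. fst x) # (\<lambda>x. fst (snd x)) # map (\<lambda>v x. v (snd (snd x))) vs"
  have st': "PS ?ws3 (\<lambda>x. (\<lambda>x. savitch_step (?W (snd x)) (m (snd x)) (E (snd x)) (u (snd x)) (v (snd x)) (fst x)) (snd x))"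
    by (rule PS_comp[OF st]) (auto intro!: PS_var)
  have n: "PS vs (\<lambda>e. 2 ^ ((M e + 1) * m e))" by (intro PS_power2 PS_mult small_mult L m)
  have "PS vs (\<lambda>e. ?F (2 ^ ((M e + 1) * m e)) e)"
  proof (rule PS_rec[where F="?F" and g="\<lambda>e. 2", OF n PS_const st'])
    show "small vs (\<lambda>e. bl (2 ^ ((M e + 1) * m e) + 2))" by (intro small_bl PS_add n PS_const)
    show "bl (?F i e) \<le> bl (2 ^ ((M e + 1) * m e) + 2)" for i e
      using savitch_iterate(1)[where W="?W e" and N="2 ^ M e" and m="m e" and E="E e" and u="u e" and v="v e" and i=i] by (intro bl_mono) (simp only: power_mult, simp)
  qed simp_all
  then have "PSP vs (\<lambda>e. ?F (2 ^ ((M e + 1) * m e)) e = 1)" by (intro PSP_eq PS_const)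
  moreover have "?F (2 ^ ((M e + 1) * m e)) e = 1 \<longleftrightarrow> savitch (2 ^ M e) (E e) (m e) (u e) (v e)" for e
    unfolding power_mult using savitch_iterate(2)[where W="?W e" and N="2 ^ M e" and m="m e" and E="E e" and u="u e" and v="v e"] by simp
  ultimately show ?thesis by (simp only:)
qed

section \<open>Histories and minimum firing times\<close>

text \<open>States of the universal automaton: quiescent, the general with its boundary, or the
  previous records of a node and its neighbours. Every automaton is an image of it under
  \<open>state_of\<close>.\<close>

datatype info = IQ | IG "bool \<times> bool \<times> bool \<times> bool"
  | IN info "info option" "info option" "info option" "info option"

instance info :: countable by countable_datatype

lemma fsa_wfD:
  assumes "fsa_wf A"
  shows "finite (fs_states A)" "fs_Q A \<in> fs_states A" "\<forall>i<fs_m A. fs_G A i \<in> fs_states A"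
    "fs_F A \<subseteq> fs_states A" "fs_Q A \<notin> fs_F A" "\<forall>b. fs_tau A b < fs_m A"
    "\<forall>s\<in>fs_states A. \<forall>a0 a1 a2 a3. (\<forall>a\<in>{a0,a1,a2,a3}. a = None \<or> the a \<in> fs_states A) \<longrightarrow>
      fs_delta A s a0 a1 a2 a3 \<in> fs_states A"
    "\<forall>a0 a1 a2 a3. (\<forall>a\<in>{a0,a1,a2,a3}. a = None \<or> a = Some (fs_Q A)) \<longrightarrow>
      fs_delta A (fs_Q A) a0 a1 a2 a3 = fs_Q A"
proof -
  note c = assms[unfolded fsa_wf_def]
  show "finite (fs_states A)" by (rule c[THEN conjunct1])
  show "fs_Q A \<in> fs_states A" by (rule c[THEN conjunct2, THEN conjunct1])
  show "\<forall>i<fs_m A. fs_G A i \<in> fs_states A" by (rule c[THEN conjunct2, THEN conjunct2, THEN conjunct1])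
  show "fs_F A \<subseteq> fs_states A" by (rule c[THEN conjunct2, THEN conjunct2, THEN conjunct2, THEN conjunct1])
  show "fs_Q A \<notin> fs_F A" by (rule c[THEN conjunct2, THEN conjunct2, THEN conjunct2, THEN conjunct2, THEN conjunct1])
  show "\<forall>b. fs_tau A b < fs_m A" by (rule c[THEN conjunct2, THEN conjunct2, THEN conjunct2, THEN conjunct2, THEN conjunct2, THEN conjunct1])
  show "\<forall>s\<in>fs_states A. \<forall>a0 a1 a2 a3. (\<forall>a\<in>{a0,a1,a2,a3}. a = None \<or> the a \<in> fs_states A) \<longrightarrow>
      fs_delta A s a0 a1 a2 a3 \<in> fs_states A" by (rule c[THEN conjunct2, THEN conjunct2, THEN conjunct2, THEN conjunct2, THEN conjunct2, THEN conjunct2, THEN conjunct1])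
  show "\<forall>a0 a1 a2 a3. (\<forall>a\<in>{a0,a1,a2,a3}. a = None \<or> a = Some (fs_Q A)) \<longrightarrow>
      fs_delta A (fs_Q A) a0 a1 a2 a3 = fs_Q A" by (rule c[THEN conjunct2, THEN conjunct2, THEN conjunct2, THEN conjunct2, THEN conjunct2, THEN conjunct2, THEN conjunct2])
qed

definition inbr :: "pos set \<Rightarrow> (pos \<Rightarrow> info) \<Rightarrow> pos \<Rightarrow> nat \<Rightarrow> info option" where
  "inbr C st p i = (if shift p i \<in> C then Some (st (shift p i)) else None)"

definition quiet :: "info option \<Rightarrow> bool" where
  "quiet a \<longleftrightarrow> a = None \<or> a = Some IQ"

text \<open>Nothing is forgotten, except that a quiescent node in quiescent surroundings stays
  \<open>IQ\<close>, as the stability of Q requires.\<close>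

definition info_step :: "info \<Rightarrow> info option \<Rightarrow> info option \<Rightarrow> info option \<Rightarrow> info option \<Rightarrow> info" where
  "info_step a n0 n1 n2 n3 = (if a = IQ \<and> quiet n0 \<and> quiet n1 \<and> quiet n2 \<and> quiet n3 then IQ else IN a n0 n1 n2 n3)"

primrec hist :: "pos set \<Rightarrow> nat \<Rightarrow> pos \<Rightarrow> info" where
  "hist C 0 p = (if p = (0,0) then IG (bc C (0,0)) else IQ)"
| "hist C (Suc t) p = info_step (hist C t p) (inbr C (hist C t) p 0) (inbr C (hist C t) p 1)
      (inbr C (hist C t) p 2) (inbr C (hist C t) p 3)"

primrec state_of :: "fsa \<Rightarrow> info \<Rightarrow> nat" where
  "state_of A IQ = fs_Q A"
| "state_of A (IG b) = fs_G A (fs_tau A b)"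
| "state_of A (IN a n0 n1 n2 n3) = fs_delta A (state_of A a) (map_option (state_of A) n0) (map_option (state_of A) n1)
     (map_option (state_of A) n2) (map_option (state_of A) n3)"

lemma quiet_state: "quiet a \<Longrightarrow> map_option (state_of A) a = None \<or> map_option (state_of A) a = Some (fs_Q A)"
  by (auto simp: quiet_def)

lemma state_of_info_step:
  assumes "fsa_wf A"
  shows "state_of A (info_step a n0 n1 n2 n3) = fs_delta A (state_of A a) (map_option (state_of A) n0)
     (map_option (state_of A) n1) (map_option (state_of A) n2) (map_option (state_of A) n3)"
proof (cases "a = IQ \<and> quiet n0 \<and> quiet n1 \<and> quiet n2 \<and> quiet n3")
  case True
  let ?m = "map_option (state_of A)"
  have "(\<forall>a\<in>{?m n0, ?m n1, ?m n2, ?m n3}. a = None \<or> a = Some (fs_Q A)) \<longrightarrow>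
      fs_delta A (fs_Q A) (?m n0) (?m n1) (?m n2) (?m n3) = fs_Q A"
    by (rule fsa_wfD(8)[OF assms, THEN spec, THEN spec, THEN spec, THEN spec])
  moreover have "\<forall>a\<in>{?m n0, ?m n1, ?m n2, ?m n3}. a = None \<or> a = Some (fs_Q A)"
    using True quiet_state[of _ A] by simp
  ultimately have "fs_delta A (fs_Q A) (?m n0) (?m n1) (?m n2) (?m n3) = fs_Q A" by (rule mp)
  moreover have "state_of A a = fs_Q A" using True by simp
  moreover have "state_of A (info_step a n0 n1 n2 n3) = fs_Q A" unfolding info_step_def if_P[OF True] by simp
  ultimately show ?thesis by simp
next
  case False
  show ?thesis unfolding info_step_def if_not_P[OF False] by simp
qed

lemma nbr_state_of: "(\<And>p. st p = state_of A (st' p)) \<Longrightarrow> nbr C st p i = map_option (state_of A) (inbr C st' p i)"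
  by (simp add: nbr_def inbr_def)

text \<open>Evaluation commutes with the transition; where \<open>info_step\<close> returns
  \<open>IQ\<close> instead of a record, this is the stability of Q in
  \<open>fsa_wf\<close>.\<close>

lemma fs_run_hist: "fsa_wf A \<Longrightarrow> fs_run A C t p = state_of A (hist C t p)"
proof (induction t arbitrary: p)
  case (Suc t)
  then show ?case by (simp add: state_of_info_step nbr_state_of[of "fs_run A C t" A "hist C t"])
qed simp

lemma not_quiet_inbr: "\<not> quiet (inbr C st p i) \<longleftrightarrow> shift p i \<in> C \<and> st (shift p i) \<noteq> IQ"
  by (auto simp: quiet_def inbr_def)

lemma less_4_iff: "i < 4 \<longleftrightarrow> i = 0 \<or> i = 1 \<or> i = 2 \<or> i = (3::nat)"
  by auto

lemma ex_less_4: "(\<exists>i<4. P i) \<longleftrightarrow> P 0 \<or> P 1 \<or> P 2 \<or> P (3::nat)"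
  unfolding less_4_iff by blast

lemma hist_Suc_neq_IQ: "hist C (Suc t) p \<noteq> IQ \<longleftrightarrow> hist C t p \<noteq> IQ \<or> (\<exists>i<4. shift p i \<in> C \<and> hist C t (shift p i) \<noteq> IQ)"
proof -
  have "hist C (Suc t) p \<noteq> IQ \<longleftrightarrow> \<not> (hist C t p = IQ \<and> quiet (inbr C (hist C t) p 0) \<and> quiet (inbr C (hist C t) p 1)
      \<and> quiet (inbr C (hist C t) p 2) \<and> quiet (inbr C (hist C t) p 3))"
    unfolding hist.simps info_step_def by (simp split: if_split del: de_Morgan_conj)
  then show ?thesis unfolding ex_less_4 de_Morgan_conj not_quiet_inbr by simp
qed

lemma hist_Suc_eq_IN: "hist C (Suc t) p \<noteq> IQ \<Longrightarrow> hist C (Suc t) p = IN (hist C t p) (inbr C (hist C t) p 0) (inbr C (hist C t) p 1)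
      (inbr C (hist C t) p 2) (inbr C (hist C t) p 3)"
  by (auto simp: info_step_def)

lemma hist_Suc_eqD:
  assumes "hist C (Suc t) p = hist C' (Suc t) p'" "hist C (Suc t) p \<noteq> IQ"
  shows "hist C t p = hist C' t p'" "i < 4 \<Longrightarrow> inbr C (hist C t) p i = inbr C' (hist C' t) p' i"
proof -
  have "IN (hist C t p) (inbr C (hist C t) p 0) (inbr C (hist C t) p 1) (inbr C (hist C t) p 2) (inbr C (hist C t) p 3) =
    IN (hist C' t p') (inbr C' (hist C' t) p' 0) (inbr C' (hist C' t) p' 1) (inbr C' (hist C' t) p' 2) (inbr C' (hist C' t) p' 3)"
    using assms hist_Suc_eq_IN[of C t p] hist_Suc_eq_IN[of C' t p'] by metis
  then show "hist C t p = hist C' t p'" "i < 4 \<Longrightarrow> inbr C (hist C t) p i = inbr C' (hist C' t) p' i"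
    by (auto simp: less_4_iff)
qed

text \<open>An awake history contains its predecessor as a component, and a node asleep later was
  asleep before.\<close>

lemma hist_eq_earlier:
  assumes "hist C t p = hist C' t p'" "s \<le> t"
  shows "hist C s p = hist C' s p'"
  using assms
proof (induction t)
  case (Suc t)
  have "hist C t p = hist C' t p'"
  proof (cases "hist C (Suc t) p = IQ")
    case True
    then show ?thesis using Suc.prems(1) hist_Suc_neq_IQ[of C t p] hist_Suc_neq_IQ[of C' t p'] by metis
  next
    case False
    then show ?thesis using hist_Suc_eqD Suc.prems(1) by blast
  qed
  then show ?case using Suc by (cases "s = Suc t") auto
qed simp

definition unshift :: "pos \<Rightarrow> nat \<Rightarrow> pos" where
  "unshift p i = (fst p - fst (eps i), snd p - snd (eps i))"

text \<open>A history that is not quiescent determines the position of its node and the current time.\<close>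

primrec info_pos :: "info \<Rightarrow> pos" where
  "info_pos IQ = (0,0)"
| "info_pos (IG b) = (0,0)"
| "info_pos (IN a n0 n1 n2 n3) = (if a \<noteq> IQ then info_pos a
     else if \<not> quiet n0 then unshift (the (map_option info_pos n0)) 0
     else if \<not> quiet n1 then unshift (the (map_option info_pos n1)) 1
     else if \<not> quiet n2 then unshift (the (map_option info_pos n2)) 2
     else unshift (the (map_option info_pos n3)) 3)"

primrec age :: "info \<Rightarrow> nat" where
  "age IQ = 0"
| "age (IG b) = 0"
| "age (IN a n0 n1 n2 n3) = Suc (if a \<noteq> IQ then age a
     else if \<not> quiet n0 then the (map_option age n0)
     else if \<not> quiet n1 then the (map_option age n1)
     else if \<not> quiet n2 then the (map_option age n2)
     else the (map_option age n3))"

lemma unshift_shift: "unshift (shift p i) i = p"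
  by (simp add: shift_def unshift_def)

lemma info_pos_age_IN:
  assumes "\<not> quiet n0 \<or> \<not> quiet n1 \<or> \<not> quiet n2 \<or> \<not> quiet n3"
    and "\<not> quiet n0 \<Longrightarrow> unshift (the (map_option info_pos n0)) 0 = p \<and> the (map_option age n0) = t"
    and "\<not> quiet n1 \<Longrightarrow> unshift (the (map_option info_pos n1)) 1 = p \<and> the (map_option age n1) = t"
    and "\<not> quiet n2 \<Longrightarrow> unshift (the (map_option info_pos n2)) 2 = p \<and> the (map_option age n2) = t"
    and "\<not> quiet n3 \<Longrightarrow> unshift (the (map_option info_pos n3)) 3 = p \<and> the (map_option age n3) = t"
  shows "info_pos (IN IQ n0 n1 n2 n3) = p \<and> age (IN IQ n0 n1 n2 n3) = Suc t"
  unfolding info_pos.simps age.simps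
  by (cases "quiet n0"; cases "quiet n1"; cases "quiet n2"; insert assms; simp)

text \<open>A node that wakes up takes the coordinates of an awake neighbour and undoes the shift.
  The trace ends at the general, the only node awake at time 0.\<close>

lemma info_pos_age_hist: "hist C t p \<noteq> IQ \<Longrightarrow> info_pos (hist C t p) = p \<and> age (hist C t p) = t"
proof (induction t arbitrary: p)
  case 0
  then show ?case by (auto split: if_splits)
next
  case (Suc t)
  let ?n = "\<lambda>i. inbr C (hist C t) p i"
  have n: "unshift (the (map_option info_pos (?n i))) i = p \<and> the (map_option age (?n i)) = t" if "\<not> quiet (?n i)" for i
  proof -
    have i: "shift p i \<in> C" "hist C t (shift p i) \<noteq> IQ" using that unfolding not_quiet_inbr by auto
    show ?thesis using Suc.IH[OF i(2)] i(1) by (simp add: inbr_def unshift_shift)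
  qed
  show ?case
  proof (cases "hist C t p = IQ")
    case True
    have "\<not> quiet (?n 0) \<or> \<not> quiet (?n 1) \<or> \<not> quiet (?n 2) \<or> \<not> quiet (?n 3)"
    proof (rule ccontr)
      assume "\<not> ?thesis"
      then have "hist C (Suc t) p = IQ" unfolding hist.simps info_step_def using True by simp
      then show False using Suc.prems by simp
    qed
    then show ?thesis unfolding hist_Suc_eq_IN[OF Suc.prems] True by (rule info_pos_age_IN) (rule n, assumption)+
  next
    case False
    then show ?thesis unfolding hist_Suc_eq_IN[OF Suc.prems] using Suc.IH[OF False] by simp
  qed
qed

text \<open>One common position p is enough: awake histories that coincide belong to the same
  position anyway.\<close>

definition conf_edges :: "pos set set \<Rightarrow> nat \<Rightarrow> (pos set \<times> pos set) set" where
  "conf_edges \<Gamma> t = {(C, C'). C \<in> \<Gamma> \<and> C' \<in> \<Gamma> \<and> (\<exists>p\<in>C \<inter> C'. hist C t p = hist C' t p \<and> hist C t p \<noteq> IQ)}"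

definition good :: "pos set set \<Rightarrow> nat \<Rightarrow> pos set \<Rightarrow> bool" where
  "good \<Gamma> t C \<longleftrightarrow> (\<forall>C'. (C, C') \<in> (conf_edges \<Gamma> t)\<^sup>* \<longrightarrow> (\<forall>p\<in>C'. hist C' t p \<noteq> IQ))"

section \<open>Firing times and the chain component of a configuration\<close>

lemma fires_at_unique:
  assumes "fires_at A C t" "fires_at A C t'" "C \<noteq> {}"
  shows "t = t'"
  using assms unfolding fires_at_def by (metis all_not_in_conv nat_neq_iff)

lemma ft_eq: "fires_at A C t \<Longrightarrow> C \<noteq> {} \<Longrightarrow> ft C A = t"
  unfolding ft_def using fires_at_unique by blast

lemma fires_at_good:
  assumes "is_solution \<Gamma> A" "C \<in> \<Gamma>" "fires_at A C t"
  shows "good \<Gamma> t C"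
proof -
  have wf: "fsa_wf A" using assms(1) by (simp add: is_solution_def)
  have *: "fires_at A C' t" if "(C, C') \<in> (conf_edges \<Gamma> t)\<^sup>*" for C'
    using that
  proof (induction rule: rtrancl_induct)
    case base
    show ?case by fact
  next
    case (step C1 C2)
    obtain p where p: "p \<in> C1" "p \<in> C2" "hist C1 t p = hist C2 t p" and C2: "C2 \<in> \<Gamma>"
      using step.hyps(2) by (auto simp: conf_edges_def)
    obtain t2 where t2: "fires_at A C2 t2" using assms(1) C2 by (auto simp: is_solution_def)
    have eq: "fs_run A C1 s p = fs_run A C2 s p" if "s \<le> t" for s
      using hist_eq_earlier[OF p(3) that] wf by (simp add: fs_run_hist)
    \<comment> \<open>The shared node passes through the same states in both configurations up to
      time t, so C2 can fire neither before nor after t.\<close>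
    have "\<not> t2 < t" using t2 p(1,2) step.IH eq[of t2] unfolding fires_at_def by (metis less_imp_le)
    moreover have "\<not> t < t2" using t2 p(1,2) step.IH eq[of t] unfolding fires_at_def by (metis le_refl)
    ultimately show ?case using t2 by (metis nat_neq_iff)
  qed
  show ?thesis
    unfolding good_def
  proof (intro allI impI ballI notI)
    fix C' p assume "(C, C') \<in> (conf_edges \<Gamma> t)\<^sup>*" "p \<in> C'" "hist C' t p = IQ"
    then have "fs_run A C' t p = fs_Q A" "fs_run A C' t p \<in> fs_F A"
      using *[of C'] fs_run_hist[OF wf, of C' t p] unfolding fires_at_def by auto
    then show False using fsa_wfD(5)[OF wf] by simp
  qed
qed

text \<open>Records of nesting depth at most n; their finiteness allows them to be stored in a
  state.\<close>

primrec infos :: "nat \<Rightarrow> info set" where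
  "infos 0 = insert IQ (range IG)"
| "infos (Suc n) = infos n \<union> (\<lambda>(a, b, c, d, e). IN a b c d e) `
     (infos n \<times> insert None (Some ` infos n) \<times> insert None (Some ` infos n) \<times> insert None (Some ` infos n) \<times> insert None (Some ` infos n))"

lemma finite_infos: "finite (infos n)"
  by (induction n) simp_all

lemma infos_mono: "m \<le> n \<Longrightarrow> infos m \<subseteq> infos n"
  by (rule lift_Suc_mono_le) auto

lemma infos_base: "IQ \<in> infos n" "IG b \<in> infos n"
  using infos_mono[of 0 n] by auto

lemma hist_in_infos: "hist C t p \<in> infos t"
proof (induction t arbitrary: p)
  case (Suc t)
  have i: "inbr C (hist C t) p i \<in> insert None (Some ` infos t)" for i using Suc by (simp add: inbr_def)
  show ?case
  proof (cases "hist C (Suc t) p = IQ")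
    case True
    then show ?thesis using infos_base(1)[of "Suc t"] by (simp only:)
  next
    case False
    show ?thesis
      unfolding hist_Suc_eq_IN[OF False] infos.simps
      by (rule UnI2, rule image_eqI[where x="(hist C t p, inbr C (hist C t) p 0, inbr C (hist C t) p 1, inbr C (hist C t) p 2, inbr C (hist C t) p 3)"],
          simp only: prod.case, intro SigmaI Suc.IH i)
  qed
next
  case 0
  have "IG b \<in> infos 0" for b by (rule infos_base)
  moreover have "IQ \<in> infos 0" by (rule infos_base)
  ultimately show ?case unfolding hist.simps by (simp only: split: if_split) blast
qed

text \<open>The automaton B runs A together with histories, which expire (None) after time t, and additionally
fires on the histories that occur at time t in the chain component of C.\<close>

locale fire_earlier =
  fixes \<Gamma> :: "pos set set" and A :: fsa and C :: "pos set" and t :: nat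
  assumes sol: "is_solution \<Gamma> A" and C: "C \<in> \<Gamma>" and good: "good \<Gamma> t C"
    and late: "\<And>s p. s \<le> t \<Longrightarrow> p \<in> C \<Longrightarrow> fs_run A C s p \<notin> fs_F A"
begin

lemma wf: "fsa_wf A"
  using sol by (simp add: is_solution_def)

definition cls :: "pos set set" where
  "cls = {C'. (C, C') \<in> (conf_edges \<Gamma> t)\<^sup>*}"

definition fire :: "info set" where
  "fire = {hist C' t p | C' p. C' \<in> cls \<and> p \<in> C'}"

lemma cls_sub: "C' \<in> cls \<Longrightarrow> C' \<in> \<Gamma>"
  unfolding cls_def using C by (auto simp: conf_edges_def elim: rtranclE)

lemma cls_awake: "C' \<in> cls \<Longrightarrow> p \<in> C' \<Longrightarrow> hist C' t p \<noteq> IQ"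
  using good unfolding good_def cls_def by blast

text \<open>A firing by time t somewhere in the component would be passed along the edges to
  C.\<close>

lemma cls_late: "C' \<in> cls \<Longrightarrow> s \<le> t \<Longrightarrow> p \<in> C' \<Longrightarrow> fs_run A C' s p \<notin> fs_F A"
  unfolding cls_def mem_Collect_eq
proof (induction arbitrary: s p rule: rtrancl_induct)
  case base
  then show ?case using late by blast
next
  case (step C1 C2)
  obtain q where q: "q \<in> C1" "q \<in> C2" "hist C1 t q = hist C2 t q" and C2: "C2 \<in> \<Gamma>"
    using step.hyps(2) by (auto simp: conf_edges_def)
  obtain t2 where t2: "fires_at A C2 t2" using sol C2 by (auto simp: is_solution_def)
  have eq: "fs_run A C1 s q = fs_run A C2 s q" if "s \<le> t" for s
    using hist_eq_earlier[OF q(3) that] wf by (simp add: fs_run_hist)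
  have "\<not> t2 \<le> t" using t2 q(1,2) step.IH eq[of t2] unfolding fires_at_def by metis
  then show ?case using t2 step.prems unfolding fires_at_def by auto
qed

text \<open>The age of the record fixes the time and its position fixes the node, so a configuration
  showing this record is joined by an edge to the one it was taken from. This makes the additional
  firing harmless outside the component.\<close>

lemma fire_imp_cls:
  assumes "hist C' s p \<in> fire" "C' \<in> \<Gamma>" "p \<in> C'"
  shows "s = t" "C' \<in> cls"
proof -
  obtain C1 q where q: "C1 \<in> cls" "q \<in> C1" "hist C' s p = hist C1 t q" using assms(1) by (auto simp: fire_def)
  have n: "hist C1 t q \<noteq> IQ" using cls_awake q by blast
  then have "info_pos (hist C' s p) = p \<and> age (hist C' s p) = s" using q(3) info_pos_age_hist[of C' s p] by simp
  then have st: "s = t" "p = q" using info_pos_age_hist[OF n] q(3) by auto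
  then show "s = t" by simp
  have "q \<in> C1 \<inter> C'" "hist C1 t q = hist C' t q" using q st assms(3) by auto
  then have "(C1, C') \<in> conf_edges \<Gamma> t" using n assms(2) cls_sub[OF q(1)] unfolding conf_edges_def by blast
  then show "C' \<in> cls" using q(1) unfolding cls_def by auto
qed

definition enc :: "info option \<times> nat \<Rightarrow> nat" where "enc = to_nat"
definition dec :: "nat \<Rightarrow> info option \<times> nat" where "dec = from_nat"

lemma dec_enc [simp]: "dec (enc x) = x"
  by (simp add: enc_def dec_def)

lemma enc_inject [simp]: "enc x = enc y \<longleftrightarrow> x = y"
  by (simp add: enc_def)

definition comps :: "info option set" where "comps = insert None (Some ` infos t)"

definition restrict :: "info \<Rightarrow> info option" where
  "restrict r = (if r \<in> infos t then Some r else None)"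

definition expired :: "nat option \<Rightarrow> bool" where
  "expired n \<longleftrightarrow> (\<exists>s. n = Some s \<and> fst (dec s) = None)"

definition info_of :: "nat option \<Rightarrow> info option" where
  "info_of n = map_option (\<lambda>s. the (fst (dec s))) n"

definition orig :: "nat option \<Rightarrow> nat option" where
  "orig n = map_option (\<lambda>s. snd (dec s)) n"

text \<open>Expiry spreads to the neighbours, since a record with a missing part cannot be formed.
  The second component is an undisturbed run of A.\<close>

definition delta' :: "nat \<Rightarrow> nat option \<Rightarrow> nat option \<Rightarrow> nat option \<Rightarrow> nat option \<Rightarrow> nat" where
  "delta' s n0 n1 n2 n3 = enc
     (if expired (Some s) \<or> expired n0 \<or> expired n1 \<or> expired n2 \<or> expired n3 then None
      else restrict (info_step (the (fst (dec s))) (info_of n0) (info_of n1) (info_of n2) (info_of n3)),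
      fs_delta A (snd (dec s)) (orig n0) (orig n1) (orig n2) (orig n3))"

text \<open>Each boundary tuple gets a general state of its own, because the initial record contains
  the tuple itself and not only its class under \<open>fs_tau A\<close>.\<close>

definition m' :: nat where
  "m' = Suc (Max (range (to_nat :: bool \<times> bool \<times> bool \<times> bool \<Rightarrow> nat)))"

definition B :: fsa where
  "B = \<lparr>fs_states = enc ` (comps \<times> fs_states A), fs_Q = enc (Some IQ, fs_Q A), fs_m = m',
     fs_G = (\<lambda>i. enc (Some (IG (from_nat i)), fs_G A (fs_tau A (from_nat i)))),
     fs_F = enc ` (Some ` fire \<times> fs_states A \<union> comps \<times> fs_F A),
     fs_tau = to_nat, fs_delta = delta'\<rparr>"

lemma fire_sub: "fire \<subseteq> infos t"
  using hist_in_infos by (auto simp: fire_def)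

lemma IQ_notin_fire: "IQ \<notin> fire"
  unfolding fire_def using cls_awake by (smt (verit) mem_Collect_eq)

lemma wf_B: "fsa_wf B"
proof -
  note wfA = fsa_wfD[OF wf]
  have b: "IQ \<in> infos t" "IG b \<in> infos t" for b by (rule infos_base)+
  have closed: "delta' s a0 a1 a2 a3 \<in> enc ` (comps \<times> fs_states A)"
    if s: "s \<in> enc ` (comps \<times> fs_states A)"
      and a: "\<forall>a\<in>{a0,a1,a2,a3}. a = None \<or> the a \<in> enc ` (comps \<times> fs_states A)" for s a0 a1 a2 a3
  proof -
    have o: "orig a = None \<or> the (orig a) \<in> fs_states A" if "a = None \<or> the a \<in> enc ` (comps \<times> fs_states A)" for a
      using that by (cases a) (auto simp: orig_def)
    have "snd (dec s) \<in> fs_states A" using s by auto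
    then have 1: "fs_delta A (snd (dec s)) (orig a0) (orig a1) (orig a2) (orig a3) \<in> fs_states A"
      by (rule wfA(7)[rule_format]) (use a o in auto)
    have 2: "restrict r \<in> comps" "None \<in> comps" for r by (auto simp: restrict_def comps_def)
    show ?thesis unfolding delta'_def by (rule imageI) (use 1 2 in simp)
  qed
  have quiescent: "delta' (enc (Some IQ, fs_Q A)) a0 a1 a2 a3 = enc (Some IQ, fs_Q A)"
    if a: "\<forall>a\<in>{a0,a1,a2,a3}. a = None \<or> a = Some (enc (Some IQ, fs_Q A))" for a0 a1 a2 a3
  proof -
    have o: "\<not> expired a \<and> quiet (info_of a) \<and> (orig a = None \<or> orig a = Some (fs_Q A))"
      if "a = None \<or> a = Some (enc (Some IQ, fs_Q A))" for a
      using that by (auto simp: expired_def info_of_def orig_def quiet_def)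
    have "fs_delta A (fs_Q A) (orig a0) (orig a1) (orig a2) (orig a3) = fs_Q A"
      by (rule wfA(8)[rule_format]) (use a o in auto)
    then show ?thesis using a o by (simp add: delta'_def info_step_def restrict_def b expired_def[of "Some (enc x)" for x])
  qed
  have fin: "finite (enc ` (comps \<times> fs_states A))" by (simp add: comps_def finite_infos wfA)
  have tau: "to_nat x < m'" for x :: "bool \<times> bool \<times> bool \<times> bool"
    unfolding m'_def by (simp add: less_Suc_eq_le)
  show ?thesis
    unfolding fsa_wf_def
  proof (intro conjI)
    show "fs_F B \<subseteq> fs_states B"
      using fire_sub wfA(4) by (auto simp: B_def comps_def)
    show "fs_Q B \<notin> fs_F B" using IQ_notin_fire wfA(5) by (auto simp: B_def)
    have "(Some (IG x), fs_G A (fs_tau A x)) \<in> comps \<times> fs_states A" for x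
      using wfA(3,6) b(2)[of x] unfolding comps_def by blast
    then show "\<forall>i<fs_m B. fs_G B i \<in> fs_states B" by (simp add: B_def)
    show "\<forall>s\<in>fs_states B. \<forall>a0 a1 a2 a3. (\<forall>a\<in>{a0, a1, a2, a3}. a = None \<or> the a \<in> fs_states B) \<longrightarrow> fs_delta B s a0 a1 a2 a3 \<in> fs_states B"
      using closed by (simp add: B_def)
    show "\<forall>a0 a1 a2 a3. (\<forall>a\<in>{a0, a1, a2, a3}. a = None \<or> a = Some (fs_Q B)) \<longrightarrow> fs_delta B (fs_Q B) a0 a1 a2 a3 = fs_Q B"
      using quiescent by (simp add: B_def)
  qed (use fin tau b wfA in \<open>auto simp: B_def comps_def\<close>)
qed

lemma run_in_states: "fsa_wf A' \<Longrightarrow> fs_run A' C' s p \<in> fs_states A'"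
proof (induction s arbitrary: p)
  case 0
  then show ?case unfolding fs_run.simps using fsa_wfD(2,3,6)[OF 0] by (simp only: split: if_split) blast
next
  case (Suc s)
  note cl = fsa_wfD(7)[OF Suc.prems, rule_format]
  have "nbr C' (fs_run A' C' s) p i = None \<or> the (nbr C' (fs_run A' C' s) p i) \<in> fs_states A'" for i
    using Suc by (simp add: nbr_def)
  then show ?case unfolding fs_run.simps by (intro cl[OF Suc.IH[OF Suc.prems]]) auto
qed

text \<open>After time t a record may survive, for example at a node that is still quiescent, but a
  surviving record is always the true history.\<close>

lemma run_B: "\<exists>a. fs_run B C' s p = enc (a, fs_run A C' s p) \<and> (a = None \<or> a = Some (hist C' s p)) \<and> (s \<le> t \<longrightarrow> a = Some (hist C' s p))"
proof (induction s arbitrary: p)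
  case 0
  then show ?case by (simp add: B_def)
next
  case (Suc s)
  have "\<forall>p. \<exists>a. fs_run B C' s p = enc (a, fs_run A C' s p) \<and> (a = None \<or> a = Some (hist C' s p)) \<and> (s \<le> t \<longrightarrow> a = Some (hist C' s p))"
    using Suc.IH by blast
  then obtain a where a: "\<And>p. fs_run B C' s p = enc (a p, fs_run A C' s p)"
    "\<And>p. a p = None \<or> a p = Some (hist C' s p)" "\<And>p. s \<le> t \<Longrightarrow> a p = Some (hist C' s p)" by metis
  let ?n = "\<lambda>i. nbr C' (fs_run B C' s) p i"
  have o: "orig (?n i) = nbr C' (fs_run A C' s) p i" for i by (simp add: orig_def nbr_def a(1))
  have ex: "s \<le> t \<Longrightarrow> \<not> expired (?n i)" for i by (auto simp: expired_def nbr_def a(1) a(3) split: if_splits)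
  have io: "\<not> expired (?n i) \<Longrightarrow> info_of (?n i) = inbr C' (hist C' s) p i" for i
    using a(2)[of "shift p i"] by (auto simp: expired_def info_of_def nbr_def inbr_def a(1) split: if_splits)
  let ?ex = "expired (Some (fs_run B C' s p)) \<or> expired (?n 0) \<or> expired (?n 1) \<or> expired (?n 2) \<or> expired (?n 3)"
  have eB: "fs_run B C' (Suc s) p = delta' (fs_run B C' s p) (?n 0) (?n 1) (?n 2) (?n 3)" by (simp add: B_def)
  have sd: "snd (dec (fs_run B C' s p)) = fs_run A C' s p" by (simp add: a(1))
  show ?case
  proof (cases ?ex)
    case True
    have "\<not> s \<le> t"
    proof
      assume st: "s \<le> t"
      have "\<not> expired (Some (fs_run B C' s p))" using a(3)[OF st, of p] by (simp add: expired_def a(1))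
      then show False using True ex[OF st] by blast
    qed
    moreover have "fs_run B C' (Suc s) p = enc (None, fs_run A C' (Suc s) p)"
      unfolding eB delta'_def if_P[OF True] o sd by simp
    ultimately show ?thesis by auto
  next
    case False
    then have np: "a p = Some (hist C' s p)" using a(2)[of p] by (auto simp: expired_def a(1))
    have "info_step (the (fst (dec (fs_run B C' s p)))) (info_of (?n 0)) (info_of (?n 1)) (info_of (?n 2)) (info_of (?n 3)) = hist C' (Suc s) p"
      using False io by (simp add: a(1) np)
    then have e: "fs_run B C' (Suc s) p = enc (restrict (hist C' (Suc s) p), fs_run A C' (Suc s) p)"
      unfolding eB delta'_def if_not_P[OF False] o sd by simp
    have "Suc s \<le> t \<Longrightarrow> hist C' (Suc s) p \<in> infos t" using hist_in_infos[of C' "Suc s" p] infos_mono by blast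
    then show ?thesis unfolding e restrict_def by auto
  qed
qed

lemma run_B_firing:
  assumes "p \<in> C'" "C' \<in> \<Gamma>"
  shows "fs_run B C' s p \<in> fs_F B \<longleftrightarrow> s = t \<and> C' \<in> cls \<or> fs_run A C' s p \<in> fs_F A"
proof -
  obtain a where a: "fs_run B C' s p = enc (a, fs_run A C' s p)" "a = None \<or> a = Some (hist C' s p)"
    "s \<le> t \<longrightarrow> a = Some (hist C' s p)" using run_B by blast
  have "a \<in> comps" using run_in_states[OF wf_B, of C' s p] a(1) by (auto simp: B_def)
  moreover have "fs_run A C' s p \<in> fs_states A" by (rule run_in_states[OF wf])
  moreover have "enc x \<in> enc ` X \<longleftrightarrow> x \<in> X" for x X by (auto simp: image_iff)
  moreover have "fs_F B = enc ` (Some ` fire \<times> fs_states A \<union> comps \<times> fs_F A)" by (simp add: B_def)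
  ultimately have "fs_run B C' s p \<in> fs_F B \<longleftrightarrow> a \<in> Some ` fire \<or> fs_run A C' s p \<in> fs_F A"
    unfolding a(1) by simp
  moreover have "a \<in> Some ` fire \<longleftrightarrow> s = t \<and> C' \<in> cls"
  proof
    assume "a \<in> Some ` fire"
    then have "hist C' s p \<in> fire" using a(2) by auto
    then show "s = t \<and> C' \<in> cls" using fire_imp_cls assms by blast
  next
    assume "s = t \<and> C' \<in> cls"
    then have "hist C' t p \<in> fire" "a = Some (hist C' t p)" using a(3) assms unfolding fire_def by blast+
    then show "a \<in> Some ` fire" by simp
  qed
  ultimately show ?thesis by simp
qed

lemma fires_cls: "C' \<in> cls \<Longrightarrow> fires_at B C' t"
  unfolding fires_at_def using run_B_firing[OF _ cls_sub] cls_late by (simp add: less_imp_le) 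

lemma sol_B: "is_solution \<Gamma> B"
  unfolding is_solution_def
proof (intro conjI wf_B ballI)
  fix C' assume C': "C' \<in> \<Gamma>"
  show "\<exists>s. fires_at B C' s"
  proof (cases "C' \<in> cls")
    case True
    then show ?thesis using fires_cls by blast
  next
    case False
    obtain s where "fires_at A C' s" using sol C' by (auto simp: is_solution_def)
    \<comment> \<open>Outside the component B and A enter their firing states at the same
      times.\<close>
    then have "fires_at B C' s" unfolding fires_at_def using run_B_firing[OF _ C'] False by simp
    then show ?thesis by blast
  qed
qed

lemma fires_C: "fires_at B C t"
  by (rule fires_cls) (simp add: cls_def)

end

lemma good_imp_solution:
  assumes sol: "is_solution \<Gamma> A" and C: "C \<in> \<Gamma>" and g: "good \<Gamma> t C"
  shows "\<exists>A' s. is_solution \<Gamma> A' \<and> fires_at A' C s \<and> s \<le> t"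
proof -
  obtain s where s: "fires_at A C s" using sol C by (auto simp: is_solution_def)
  show ?thesis
  proof (cases "s \<le> t")
    case True
    then show ?thesis using s sol by blast
  next
    case False
    then interpret fire_earlier \<Gamma> A C t
      using s by unfold_locales (use sol C g in \<open>auto simp: fires_at_def\<close>)
    show ?thesis using sol_B fires_C by blast
  qed
qed

lemma mft_eq_Least_good:
  assumes "is_solution \<Gamma> A" "C \<in> \<Gamma>" "C \<noteq> {}"
  shows "mft \<Gamma> C = (LEAST t. good \<Gamma> t C)"
proof -
  let ?m = "LEAST t. good \<Gamma> t C"
  have lower: "good \<Gamma> (ft C A') C" if A': "is_solution \<Gamma> A'" for A'
  proof -
    obtain s where "fires_at A' C s" using A' assms(2) by (auto simp: is_solution_def)
    then show ?thesis using fires_at_good[OF A' assms(2)] ft_eq[OF _ assms(3)] by metis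
  qed
  have "good \<Gamma> ?m C" by (rule LeastI[of _ "ft C A"]) (rule lower[OF assms(1)])
  then obtain A' s where A': "is_solution \<Gamma> A'" "fires_at A' C s" "s \<le> ?m"
    using good_imp_solution[OF assms(1,2)] by blast
  have "ft C A' = ?m" using lower[OF A'(1)] ft_eq[OF A'(2) assms(3)] A'(3) Least_le[of "\<lambda>t. good \<Gamma> t C" s] by simp
  then show ?thesis
    unfolding mft_def
  proof (intro Least_equality)
    assume "ft C A' = ?m"
    then show "\<exists>A. is_solution \<Gamma> A \<and> ft C A = ?m" using A'(1) by blast
    show "?m \<le> y" if "\<exists>A. is_solution \<Gamma> A \<and> ft C A = y" for y
      using that lower Least_le[of "\<lambda>t. good \<Gamma> t C"] by blast
  qed
qed

section \<open>Balls, truncation, and an upper bound\<close>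

primrec nball :: "pos set \<Rightarrow> pos \<Rightarrow> nat \<Rightarrow> pos set" where
  "nball C x 0 = {x}"
| "nball C x (Suc s) = nball C x s \<union> {p \<in> C. \<exists>i<4. shift p i \<in> nball C x s}"

lemma nball_sub: "x \<in> C \<Longrightarrow> nball C x s \<subseteq> C"
  by (induction s) auto

lemma nball_mono: "s \<le> r \<Longrightarrow> nball C x s \<subseteq> nball C x r"
  by (rule lift_Suc_mono_le) auto

lemma nball_self: "x \<in> nball C x s"
  using nball_mono[of 0 s C x] by auto

lemma nball_stable: "nball C x (Suc s) = nball C x s \<Longrightarrow> nball C x (s + r) = nball C x s"
  by (induction r) (auto simp del: nball.simps(2) simp: nball.simps(2)[of C x "s + _"] nball.simps(2)[of C x s])

definition opposite :: "nat \<Rightarrow> nat" where "opposite i = (i + 2) mod 4"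

lemma opposite_less: "opposite i < 4"
  by (simp add: opposite_def)

lemma shift_opposite: "i < 4 \<Longrightarrow> shift (shift p i) (opposite i) = p"
  by (auto simp: less_4_iff opposite_def shift_def eps_def)

lemma adjacent_sym: "adjacent p q \<Longrightarrow> adjacent q p"
  unfolding adjacent_def using shift_opposite opposite_less by metis

text \<open>The wake-up signal travels exactly one step per time unit.\<close>

lemma hist_awake:
  assumes "(0,0) \<in> C"
  shows "p \<in> C \<Longrightarrow> hist C s p \<noteq> IQ \<longleftrightarrow> p \<in> nball C (0,0) s"
proof (induction s arbitrary: p)
  case 0
  then show ?case by simp
next
  case (Suc s)
  have "(\<exists>i<4. shift p i \<in> C \<and> hist C s (shift p i) \<noteq> IQ) \<longleftrightarrow> (\<exists>i<4. shift p i \<in> nball C (0,0) s)"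
    using Suc.IH nball_sub[OF assms, of s] by blast
  then show ?case unfolding hist_Suc_neq_IQ nball.simps using Suc by blast
qed

lemma path_in_nball:
  assumes "is_path ps" "set ps \<subseteq> C"
  shows "i < length ps \<Longrightarrow> ps ! i \<in> nball C (hd ps) i"
proof (induction i)
  case 0
  then show ?case by (cases ps) auto
next
  case (Suc i)
  have "adjacent (ps ! Suc i) (ps ! i)" using assms(1) Suc.prems adjacent_sym by (auto simp: is_path_def)
  then obtain k where "k < 4" "shift (ps ! Suc i) k = ps ! i" unfolding adjacent_def by metis
  moreover have "ps ! Suc i \<in> C" using assms(2) Suc.prems nth_mem by blast
  ultimately show ?case using Suc by auto
qed

section \<open>Connectivity measured by growing balls\<close>

definition linked :: "pos set \<Rightarrow> bool" where
  "linked C \<longleftrightarrow> (\<forall>p\<in>C. \<forall>q\<in>C. \<exists>s. q \<in> nball C p s)"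

lemma configs_2REG_linked:
  assumes "C \<in> configs_2REG"
  shows "linked C"
  unfolding linked_def
proof (intro ballI)
  fix p q assume "p \<in> C" "q \<in> C"
  then obtain ps where ps: "is_path ps" "set ps \<subseteq> C" "hd ps = p" "last ps = q"
    using assms unfolding configs_2REG_def by blast
  then have ne: "ps \<noteq> []" by (simp add: is_path_def)
  then have "ps ! (length ps - 1) \<in> nball C (hd ps) (length ps - 1)" using path_in_nball[OF ps(1,2)] by simp
  then show "\<exists>s. q \<in> nball C p s" using ps ne by (auto simp: last_conv_nth)
qed

text \<open>As long as the ball is not all of C it gains a node in each step: a ball that stops
  growing is stable forever, contrary to connectedness.\<close>

lemma nball_card:
  assumes "finite C" "linked C" "x \<in> C"
  shows "nball C x (card C) = C"
proof -
  have sub: "nball C x s \<subseteq> C" for s using nball_sub[OF assms(3)] .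
  have "nball C x s = C \<or> s < card (nball C x s)" for s
  proof (induction s)
    case (Suc s)
    show ?case
    proof (cases "nball C x s = C")
      case True
      then show ?thesis using nball_mono[of s "Suc s" C x] sub[of "Suc s"] by (metis le_SucI order_refl subset_antisym)
    next
      case False
      have "nball C x (Suc s) \<noteq> nball C x s"
      proof
        assume st: "nball C x (Suc s) = nball C x s"
        have "C \<subseteq> nball C x s"
        proof
          fix q assume "q \<in> C"
          then obtain r where "q \<in> nball C x r" using assms unfolding linked_def by blast
          then have "q \<in> nball C x (s + r)" by (rule subsetD[OF nball_mono[OF le_add2]])
          then show "q \<in> nball C x s" using nball_stable[OF st] by simp
        qed
        then show False using False sub by blast
      qed
      then have "nball C x s \<subset> nball C x (Suc s)" by auto
      then have "card (nball C x s) < card (nball C x (Suc s))"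
        by (rule psubset_card_mono[OF finite_subset[OF sub assms(1)]])
      then show ?thesis using Suc False by linarith
    qed
  qed simp
  from this[of "card C"] show ?thesis using card_mono[OF assms(1) sub[of "card C"]] by auto
qed

definition adj_rel :: "pos set \<Rightarrow> (pos \<times> pos) set" where
  "adj_rel C = {(p, q). p \<in> C \<and> q \<in> C \<and> adjacent p q}"

lemma is_path_snoc:
  assumes "is_path ps" "adjacent (last ps) q"
  shows "is_path (ps @ [q])"
  unfolding is_path_def
proof (intro conjI allI impI)
  fix i assume i: "Suc i < length (ps @ [q])"
  have ne: "ps \<noteq> []" using assms(1) by (simp add: is_path_def)
  show "adjacent ((ps @ [q]) ! i) ((ps @ [q]) ! Suc i)"
  proof (cases "Suc i < length ps")
    case True
    then show ?thesis using assms(1) by (simp add: is_path_def nth_append)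
  next
    case False
    then have "i = length ps - 1" "Suc i = length ps" using i by auto
    then show ?thesis using assms(2) ne by (simp add: nth_append last_conv_nth)
  qed
qed simp

lemma rtrancl_path:
  assumes "(p, q) \<in> (adj_rel C)\<^sup>*" "p \<in> C"
  shows "\<exists>ps. is_path ps \<and> set ps \<subseteq> C \<and> hd ps = p \<and> last ps = q"
  using assms(1)
proof (induction rule: rtrancl_induct)
  case base
  show ?case by (rule exI[of _ "[p]"]) (use assms(2) in \<open>simp add: is_path_def\<close>)
next
  case (step q r)
  then obtain ps where ps: "is_path ps" "set ps \<subseteq> C" "hd ps = p" "last ps = q" by blast
  have ne: "ps \<noteq> []" using ps(1) by (simp add: is_path_def)
  have r: "r \<in> C" "adjacent q r" using step.hyps(2) by (auto simp: adj_rel_def)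
  show ?case
    by (rule exI[of _ "ps @ [r]"]) (use ps ne r is_path_snoc[OF ps(1)] in simp)
qed

lemma nball_rtrancl:
  assumes "x \<in> C"
  shows "p \<in> nball C x s \<Longrightarrow> (p, x) \<in> (adj_rel C)\<^sup>*"
proof (induction s arbitrary: p)
  case (Suc s)
  show ?case
  proof (cases "p \<in> nball C x s")
    case False
    then obtain i where i: "p \<in> C" "i < 4" "shift p i \<in> nball C x s" using Suc.prems by auto
    then have "(p, shift p i) \<in> adj_rel C" using nball_sub[OF assms] unfolding adj_rel_def adjacent_def by blast
    then show ?thesis using Suc.IH[OF i(3)] by (rule converse_rtrancl_into_rtrancl)
  qed (use Suc.IH in blast)
qed simp

text \<open>Paths are reversible and can be joined at the general, so it suffices that each node is
  reached from there. This is the form of connectedness that the bit maps test.\<close>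

lemma configs_2REG_iff:
  "C \<in> configs_2REG \<longleftrightarrow> finite C \<and> (0,0) \<in> C \<and> (\<forall>p\<in>C. \<exists>s. p \<in> nball C (0,0) s)"
proof
  assume C: "C \<in> configs_2REG"
  then show "finite C \<and> (0,0) \<in> C \<and> (\<forall>p\<in>C. \<exists>s. p \<in> nball C (0,0) s)"
    using configs_2REG_linked[OF C] unfolding configs_2REG_def linked_def by blast
next
  assume C: "finite C \<and> (0,0) \<in> C \<and> (\<forall>p\<in>C. \<exists>s. p \<in> nball C (0,0) s)"
  have "sym (adj_rel C)" unfolding sym_def adj_rel_def using adjacent_sym by blast
  then have s: "sym ((adj_rel C)\<^sup>*)" by (rule sym_rtrancl)
  have "(p, q) \<in> (adj_rel C)\<^sup>*" if "p \<in> C" "q \<in> C" for p q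
  proof -
    have "(p, (0,0)) \<in> (adj_rel C)\<^sup>*" "(q, (0,0)) \<in> (adj_rel C)\<^sup>*" using C that nball_rtrancl by blast+
    then show ?thesis using s by (meson rtrancl_trans symD)
  qed
  then show "C \<in> configs_2REG" unfolding configs_2REG_def using C rtrancl_path by blast
qed

lemma nball_nball:
  assumes "s \<le> r"
  shows "nball (nball C x r) x s = nball C x s"
  using assms
proof (induction s)
  case (Suc s)
  have "nball C x (Suc s) \<subseteq> nball C x r" using Suc.prems by (rule nball_mono)
  moreover have "nball C x r - {x} \<subseteq> C" by (induction r) auto
  ultimately show ?case using Suc nball_self[of x C s] by auto
qed simp

lemma nball_in_2REG:
  assumes "C \<in> configs_2REG"
  shows "nball C (0,0) r \<in> configs_2REG"
proof -
  have C: "finite C" "(0,0) \<in> C" using assms by (auto simp: configs_2REG_iff)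
  have "finite (nball C (0,0) r)" using nball_sub[OF C(2)] C(1) finite_subset by blast
  then show ?thesis unfolding configs_2REG_iff using nball_self nball_nball[of r r C "(0,0)"] by blast
qed

text \<open>A node awake at time s has distance at most s, and its history also shows which
  neighbours exist, at distance up to s + 1. All farther nodes are asleep in both
  configurations.\<close>

lemma hist_truncate:
  assumes "(0,0) \<in> C" and T: "T = nball C (0,0) (Suc t)"
  shows "s \<le> t \<Longrightarrow> p \<in> T \<Longrightarrow> hist T s p = hist C s p"
proof (induction s arbitrary: p)
  case 0
  have sub: "T \<subseteq> C" using nball_sub[OF assms(1)] T by simp
  have "q \<in> C \<longleftrightarrow> q \<in> T" if "q = shift (0,0) i" "i < 4" for q i
  proof
    assume "q \<in> C"
    moreover have "shift q (opposite i) = (0,0)" using that shift_opposite by simp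
    ultimately have "q \<in> nball C (0,0) (Suc 0)" using opposite_less[of i] by auto
    then show "q \<in> T" unfolding T using nball_mono[of "Suc 0" "Suc t"] by blast
  qed (use sub in blast)
  then show ?case by (simp add: bc_def)
next
  case (Suc s)
  have TC: "T \<subseteq> C" using nball_sub[OF assms(1)] T by simp
  have o: "(0,0) \<in> T" unfolding T by (rule nball_self)
  have IH: "hist T s q = hist C s q" if "q \<in> T" for q using Suc that by simp
  show ?case
  proof (cases "p \<in> nball C (0,0) (Suc s)")
    case True
    have "inbr T (hist T s) p i = inbr C (hist C s) p i" if "i < 4" for i
    proof -
      have "shift p i \<in> T" if "shift p i \<in> C"
      proof -
        have "shift (shift p i) (opposite i) \<in> nball C (0,0) (Suc s)" using True shift_opposite[OF \<open>i < 4\<close>, of p] by (simp only:)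
        then have "shift p i \<in> nball C (0,0) (Suc (Suc s))"
          unfolding nball.simps(2)[of C "(0,0)" "Suc s"] using that opposite_less[of i] by blast
        moreover have "Suc (Suc s) \<le> Suc t" using Suc.prems(1) by simp
        ultimately show ?thesis unfolding T using nball_mono by blast
      qed
      then show ?thesis using IH TC by (auto simp: inbr_def)
    qed
    then show ?thesis using IH[OF Suc.prems(2)] by simp
  next
    case False
    then have "hist C (Suc s) p = IQ" using hist_awake[OF assms(1)] Suc.prems(2) TC by blast
    moreover have "p \<notin> nball T (0,0) (Suc s)"
      using False nball_nball[of "Suc s" "Suc t" C "(0,0)"] Suc.prems(1) unfolding T by simp
    then have "hist T (Suc s) p = IQ" using hist_awake[OF o Suc.prems(2)] by blast
    ultimately show ?thesis by simp
  qed
qed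

text \<open>The component of C is C alone: a configuration sharing an awake history with C this late
  contains C and has the same neighbourhood at each node of C, so by connectedness it cannot be
  larger.\<close>

lemma good_large:
  assumes \<Gamma>: "\<Gamma> \<subseteq> configs_2REG" and C: "C \<in> \<Gamma>" and t: "2 * card C < t"
  shows "good \<Gamma> t C"
proof -
  have fin: "finite C" and o: "(0,0) \<in> C" and l: "linked C"
    using C \<Gamma> configs_2REG_linked[of C] by (auto simp: configs_2REG_iff)
  have all: "nball C x (card C) = C" if "x \<in> C" for x using nball_card[OF fin l that] .
  have awake: "hist C s p \<noteq> IQ" if "p \<in> C" "card C \<le> s" for p s
    using hist_awake[OF o that(1)] all[OF o] nball_mono[OF that(2), of C "(0,0)"] that(1) by blast
  have step: "C' = C" if E: "(C, C') \<in> conf_edges \<Gamma> t" for C'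
  proof -
    obtain p where p: "p \<in> C" "p \<in> C'" "hist C t p = hist C' t p" and C': "C' \<in> \<Gamma>"
      using E by (auto simp: conf_edges_def)
    have l': "linked C'"
      using C' \<Gamma> configs_2REG_linked[of C'] by (auto simp: configs_2REG_iff)
    have nb: "shift r i \<in> C \<longleftrightarrow> shift r i \<in> C'" "shift r i \<in> C \<Longrightarrow> hist C s (shift r i) = hist C' s (shift r i)"
      if "r \<in> C" "hist C (Suc s) r = hist C' (Suc s) r" "card C \<le> Suc s" "i < 4" for r i s
      using hist_Suc_eqD(2)[OF that(2) awake[OF that(1,3)] that(4)] by (auto simp: inbr_def split: if_splits)
    \<comment> \<open>Each step back in time reveals the histories of the neighbours. All times
      involved are at least \<open>card C\<close>, so the nodes are awake and their records do
      contain the neighbours.\<close>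
    have bk: "q \<in> C \<and> q \<in> C' \<and> hist C (t - j) q = hist C' (t - j) q" if "q \<in> nball C p j" "j \<le> card C" for q j
      using that
    proof (induction j arbitrary: q)
      case 0
      then show ?case using p by simp
    next
      case (Suc j)
      have e: "t - j = Suc (t - Suc j)" using t Suc.prems by simp
      have k: "card C \<le> Suc (t - Suc j)" using t Suc.prems by simp
      show ?case
      proof (cases "q \<in> nball C p j")
        case True
        then have q: "q \<in> C" "q \<in> C'" "hist C (t - j) q = hist C' (t - j) q" using Suc by auto
        then show ?thesis using hist_eq_earlier[OF q(3), of "t - Suc j"] by simp
      next
        case False
        then obtain i where i: "q \<in> C" "i < 4" "shift q i \<in> nball C p j" using Suc.prems by auto
        have r: "shift q i \<in> C" "hist C (Suc (t - Suc j)) (shift q i) = hist C' (Suc (t - Suc j)) (shift q i)"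
          using Suc.IH[OF i(3)] Suc.prems e by auto
        show ?thesis using nb[OF r k opposite_less[of i]] i shift_opposite[OF i(2), of q] by auto
      qed
    qed
    \<comment> \<open>At time \<open>t - card C\<close> the agreement has reached all of C, and
      since 2 * card C < t everyone is awake then; one more look back compares which neighbours
      exist.\<close>
    have bdry: "shift r i \<in> C \<longleftrightarrow> shift r i \<in> C'" if "r \<in> C" "i < 4" for r i
    proof -
      have "r \<in> nball C p (card C)" using all[OF p(1)] that by simp
      then have "hist C (t - card C) r = hist C' (t - card C) r" using bk by blast
      moreover have "t - card C = Suc (t - card C - 1)" "card C \<le> Suc (t - card C - 1)" using t by auto
      ultimately show ?thesis using nb(1)[OF that(1) _ _ that(2), of "t - card C - 1"] by simp
    qed
    have "C \<subseteq> C'" using bk all[OF p(1)] by blast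
    moreover have "nball C' p s \<subseteq> C" for s
    proof (induction s)
      case (Suc s)
      have "q \<in> C" if "q \<in> C'" "i < 4" "shift q i \<in> C" for q i
        using bdry[OF that(3) opposite_less[of i]] shift_opposite[OF that(2), of q] that(1) by simp
      then show ?case using Suc by auto
    qed (use p in simp)
    then have "C' \<subseteq> C" using l' p(2) unfolding linked_def by blast
    ultimately show ?thesis by blast
  qed
  have "C' = C" if "(C, C') \<in> (conf_edges \<Gamma> t)\<^sup>*" for C'
    using that by (induction rule: rtrancl_induct) (use step in auto)
  then show ?thesis unfolding good_def
  proof (intro allI impI ballI)
    fix C' p assume r: "(C, C') \<in> (conf_edges \<Gamma> t)\<^sup>*" and p: "p \<in> C'"
    assume "\<And>C'. (C, C') \<in> (conf_edges \<Gamma> t)\<^sup>* \<Longrightarrow> C' = C"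
    then have "C' = C" using r by blast
    then show "hist C' t p \<noteq> IQ" using awake[of p t] p t by simp
  qed
qed

text \<open>The first asleep configuration on a chain can be replaced by its truncation to radius t + 1, which
is still asleep somewhere and shares the same history.\<close>

lemma good_restrict:
  assumes \<Gamma>: "\<Gamma> \<subseteq> configs_2REG" and trunc: "\<And>C r. C \<in> \<Gamma> \<Longrightarrow> nball C (0,0) r \<in> \<Gamma>"
    and \<Delta>: "\<Delta> \<subseteq> \<Gamma>" "\<And>C. C \<in> \<Gamma> \<Longrightarrow> nball C (0,0) (Suc t) \<in> \<Delta>" and C: "C \<in> \<Delta>"
  shows "good \<Gamma> t C \<longleftrightarrow> good \<Delta> t C"
proof
  assume g: "good \<Gamma> t C"
  have "conf_edges \<Delta> t \<subseteq> conf_edges \<Gamma> t" using \<Delta>(1) by (auto simp: conf_edges_def)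
  then show "good \<Delta> t C" using g rtrancl_mono unfolding good_def by blast
next
  assume g: "good \<Delta> t C"
  have "(C, C') \<in> (conf_edges \<Delta> t)\<^sup>* \<and> C' \<in> \<Delta>" if "(C, C') \<in> (conf_edges \<Gamma> t)\<^sup>*" for C'
    using that
  proof (induction rule: rtrancl_induct)
    case base
    then show ?case using C by simp
  next
    case (step C1 C2)
    obtain p where p: "p \<in> C1" "p \<in> C2" "hist C1 t p = hist C2 t p" "hist C1 t p \<noteq> IQ" and C2: "C2 \<in> \<Gamma>"
      using step.hyps(2) by (auto simp: conf_edges_def)
    have o: "(0,0) \<in> C2" and l: "linked C2" using C2 \<Gamma> configs_2REG_linked by (auto simp: configs_2REG_iff)
    let ?T = "nball C2 (0,0) (Suc t)"
    have T\<Delta>: "?T \<in> \<Delta>" using \<Delta>(2) C2 by blast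
    have pt: "p \<in> nball C2 (0,0) t" using hist_awake[OF o p(2)] p(3,4) by simp
    then have pT: "p \<in> ?T" using nball_mono[of t "Suc t"] by auto
    have h: "hist ?T t q = hist C2 t q" if "q \<in> ?T" for q using hist_truncate[OF o refl _ that] by simp
    have "p \<in> C1 \<inter> ?T" "hist C1 t p = hist ?T t p" using p pT h[OF pT] by simp_all
    then have "(C1, ?T) \<in> conf_edges \<Delta> t" using step.IH T\<Delta> p(4) unfolding conf_edges_def by blast
    then have CT: "(C, ?T) \<in> (conf_edges \<Delta> t)\<^sup>*" using step.IH by (meson rtrancl.rtrancl_into_rtrancl)
    \<comment> \<open>The truncation lies in the component, hence is entirely awake at time t. So
      the ball of radius t + 1 has no node outside radius t, the ball is stable, and nothing was cut
      off.\<close>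
    have "?T = nball C2 (0,0) t"
    proof
      show "?T \<subseteq> nball C2 (0,0) t"
      proof
        fix q assume q: "q \<in> ?T"
        then have "hist C2 t q \<noteq> IQ" using g CT h unfolding good_def by metis
        then show "q \<in> nball C2 (0,0) t" using hist_awake[OF o] q nball_sub[OF o, of "Suc t"] by blast
      qed
    qed (rule nball_mono, simp)
    then have "nball C2 (0,0) (t + r) = nball C2 (0,0) t" for r by (rule nball_stable)
    then have "C2 \<subseteq> nball C2 (0,0) t" using l o nball_mono[of _ "t + _" C2 "(0,0)"] unfolding linked_def by (metis le_add2 subsetD subsetI)
    then have "?T = C2" using nball_sub[OF o] nball_mono[of t "Suc t" C2 "(0,0)"] by (metis le_SucI order_refl subset_antisym subset_trans)
    then show ?case using CT T\<Delta> by simp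
  qed
  then show "good \<Gamma> t C" using g unfolding good_def by blast
qed

section \<open>Path configurations and degrees\<close>

definition nbset :: "pos set \<Rightarrow> pos \<Rightarrow> pos set" where
  "nbset C p = {q \<in> C. adjacent p q}"

definition deg :: "pos set \<Rightarrow> pos \<Rightarrow> nat" where
  "deg C p = of_bool (shift p 0 \<in> C) + of_bool (shift p 1 \<in> C) + of_bool (shift p 2 \<in> C) + of_bool (shift p 3 \<in> C)"

lemma shift_inj: "shift p i = shift p j \<Longrightarrow> i < 4 \<Longrightarrow> j < 4 \<Longrightarrow> i = j"
  by (auto simp: shift_def eps_def less_4_iff split: if_splits)

lemma not_adjacent_self: "\<not> adjacent p p"
proof
  assume "adjacent p p"
  then obtain i where "i < 4" "p = shift p i" unfolding adjacent_def by blast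
  then show False by (cases p) (auto simp: less_4_iff shift_def eps_def)
qed

lemma finite_nbset: "finite (nbset C p)"
proof -
  have "nbset C p \<subseteq> shift p ` {..<4}" unfolding nbset_def adjacent_def by auto
  then show ?thesis using finite_subset by blast
qed

lemma deg_eq_card: "deg C p = card (nbset C p)"
proof -
  let ?I = "{i. i < 4 \<and> shift p i \<in> C}"
  have "nbset C p = shift p ` ?I" unfolding nbset_def adjacent_def by auto
  moreover have "inj_on (shift p) ?I" by (rule inj_onI, rule shift_inj[of p]) auto
  ultimately have "card (nbset C p) = card ?I" by (simp add: card_image)
  also have "\<dots> = (\<Sum>i<4. of_bool (shift p i \<in> C))"
  proof -
    have "card ?I = (\<Sum>i\<in>?I. 1)" by simp
    also have "\<dots> = (\<Sum>i<4. if shift p i \<in> C then 1 else 0)"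
      by (rule sum.mono_neutral_cong_left) auto
    finally show ?thesis by (simp add: of_bool_def)
  qed
  also have "\<dots> = deg C p" by (simp add: deg_def numeral_eq_Suc)
  finally show ?thesis by simp
qed

lemma deg_mono: "C \<subseteq> D \<Longrightarrow> deg C p \<le> deg D p"
  unfolding deg_eq_card by (rule card_mono[OF finite_nbset]) (auto simp: nbset_def)

lemma g2path_list_nbset:
  assumes "is_g2path_list ps" "l < length ps"
  shows "nbset (set ps) (ps ! l) \<subseteq> (!) ps ` {m. m < length ps \<and> (m = Suc l \<or> l = Suc m)}"
proof
  fix q assume q: "q \<in> nbset (set ps) (ps ! l)"
  then obtain m where m: "m < length ps" "q = ps ! m" "adjacent (ps ! l) (ps ! m)"
    by (auto simp: nbset_def in_set_conv_nth)
  then have "\<not> (l + 2 \<le> m \<or> m + 2 \<le> l)" using assms unfolding is_g2path_list_def by blast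
  moreover have "l \<noteq> m"
  proof
    assume "l = m"
    then show False using m(3) not_adjacent_self[of "ps ! m"] by simp
  qed
  ultimately have "m = Suc l \<or> l = Suc m" by linarith
  then show "q \<in> (!) ps ` {m. m < length ps \<and> (m = Suc l \<or> l = Suc m)}" using m by blast
qed

lemma g2path_list_deg:
  assumes "is_g2path_list ps" "l < length ps"
  shows "deg (set ps) (ps ! l) \<le> 2" "l = 0 \<or> Suc l = length ps \<Longrightarrow> deg (set ps) (ps ! l) \<le> 1"
proof -
  let ?I = "{m. m < length ps \<and> (m = Suc l \<or> l = Suc m)}"
  have *: "deg (set ps) (ps ! l) \<le> card ?I"
    unfolding deg_eq_card using card_mono[OF _ g2path_list_nbset[OF assms]] card_image_le[of ?I "(!) ps"] by fastforce
  have "?I \<subseteq> {Suc l, l - 1}" by auto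
  then have "card ?I \<le> card {Suc l, l - 1}" by (rule card_mono[rotated]) simp
  also have "\<dots> \<le> 2" by (simp add: card_insert_if)
  finally show "deg (set ps) (ps ! l) \<le> 2" using * by linarith
  show "deg (set ps) (ps ! l) \<le> 1" if "l = 0 \<or> Suc l = length ps"
  proof -
    have "?I \<subseteq> {if l = 0 then 1 else l - 1}" using that by auto
    then have "card ?I \<le> 1" using card_mono[of "{if l = 0 then 1 else l - 1}" ?I] by simp
    then show ?thesis using * by linarith
  qed
qed

lemma g2path_deg_le2:
  assumes "is_g2path_list ps" "p \<in> set ps"
  shows "deg (set ps) p \<le> 2"
proof -
  obtain i where "i < length ps" "ps ! i = p" using assms(2) by (metis in_set_conv_nth)
  then show ?thesis using g2path_list_deg(1)[OF assms(1)] by metis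
qed

text \<open>A longest path from e is closed under taking neighbours.\<close>

lemma deg_imp_path:
  assumes fin: "finite C" and l: "linked C" and o: "(0,0) \<in> C" and d2: "\<And>p. p \<in> C \<Longrightarrow> deg C p \<le> 2"
    and e: "e \<in> C" "deg C e \<le> 1"
  shows "\<exists>ps. is_g2path_list ps \<and> set ps = C \<and> hd ps = e"
proof -
  define P where "P ps \<longleftrightarrow> is_path ps \<and> distinct ps \<and> set ps \<subseteq> C \<and> hd ps = e" for ps
  have "is_path [e]" unfolding is_path_def by simp
  then have "P [e]" unfolding P_def using e(1) by simp
  moreover have "length ps < Suc (card C)" if "P ps" for ps
    using that card_mono[OF fin, of "set ps"] by (simp add: P_def distinct_card less_Suc_eq_le)
  ultimately have "\<exists>ps. P ps \<and> (\<forall>qs. P qs \<longrightarrow> length qs \<le> length ps)"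
    by (intro ex_has_greatest_nat[of P "[e]" length "Suc (card C)"]) (auto intro: less_imp_le)
  then obtain ps where ps: "P ps" and mx: "\<And>qs. P qs \<Longrightarrow> length qs \<le> length ps" by blast
  let ?n = "length ps"
  have ne: "ps \<noteq> []" and sub: "set ps \<subseteq> C" and dist: "distinct ps" and hd: "hd ps = e"
    and adj: "\<And>i. Suc i < ?n \<Longrightarrow> adjacent (ps ! i) (ps ! Suc i)" using ps by (auto simp: P_def is_path_def)
  have inC: "ps ! i \<in> C" if "i < ?n" for i using sub that nth_mem by blast
  \<comment> \<open>The degree bound, 1 at the starting point and 2 elsewhere, is already exhausted
    by the neighbours along the path.\<close>
  have inner: "nbset C (ps ! i) \<subseteq> (!) ps ` {m. m < ?n \<and> (m = Suc i \<or> i = Suc m)}" if i: "Suc i < ?n" for i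
  proof (cases i)
    case 0
    have "ps ! Suc i \<in> nbset C (ps ! i)" using adj[OF i] inC[OF i] by (simp add: nbset_def)
    moreover have "card (nbset C (ps ! i)) \<le> 1" using e(2) hd ne 0 by (simp add: deg_eq_card hd_conv_nth)
    ultimately have "nbset C (ps ! i) = {ps ! Suc i}"
      using card_seteq[OF finite_nbset, of "{ps ! Suc i}" C "ps ! i"] by simp
    then show ?thesis using i by simp
  next
    case (Suc j)
    have j: "Suc j < ?n" "j < ?n" using i Suc by auto
    have "{ps ! j, ps ! Suc i} \<subseteq> nbset C (ps ! i)"
      using adj[OF i] adjacent_sym[OF adj[OF j(1)]] inC[OF i] inC[OF j(2)] Suc by (simp add: nbset_def)
    moreover have "card {ps ! j, ps ! Suc i} = 2" using dist i j Suc by (simp add: nth_eq_iff_index_eq)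
    moreover have "card (nbset C (ps ! i)) \<le> 2" using d2[OF inC, of i] i by (simp add: deg_eq_card)
    ultimately have "{ps ! j, ps ! Suc i} = nbset C (ps ! i)" using card_seteq[OF finite_nbset] by metis
    then have e: "nbset C (ps ! i) = (!) ps ` {j, Suc i}" by (simp only: image_insert image_empty)
    have "{j, Suc i} \<subseteq> {m. m < ?n \<and> (m = Suc i \<or> i = Suc m)}" using i j Suc by auto
    then show ?thesis unfolding e by (rule image_mono)
  qed
  \<comment> \<open>Only the last node could have a neighbour outside the path, and appending it
    would give a longer path.\<close>
  have closed: "nbset C p \<subseteq> set ps" if p: "p \<in> set ps" for p
  proof -
    obtain i where i: "i < ?n" "p = ps ! i" using p by (auto simp: in_set_conv_nth)
    show ?thesis
    proof (cases "Suc i < ?n")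
      case True
      then show ?thesis using inner[OF True] i by auto
    next
      case False
      then have "i = ?n - 1" using i(1) by simp
      then have last: "last ps = p" using i(2) last_conv_nth[OF ne] by simp
      show ?thesis
      proof
        fix q assume q: "q \<in> nbset C p"
        show "q \<in> set ps"
        proof (rule ccontr)
          assume "q \<notin> set ps"
          moreover have "is_path (ps @ [q])" using ps q last is_path_snoc[of ps q] unfolding P_def nbset_def by blast
          ultimately have "P (ps @ [q])" using ps q ne unfolding P_def nbset_def by simp
          then show False using mx[of "ps @ [q]"] by simp
        qed
      qed
    qed
  qed
  have "nball C e s \<subseteq> set ps" for s
  proof (induction s)
    case 0
    then show ?case using ne hd by (metis hd_in_set empty_subsetI insert_subset nball.simps(1))
  next
    case (Suc s)
    have "q \<in> set ps" if "q \<in> C" "i < 4" "shift q i \<in> nball C e s" for q i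
    proof -
      have "adjacent q (shift q i)" using that(2) by (auto simp: adjacent_def)
      then have "q \<in> nbset C (shift q i)" using that(1) adjacent_sym by (simp add: nbset_def)
      then show ?thesis using closed that(3) Suc by blast
    qed
    then show ?case using Suc by auto
  qed
  then have "C \<subseteq> set ps" using l e(1) unfolding linked_def by blast
  then have C: "set ps = C" using sub by blast
  \<comment> \<open>A chord would be one more neighbour of its earlier end, which is not the last
    node and so is covered by \<open>inner\<close>.\<close>
  have na: "\<not> adjacent (ps ! l) (ps ! m)" if lm: "l + 2 \<le> m" "m < ?n" for l m
  proof
    assume "adjacent (ps ! l) (ps ! m)"
    then have "ps ! m \<in> nbset C (ps ! l)" using inC lm by (simp add: nbset_def)
    moreover have "Suc l < ?n" using lm by simp
    ultimately have "ps ! m \<in> (!) ps ` {m. m < ?n \<and> (m = Suc l \<or> l = Suc m)}" using inner[of l] by (rule_tac subsetD)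
    then have "\<exists>k. k < ?n \<and> (k = Suc l \<or> l = Suc k) \<and> ps ! m = ps ! k" by blast
    then obtain k where k: "k < ?n" "k = Suc l \<or> l = Suc k" "ps ! m = ps ! k" by (elim exE conjE)
    have "m = k" using nth_eq_iff_index_eq[OF dist lm(2) k(1)] k(3) by simp
    then show False using k(2) lm(1) by linarith
  qed
  have nn: "\<not> adjacent (ps ! l) (ps ! m)" if lm: "l < ?n" "m < ?n" "l + 2 \<le> m \<or> m + 2 \<le> l" for l m
    using lm(3)
  proof
    assume "l + 2 \<le> m"
    then show ?thesis using na lm(2) by simp
  next
    assume "m + 2 \<le> l"
    then show ?thesis using na[of m l] lm(1) adjacent_sym by blast
  qed
  have p: "is_path ps" "distinct ps" "(0,0) \<in> set ps" using ps o C by (simp_all add: P_def)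
  have "is_g2path_list ps" unfolding is_g2path_list_def by (intro conjI allI impI p nn)
  then show ?thesis using C hd by blast
qed

text \<open>A connected graph of maximal degree 2 is a path or a cycle, and a node of degree at most
  1 excludes the cycle. The degree form is easy to test on a bit map and behaves well under
  truncation.\<close>

lemma configs_g2PATH_iff:
  "C \<in> configs_g2PATH \<longleftrightarrow> C \<in> configs_2REG \<and> (\<forall>p\<in>C. deg C p \<le> 2) \<and> (\<exists>p\<in>C. deg C p \<le> 1)"
proof
  assume C: "C \<in> configs_g2PATH"
  then obtain ps where ps: "is_g2path_list ps" "set ps = C" by (auto simp: configs_g2PATH_def)
  then have n: "0 < length ps" by (auto simp: is_g2path_list_def is_path_def)
  then have "ps ! 0 \<in> C" "deg C (ps ! 0) \<le> 1" using ps(2) g2path_list_deg(2)[OF ps(1) n] nth_mem[OF n] by simp_all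
  moreover have "C \<in> configs_2REG" using C by (simp add: configs_g2PATH_def)
  ultimately show "C \<in> configs_2REG \<and> (\<forall>p\<in>C. deg C p \<le> 2) \<and> (\<exists>p\<in>C. deg C p \<le> 1)"
    using g2path_deg_le2[OF ps(1)] ps(2) by blast
next
  assume C: "C \<in> configs_2REG \<and> (\<forall>p\<in>C. deg C p \<le> 2) \<and> (\<exists>p\<in>C. deg C p \<le> 1)"
  then obtain e where e: "e \<in> C" "deg C e \<le> 1" by blast
  have "\<exists>ps. is_g2path_list ps \<and> set ps = C \<and> hd ps = e"
    by (rule deg_imp_path) (use C e configs_2REG_linked[of C] in \<open>simp_all add: configs_2REG_iff\<close>)
  then show "C \<in> configs_g2PATH" using C unfolding configs_g2PATH_def by blast
qed

lemma configs_2PATH_iff: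
  "C \<in> configs_2PATH \<longleftrightarrow> C \<in> configs_2REG \<and> (\<forall>p\<in>C. deg C p \<le> 2) \<and> deg C (0,0) \<le> 1"
proof
  assume C: "C \<in> configs_2PATH"
  then obtain ps where ps: "is_g2path_list ps" "set ps = C" "hd ps = (0,0) \<or> last ps = (0,0)" by (auto simp: configs_2PATH_def)
  then have ne: "ps \<noteq> []" by (auto simp: is_g2path_list_def is_path_def)
  then have "ps ! 0 = (0,0) \<or> ps ! (length ps - 1) = (0,0)" using ps(3) by (simp add: hd_conv_nth last_conv_nth)
  then have "deg C (0,0) \<le> 1" using ps(2) ne g2path_list_deg(2)[OF ps(1), of 0] g2path_list_deg(2)[OF ps(1), of "length ps - 1"]
    by auto
  moreover have "\<forall>p\<in>C. deg C p \<le> 2" using ps(2) g2path_deg_le2[OF ps(1)] by blast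
  moreover have "C \<in> configs_2REG" using C by (simp add: configs_2PATH_def)
  ultimately show "C \<in> configs_2REG \<and> (\<forall>p\<in>C. deg C p \<le> 2) \<and> deg C (0,0) \<le> 1" by blast
next
  assume C: "C \<in> configs_2REG \<and> (\<forall>p\<in>C. deg C p \<le> 2) \<and> deg C (0,0) \<le> 1"
  then have "\<exists>ps. is_g2path_list ps \<and> set ps = C \<and> hd ps = (0,0)"
    using configs_2REG_linked[of C] by (intro deg_imp_path) (auto simp: configs_2REG_iff)
  then show "C \<in> configs_2PATH" using C unfolding configs_2PATH_def by blast
qed

lemma nball_in_2PATH:
  assumes "C \<in> configs_2PATH"
  shows "nball C (0,0) r \<in> configs_2PATH"
proof -
  have C: "C \<in> configs_2REG" "\<forall>p\<in>C. deg C p \<le> 2" "deg C (0,0) \<le> 1" using assms by (simp_all add: configs_2PATH_iff)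
  have sub: "nball C (0,0) r \<subseteq> C" using C(1) by (intro nball_sub) (simp add: configs_2REG_iff)
  have "deg (nball C (0,0) r) p \<le> 2" if "p \<in> nball C (0,0) r" for p
    by (rule le_trans[OF deg_mono[OF sub] C(2)[THEN bspec, OF subsetD[OF sub that]]])
  moreover have "deg (nball C (0,0) r) (0,0) \<le> 1" using deg_mono[OF sub, of "(0,0)"] C(3) by linarith
  ultimately show ?thesis unfolding configs_2PATH_iff using nball_in_2REG[OF C(1)] by blast
qed

text \<open>Either the ball is all of C, or some node of C outside it is adjacent to a node of the
  ball, whose degree inside the ball has then dropped to at most 1.\<close>

lemma nball_in_g2PATH:
  assumes "C \<in> configs_g2PATH"
  shows "nball C (0,0) r \<in> configs_g2PATH"
proof -
  have C: "C \<in> configs_2REG" "\<forall>p\<in>C. deg C p \<le> 2" "\<exists>p\<in>C. deg C p \<le> 1" using assms by (simp_all add: configs_g2PATH_iff)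
  have o: "(0,0) \<in> C" and l: "linked C" using C(1) configs_2REG_linked by (auto simp: configs_2REG_iff)
  let ?T = "nball C (0,0) r"
  have sub: "?T \<subseteq> C" using nball_sub[OF o] .
  have "\<exists>p\<in>?T. deg ?T p \<le> 1"
  proof (cases "nball C (0,0) (Suc r) = ?T")
    case True
    have "p \<in> ?T" if "p \<in> C" for p
    proof -
      have "\<exists>s. p \<in> nball C (0,0) s" by (rule l[unfolded linked_def, THEN bspec, OF o, THEN bspec, OF that])
      then obtain s where "p \<in> nball C (0,0) s" ..
      then have "p \<in> nball C (0,0) (r + s)" by (rule subsetD[OF nball_mono[OF le_add2]])
      then show ?thesis unfolding nball_stable[OF True] .
    qed
    then have "C \<subseteq> ?T" by (rule subsetI)
    then have eq: "?T = C" by (rule subset_antisym[OF sub])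
    show ?thesis unfolding eq by (rule C(3))
  next
    case False
    then have "\<not> {p \<in> C. \<exists>i<4. shift p i \<in> ?T} \<subseteq> ?T" unfolding nball.simps(2)[of C "(0,0)" r] by blast
    then obtain q i where q: "q \<in> C" "q \<notin> ?T" "i < 4" "shift q i \<in> ?T" by blast
    let ?p = "shift q i"
    have "adjacent q ?p" using q(3) by (auto simp: adjacent_def)
    then have "q \<in> nbset C ?p" using q(1) adjacent_sym by (simp add: nbset_def)
    moreover have "nbset ?T ?p \<subseteq> nbset C ?p" "q \<notin> nbset ?T ?p" using sub q(2) by (auto simp: nbset_def)
    ultimately have "nbset ?T ?p \<subset> nbset C ?p" by blast
    then have "deg ?T ?p < deg C ?p" unfolding deg_eq_card by (rule psubset_card_mono[OF finite_nbset])
    moreover have "deg C ?p \<le> 2" using C(2) sub q(4) by blast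
    ultimately have "deg ?T ?p \<le> 1" by linarith
    then show ?thesis using q(4) by (rule bexI)
  qed
  moreover have "deg ?T p \<le> 2" if "p \<in> ?T" for p
    by (rule le_trans[OF deg_mono[OF sub] C(2)[THEN bspec, OF subsetD[OF sub that]]])
  ultimately show ?thesis unfolding configs_g2PATH_iff using nball_in_2REG[OF C(1)] by blast
qed

section \<open>Configurations as bit maps\<close>

text \<open>Cell (x, y) of the L times L square, L = 2 * T + 1, has index (x + T) * L + (y + T), so its neighbours have
index i + L, i + 1, i - L, i - 1. Codes of configurations leave the outermost cells empty, so nothing wraps
around and no subtraction truncates. M is the number of cells.\<close>

definition centre :: "nat \<Rightarrow> nat" where
  "centre L = (L div 2) * L + L div 2"

definition inner_index :: "nat \<Rightarrow> nat \<Rightarrow> bool" where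
  "inner_index L i \<longleftrightarrow> 0 < i div L \<and> i div L + 1 < L \<and> 0 < i mod L \<and> i mod L + 1 < L"

primrec awake_map :: "nat \<Rightarrow> nat \<Rightarrow> nat \<Rightarrow> nat \<Rightarrow> nat" where
  "awake_map L M c 0 = compr M (\<lambda>i. i = centre L)"
| "awake_map L M c (Suc s) = compr M (\<lambda>i. bit c i \<and> (bit (awake_map L M c s) i \<or> bit (awake_map L M c s) (i + L) \<or>
     bit (awake_map L M c s) (i + 1) \<or> bit (awake_map L M c s) (i - L) \<or> bit (awake_map L M c s) (i - 1)))"

definition same_nbrs :: "nat \<Rightarrow> nat \<Rightarrow> nat \<Rightarrow> nat \<Rightarrow> bool" where
  "same_nbrs L c d i \<longleftrightarrow> (bit c (i + L) \<longleftrightarrow> bit d (i + L)) \<and> (bit c (i + 1) \<longleftrightarrow> bit d (i + 1)) \<and>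
     (bit c (i - L) \<longleftrightarrow> bit d (i - L)) \<and> (bit c (i - 1) \<longleftrightarrow> bit d (i - 1))"

definition nbrs_in :: "nat \<Rightarrow> nat \<Rightarrow> nat \<Rightarrow> nat \<Rightarrow> bool" where
  "nbrs_in L c h i \<longleftrightarrow> (bit c (i + L) \<longrightarrow> bit h (i + L)) \<and> (bit c (i + 1) \<longrightarrow> bit h (i + 1)) \<and>
     (bit c (i - L) \<longrightarrow> bit h (i - L)) \<and> (bit c (i - 1) \<longrightarrow> bit h (i - 1))"

text \<open>Equality of histories at common nodes, computed without writing the histories down: both
  asleep, or previous agreement at the node and at all its neighbours, which must be the same. At
  time 0 only the general's record depends on the configuration, through its boundary.\<close>

primrec agree_map :: "nat \<Rightarrow> nat \<Rightarrow> nat \<Rightarrow> nat \<Rightarrow> nat \<Rightarrow> nat" where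
  "agree_map L M c d 0 = compr M (\<lambda>i. bit c i \<and> bit d i \<and> (i = centre L \<longrightarrow> same_nbrs L c d i))"
| "agree_map L M c d (Suc s) = compr M (\<lambda>i. bit c i \<and> bit d i \<and>
     (\<not> bit (awake_map L M c (Suc s)) i \<and> \<not> bit (awake_map L M d (Suc s)) i \<or>
      bit (agree_map L M c d s) i \<and> same_nbrs L c d i \<and> nbrs_in L c (agree_map L M c d s) i))"

definition edge_code :: "nat \<Rightarrow> nat \<Rightarrow> nat \<Rightarrow> nat \<Rightarrow> nat \<Rightarrow> bool" where
  "edge_code L M t c d \<longleftrightarrow> (\<exists>i<M. bit (agree_map L M c d t) i \<and> bit (awake_map L M c t) i)"

definition asleep_code :: "nat \<Rightarrow> nat \<Rightarrow> nat \<Rightarrow> nat \<Rightarrow> bool" where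
  "asleep_code L M t c \<longleftrightarrow> (\<exists>i<M. bit c i \<and> \<not> bit (awake_map L M c t) i)"

definition deg_code :: "nat \<Rightarrow> nat \<Rightarrow> nat \<Rightarrow> nat" where
  "deg_code L c i = of_bool (bit c (i + L)) + of_bool (bit c (i + 1)) + of_bool (bit c (i - L)) + of_bool (bit c (i - 1))"

text \<open>Connectedness is tested by the wake-up signal itself: M steps suffice, as there are only
  M cells.\<close>

definition valid_code :: "nat \<Rightarrow> nat \<Rightarrow> nat \<Rightarrow> nat \<Rightarrow> bool" where
  "valid_code g L M c \<longleftrightarrow> bit c (centre L) \<and> (\<forall>i<M. bit c i \<longrightarrow> inner_index L i) \<and> \<not> asleep_code L M M c \<and>
     (g = 0 \<or> (\<forall>i<M. bit c i \<longrightarrow> deg_code L c i \<le> 2) \<and>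
       (g = 1 \<longrightarrow> (\<exists>i<M. bit c i \<and> deg_code L c i \<le> 1)) \<and> (g \<noteq> 1 \<longrightarrow> deg_code L c (centre L) \<le> 1))"

text \<open>The disjunct \<open>c = d\<close> provides the reflexivity on which padding of walks
  relies, also at numbers that are no codes.\<close>

definition step_code :: "nat \<Rightarrow> nat \<Rightarrow> nat \<Rightarrow> nat \<Rightarrow> nat \<Rightarrow> nat \<Rightarrow> bool" where
  "step_code g L M t c d \<longleftrightarrow> c = d \<or> valid_code g L M c \<and> valid_code g L M d \<and> edge_code L M t c d"

definition good_code :: "nat \<Rightarrow> nat \<Rightarrow> nat \<Rightarrow> nat \<Rightarrow> nat \<Rightarrow> bool" where
  "good_code g L M t c \<longleftrightarrow> \<not> (\<exists>v<2^M. savitch (2^M) (step_code g L M t) (2 * M) c v \<and> asleep_code L M t v)"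

text \<open>g = 0, 1, 2 select 2REG, g-2PATH and 2PATH.\<close>

definition gamma :: "nat \<Rightarrow> pos set set" where
  "gamma g = {C \<in> configs_2REG. g = 0 \<or> (\<forall>p\<in>C. deg C p \<le> 2) \<and> (g = 1 \<longrightarrow> (\<exists>p\<in>C. deg C p \<le> 1)) \<and> (g \<noteq> 1 \<longrightarrow> deg C (0,0) \<le> 1)}"

lemma gamma_0: "gamma 0 = configs_2REG"
  and gamma_1: "gamma 1 = configs_g2PATH"
  and gamma_2: "gamma 2 = configs_2PATH"
  by (rule set_eqI, simp add: gamma_def configs_g2PATH_iff configs_2PATH_iff)+

lemma gamma_cases: "gamma g = gamma 0 \<or> gamma g = gamma 1 \<or> gamma g = gamma 2"
  by (auto simp: gamma_def)

lemma gamma_sub: "gamma g \<subseteq> configs_2REG"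
  by (auto simp: gamma_def)

lemma nball_in_gamma: "C \<in> gamma g \<Longrightarrow> nball C (0,0) r \<in> gamma g"
  using gamma_cases[of g] nball_in_2REG nball_in_g2PATH nball_in_2PATH
  unfolding gamma_0 gamma_1 gamma_2 by metis

locale grid =
  fixes T :: nat
  assumes T: "0 < T"
begin

definition L :: nat where "L = 2 * T + 1"
definition M :: nat where "M = L * L"
definition box :: "pos set" where "box = {p. \<bar>fst p\<bar> \<le> int T \<and> \<bar>snd p\<bar> \<le> int T}"
definition inner :: "pos set" where "inner = {p. \<bar>fst p\<bar> < int T \<and> \<bar>snd p\<bar> < int T}"
definition idx :: "pos \<Rightarrow> nat" where "idx p = nat (fst p + int T) * L + nat (snd p + int T)"

lemma L0: "0 < L" by (simp add: L_def)

lemma inner_box: "inner \<subseteq> box" by (auto simp: inner_def box_def)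

lemma idx_div: "p \<in> box \<Longrightarrow> idx p div L = nat (fst p + int T)"
  and idx_mod: "p \<in> box \<Longrightarrow> idx p mod L = nat (snd p + int T)"
proof -
  assume "p \<in> box"
  then have "nat (snd p + int T) < L" by (auto simp: box_def L_def)
  then show "idx p div L = nat (fst p + int T)" "idx p mod L = nat (snd p + int T)"
    by (simp_all add: idx_def)
qed

lemma idx_inj: "p \<in> box \<Longrightarrow> q \<in> box \<Longrightarrow> idx p = idx q \<Longrightarrow> p = q"
proof (rule prod_eqI)
  assume a: "p \<in> box" "q \<in> box" "idx p = idx q"
  then have "nat (fst p + int T) = nat (fst q + int T)" "nat (snd p + int T) = nat (snd q + int T)"
    using idx_div idx_mod by metis+
  moreover have "- int T \<le> fst p" "- int T \<le> snd p" "- int T \<le> fst q" "- int T \<le> snd q" using a by (auto simp: box_def)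
  ultimately show "fst p = fst q" "snd p = snd q" by linarith+
qed

lemma idx_less: "p \<in> box \<Longrightarrow> idx p < M"
proof -
  assume p: "p \<in> box"
  have "nat (fst p + int T) < L" using p by (auto simp: box_def L_def)
  then have "idx p div L < L" using idx_div[OF p] by simp
  then show ?thesis unfolding M_def using L0 by (simp add: div_less_iff_less_mult)
qed

lemma idx_surj: "i < M \<Longrightarrow> \<exists>p\<in>box. idx p = i"
proof
  let ?p = "(int (i div L) - int T, int (i mod L) - int T)"
  assume "i < M"
  then have a: "i div L < L" by (simp add: M_def less_mult_imp_div_less)
  have b: "i mod L < L" using L0 by simp
  have "y < L \<Longrightarrow> \<bar>int y - int T\<bar> \<le> int T" for y by (simp add: L_def)
  from this[OF a] this[OF b] show "?p \<in> box" by (simp add: box_def)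
  show "idx ?p = i" by (simp add: idx_def)
qed

lemma inner_index_idx: "p \<in> box \<Longrightarrow> inner_index L (idx p) \<longleftrightarrow> p \<in> inner"
  unfolding inner_index_def idx_div idx_mod by (auto simp: inner_def box_def L_def)

lemma idx_centre: "idx (0,0) = centre L"
  by (simp add: idx_def centre_def L_def)

lemma zero_inner: "(0,0) \<in> inner"
  using T by (simp add: inner_def)

lemma idx_shift:
  assumes "p \<in> inner"
  shows "idx (shift p 0) = idx p + L" "idx (shift p 1) = idx p + 1" "idx (shift p 2) = idx p - L" "idx (shift p 3) = idx p - 1"
proof -
  have a: "- int T < fst p" "- int T < snd p" using assms by (auto simp: inner_def)
  obtain m where m: "nat (fst p + int T) = Suc m" using a by (cases "nat (fst p + int T)") auto
  obtain n where n: "nat (snd p + int T) = Suc n" using a by (cases "nat (snd p + int T)") auto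
  have "nat (fst p + 1 + int T) = Suc (Suc m)" "nat (fst p - 1 + int T) = m"
    "nat (snd p + 1 + int T) = Suc (Suc n)" "nat (snd p - 1 + int T) = n" using m n by linarith+
  then show "idx (shift p 0) = idx p + L" "idx (shift p 1) = idx p + 1" "idx (shift p 2) = idx p - L" "idx (shift p 3) = idx p - 1"
    using m n by (simp_all add: idx_def shift_def eps_def)
qed

lemma shift_box: "p \<in> inner \<Longrightarrow> shift p i \<in> box"
  by (auto simp: inner_def box_def shift_def eps_def)

section \<open>Bit maps read as configurations\<close>

definition inn :: "nat \<Rightarrow> bool" where "inn c \<longleftrightarrow> (\<forall>i<M. bit c i \<longrightarrow> inner_index L i)"
definition dec :: "nat \<Rightarrow> pos set" where "dec c = {p \<in> inner. bit c (idx p)}"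
definition code :: "pos set \<Rightarrow> nat" where "code C = compr M (\<lambda>i. \<exists>p\<in>C. idx p = i)"

lemma dec_inner: "dec c \<subseteq> inner" by (auto simp: dec_def)

lemma inn_bit: "inn c \<Longrightarrow> p \<in> box \<Longrightarrow> bit c (idx p) \<longleftrightarrow> p \<in> dec c"
  using idx_less inner_index_idx unfolding inn_def dec_def by blast

lemma dec_code: "C \<subseteq> inner \<Longrightarrow> dec (code C) = C"
  unfolding dec_def code_def bit_compr using idx_less idx_inj inner_box by blast

lemma inn_code: "C \<subseteq> inner \<Longrightarrow> inn (code C)"
  unfolding inn_def code_def bit_compr using inner_index_idx inner_box by blast

lemma inn_sub: "inn c \<Longrightarrow> (\<And>i. bit a i \<Longrightarrow> bit c i) \<Longrightarrow> inn a"
  unfolding inn_def by blast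

lemma bits_shift:
  assumes "inn c" "p \<in> inner"
  shows "bit c (idx p) \<longleftrightarrow> p \<in> dec c" "bit c (idx p + L) \<longleftrightarrow> shift p 0 \<in> dec c" "bit c (idx p + 1) \<longleftrightarrow> shift p 1 \<in> dec c"
    "bit c (idx p - L) \<longleftrightarrow> shift p 2 \<in> dec c" "bit c (idx p - 1) \<longleftrightarrow> shift p 3 \<in> dec c"
  unfolding idx_shift[OF assms(2), symmetric]
  using inn_bit[OF assms(1)] shift_box[OF assms(2)] inner_box assms(2) by blast+

lemma awake_map_sub: "bit c (centre L) \<Longrightarrow> bit (awake_map L M c s) i \<Longrightarrow> bit c i"
  by (cases s) (auto simp: bit_compr)

lemma dec_awake_map:
  assumes c: "inn c" "bit c (centre L)"
  shows "dec (awake_map L M c s) = nball (dec c) (0,0) s"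
proof (induction s)
  case 0
  have "bit (awake_map L M c 0) (idx p) \<longleftrightarrow> p = (0,0)" if "p \<in> inner" for p
    using that idx_less idx_inj[of p "(0,0)"] inner_box zero_inner unfolding awake_map.simps bit_compr idx_centre[symmetric] by blast
  then show ?case unfolding dec_def using zero_inner by auto
next
  case (Suc s)
  let ?a = "awake_map L M c s"
  have ia: "inn ?a" using inn_sub[OF c(1)] awake_map_sub[OF c(2)] by blast
  have "bit (awake_map L M c (Suc s)) (idx p) \<longleftrightarrow> p \<in> nball (dec c) (0,0) (Suc s)" if p: "p \<in> inner" for p
  proof -
    have "p \<in> nball (dec c) (0,0) s \<Longrightarrow> p \<in> dec c"
      using Suc awake_map_sub[OF c(2)] unfolding dec_def by blast
    moreover have "idx p < M" using p inner_box idx_less by blast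
    ultimately show ?thesis
      unfolding awake_map.simps bit_compr bits_shift[OF ia p] bits_shift(1)[OF c(1) p] Suc nball.simps Un_iff mem_Collect_eq ex_less_4
      by blast
  qed
  moreover have "nball (dec c) (0,0) (Suc s) \<subseteq> inner"
    using nball_sub[of "(0,0)" "dec c"] dec_inner c zero_inner idx_centre unfolding dec_def by fastforce
  ultimately show ?case unfolding dec_def by blast
qed

lemma awake_bit:
  assumes c: "inn c" "bit c (centre L)" and p: "p \<in> dec c"
  shows "bit (awake_map L M c s) (idx p) \<longleftrightarrow> hist (dec c) s p \<noteq> IQ"
proof -
  have o: "(0,0) \<in> dec c" using c zero_inner by (simp add: dec_def idx_centre)
  have "p \<in> inner" using p dec_inner by blast
  then have "bit (awake_map L M c s) (idx p) \<longleftrightarrow> p \<in> dec (awake_map L M c s)" by (simp add: dec_def)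
  then show ?thesis using hist_awake[OF o p] dec_awake_map[OF c] by simp
qed

text \<open>A quiescent history does not record its neighbours, hence the separate first
  alternative; the second is the recursion step of \<open>agree_map\<close>.\<close>

lemma hist_Suc_eq_iff:
  assumes "p \<in> C" "p \<in> D"
  shows "hist C (Suc s) p = hist D (Suc s) p \<longleftrightarrow> hist C (Suc s) p = IQ \<and> hist D (Suc s) p = IQ \<or>
    hist C s p = hist D s p \<and> (\<forall>i<4. (shift p i \<in> C \<longleftrightarrow> shift p i \<in> D) \<and> (shift p i \<in> C \<longrightarrow> hist C s (shift p i) = hist D s (shift p i)))"
    (is "?l \<longleftrightarrow> ?q \<or> ?e \<and> ?n")
proof -
  have n: "?n \<longleftrightarrow> (\<forall>i<4. inbr C (hist C s) p i = inbr D (hist D s) p i)"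
    unfolding inbr_def by (auto split: if_splits)
  have 1: "?q \<or> ?e \<and> ?n" if ?l
    unfolding n using hist_Suc_eqD[OF that] that by metis
  have 2: ?l if "?e" "\<forall>i<4. inbr C (hist C s) p i = inbr D (hist D s) p i"
    using that(2)[rule_format, of 0] that(2)[rule_format, of 1] that(2)[rule_format, of 2] that(2)[rule_format, of 3] that(1)
    by simp
  show ?thesis using 1 2 n by metis
qed

lemma agree_map_bit:
  assumes c: "inn c" "bit c (centre L)" and d: "inn d" "bit d (centre L)"
  shows "p \<in> inner \<Longrightarrow> bit (agree_map L M c d s) (idx p) \<longleftrightarrow>
    p \<in> dec c \<and> p \<in> dec d \<and> hist (dec c) s p = hist (dec d) s p"
proof (induction s arbitrary: p)
  case 0
  have i: "idx p < M" using 0 inner_box idx_less by blast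
  have o: "idx p = centre L \<longleftrightarrow> p = (0,0)"
    using 0 idx_inj[of p "(0,0)"] inner_box zero_inner idx_centre by auto
  have "same_nbrs L c d (idx p) \<longleftrightarrow> bc (dec c) p = bc (dec d) p"
    unfolding same_nbrs_def bits_shift[OF c(1) 0] bits_shift[OF d(1) 0] bc_def by auto
  then show ?case unfolding agree_map.simps bit_compr o bits_shift(1)[OF c(1) 0] bits_shift(1)[OF d(1) 0]
    using i by auto
next
  case (Suc s)
  note p = Suc.prems
  let ?h = "agree_map L M c d s"
  have i: "idx p < M" using p inner_box idx_less by blast
  have "inn ?h"
    by (rule inn_sub[OF c(1)]) (cases s, auto simp: bit_compr)
  have IH: "q \<in> dec ?h \<longleftrightarrow> q \<in> dec c \<and> q \<in> dec d \<and> hist (dec c) s q = hist (dec d) s q" for q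
    using Suc.IH[of q] dec_inner[of c] unfolding dec_def[of ?h] by blast
  show ?case
  proof (cases "p \<in> dec c \<and> p \<in> dec d")
    case True
    then have pc: "p \<in> dec c" "p \<in> dec d" by auto
    have nb: "same_nbrs L c d (idx p) \<and> nbrs_in L c ?h (idx p) \<longleftrightarrow>
      (\<forall>i<4. (shift p i \<in> dec c \<longleftrightarrow> shift p i \<in> dec d) \<and> (shift p i \<in> dec c \<longrightarrow> hist (dec c) s (shift p i) = hist (dec d) s (shift p i)))"
      unfolding same_nbrs_def nbrs_in_def bits_shift[OF c(1) p] bits_shift[OF d(1) p] bits_shift[OF \<open>inn ?h\<close> p] IH less_4_iff by blast
    have "bit (agree_map L M c d (Suc s)) (idx p) \<longleftrightarrow>
      (\<not> bit (awake_map L M c (Suc s)) (idx p) \<and> \<not> bit (awake_map L M d (Suc s)) (idx p) \<or>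
       bit ?h (idx p) \<and> same_nbrs L c d (idx p) \<and> nbrs_in L c ?h (idx p))"
      unfolding agree_map.simps bit_compr bits_shift(1)[OF c(1) p] bits_shift(1)[OF d(1) p] using i pc by blast
    also have "\<dots> \<longleftrightarrow> hist (dec c) (Suc s) p = hist (dec d) (Suc s) p"
      unfolding awake_bit[OF c pc(1)] awake_bit[OF d pc(2)] hist_Suc_eq_iff[OF pc] nb Suc.IH[OF p] using pc by blast
    finally show ?thesis using pc by blast
  next
    case False
    then show ?thesis unfolding agree_map.simps bit_compr bits_shift(1)[OF c(1) p] bits_shift(1)[OF d(1) p] by blast
  qed
qed

lemma ex_index_dec:
  assumes "inn c"
  shows "(\<exists>i<M. bit c i \<and> P i) \<longleftrightarrow> (\<exists>p\<in>dec c. P (idx p))"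
proof
  assume "\<exists>i<M. bit c i \<and> P i"
  then obtain i where i: "i < M" "bit c i" "P i" by blast
  then obtain p where p: "p \<in> box" "idx p = i" using idx_surj by blast
  then have "p \<in> dec c" using inn_bit[OF assms p(1)] i by simp
  then show "\<exists>p\<in>dec c. P (idx p)" using i p by blast
next
  assume "\<exists>p\<in>dec c. P (idx p)"
  then show "\<exists>i<M. bit c i \<and> P i" unfolding dec_def using idx_less inner_box by blast
qed

lemma all_index_dec:
  assumes "inn c"
  shows "(\<forall>i<M. bit c i \<longrightarrow> P i) \<longleftrightarrow> (\<forall>p\<in>dec c. P (idx p))"
  using ex_index_dec[OF assms, of "\<lambda>i. \<not> P i"] by blast

lemma edge_code_iff:
  assumes c: "inn c" "bit c (centre L)" and d: "inn d" "bit d (centre L)"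
  shows "edge_code L M t c d \<longleftrightarrow> (\<exists>p\<in>dec c \<inter> dec d. hist (dec c) t p = hist (dec d) t p \<and> hist (dec c) t p \<noteq> IQ)"
proof -
  have "edge_code L M t c d \<longleftrightarrow> (\<exists>i<M. bit c i \<and> (bit (agree_map L M c d t) i \<and> bit (awake_map L M c t) i))"
    unfolding edge_code_def using awake_map_sub[OF c(2)] by blast
  also have "\<dots> \<longleftrightarrow> (\<exists>p\<in>dec c. bit (agree_map L M c d t) (idx p) \<and> bit (awake_map L M c t) (idx p))"
    by (rule ex_index_dec[OF c(1)])
  also have "\<dots> \<longleftrightarrow> (\<exists>p\<in>dec c \<inter> dec d. hist (dec c) t p = hist (dec d) t p \<and> hist (dec c) t p \<noteq> IQ)"
    using agree_map_bit[OF c d] awake_bit[OF c] dec_inner[of c] by blast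
  finally show ?thesis .
qed

lemma asleep_code_iff:
  assumes c: "inn c" "bit c (centre L)"
  shows "asleep_code L M t c \<longleftrightarrow> (\<exists>p\<in>dec c. hist (dec c) t p = IQ)"
  unfolding asleep_code_def ex_index_dec[OF c(1)] using awake_bit[OF c] by blast

lemma deg_code_eq: "inn c \<Longrightarrow> p \<in> inner \<Longrightarrow> deg_code L c (idx p) = deg (dec c) p"
  unfolding deg_code_def deg_def using bits_shift by (simp only:)

lemma finite_inner: "finite inner"
proof -
  have "inner \<subseteq> {- int T..int T} \<times> {- int T..int T}" by (auto simp: inner_def)
  then show ?thesis using finite_subset by blast
qed

lemma card_inner_le: "C \<subseteq> inner \<Longrightarrow> card C \<le> M"
proof -
  assume C: "C \<subseteq> inner"
  have "inj_on idx C" using idx_inj C inner_box by (meson inj_onI subsetD)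
  moreover have "idx ` C \<subseteq> {..<M}" using idx_less C inner_box by blast
  ultimately show ?thesis using card_inj_on_le[of idx C "{..<M}"] by simp
qed

lemma linked_all_awake:
  assumes C: "C \<in> configs_2REG" "C \<subseteq> inner" and p: "p \<in> C"
  shows "hist C M p \<noteq> IQ"
proof -
  have o: "finite C" "(0,0) \<in> C" using C(1) by (auto simp: configs_2REG_iff)
  have "p \<in> nball C (0,0) (card C)" using nball_card[OF o(1) configs_2REG_linked[OF C(1)] o(2)] p by simp
  then have "p \<in> nball C (0,0) M" using nball_mono[OF card_inner_le[OF C(2)]] by blast
  then show ?thesis using hist_awake[OF o(2) p] by blast
qed

lemma valid_code_iff: "valid_code g L M c \<longleftrightarrow> inn c \<and> dec c \<in> gamma g"
proof (cases "inn c \<and> bit c (centre L)")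
  case False
  have "bit c (centre L)" if "dec c \<in> gamma g"
    using that gamma_sub[of g] unfolding configs_2REG_iff dec_def idx_centre[symmetric] gamma_def by auto
  then show ?thesis using False unfolding valid_code_def inn_def by blast
next
  case True
  then have c: "inn c" "bit c (centre L)" by auto
  have o: "(0,0) \<in> dec c" using c zero_inner by (simp add: dec_def idx_centre)
  have con: "\<not> asleep_code L M M c \<longleftrightarrow> dec c \<in> configs_2REG"
  proof
    assume "\<not> asleep_code L M M c"
    then have "\<forall>p\<in>dec c. p \<in> nball (dec c) (0,0) M" unfolding asleep_code_iff[OF c] using hist_awake[OF o] by blast
    then show "dec c \<in> configs_2REG" unfolding configs_2REG_iff using o finite_subset[OF dec_inner finite_inner] by blast
  next
    assume "dec c \<in> configs_2REG"
    then show "\<not> asleep_code L M M c" unfolding asleep_code_iff[OF c] using linked_all_awake[OF _ dec_inner] by blast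
  qed
  have d: "deg_code L c (idx p) = deg (dec c) p" if "p \<in> dec c" for p
    using deg_code_eq[OF c(1)] that dec_inner by blast
  have d0: "deg_code L c (centre L) = deg (dec c) (0,0)" using d[OF o] by (simp add: idx_centre)
  show ?thesis
    unfolding valid_code_def con inn_def[symmetric] all_index_dec[OF c(1)] ex_index_dec[OF c(1)] gamma_def d0
    using c d by auto
qed

lemma valid_codeD:
  assumes "valid_code g L M c"
  shows "inn c" "bit c (centre L)" "dec c \<in> gamma g"
  using assms valid_code_iff[of g c] by (auto simp: valid_code_def)

text \<open>Walks and chains correspond in both directions: from a valid code a proper step leads
  only to valid codes, and each configuration within \<open>inner\<close> has a code below
  \<open>2^M\<close>.\<close>

lemma good_code_iff:
  assumes c: "valid_code g L M c" "c < 2^M"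
  shows "good_code g L M t c \<longleftrightarrow> good {C \<in> gamma g. C \<subseteq> inner} t (dec c)"
proof -
  let ?D = "{C \<in> gamma g. C \<subseteq> inner}" and ?R = "edges_below (2^M) (step_code g L M t)"
  have refl: "step_code g L M t x x" for x by (simp add: step_code_def)
  have savitch: "savitch (2^M) (step_code g L M t) (2 * M) c v \<longleftrightarrow> (c, v) \<in> ?R\<^sup>*" if "v < 2^M" for v
    by (rule savitch_iff_rtrancl[OF c(2) that refl])
  have down: "valid_code g L M v \<and> (dec c, dec v) \<in> (conf_edges ?D t)\<^sup>*" if "(c, v) \<in> ?R\<^sup>*" for v
    using that
  proof (induction rule: rtrancl_induct)
    case base
    then show ?case using c by simp
  next
    case (step u v)
    show ?case
    proof (cases "u = v")
      case True
      then show ?thesis using step.IH by simp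
    next
      case False
      then have e: "valid_code g L M u" "valid_code g L M v" "edge_code L M t u v"
        using step.hyps(2) unfolding edges_below_def step_code_def by auto
      note vu = valid_codeD[OF e(1)] and vv = valid_codeD[OF e(2)]
      have "(dec u, dec v) \<in> conf_edges ?D t"
        using e(3) vu(3) vv(3) dec_inner unfolding edge_code_iff[OF vu(1,2) vv(1,2)] conf_edges_def by blast
      then show ?thesis using step.IH e(2) by (meson rtrancl.rtrancl_into_rtrancl)
    qed
  qed
  have up: "\<exists>v. v < 2^M \<and> valid_code g L M v \<and> dec v = C' \<and> (c, v) \<in> ?R\<^sup>*" if "(dec c, C') \<in> (conf_edges ?D t)\<^sup>*" for C'
    using that
  proof (induction rule: rtrancl_induct)
    case base
    then show ?case using c by blast
  next
    case (step C1 C2)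
    obtain u where u: "u < 2^M" "valid_code g L M u" "dec u = C1" "(c, u) \<in> ?R\<^sup>*" using step.IH by blast
    have C2: "C2 \<in> gamma g" "C2 \<subseteq> inner" using step.hyps(2) by (auto simp: conf_edges_def)
    let ?v = "code C2"
    have v: "?v < 2^M" "dec ?v = C2" using compr_less dec_code[OF C2(2)] unfolding code_def by auto
    have vv: "valid_code g L M ?v" unfolding valid_code_iff using inn_code[OF C2(2)] v(2) C2(1) by simp
    note du = valid_codeD[OF u(2)] and dv = valid_codeD[OF vv]
    have "edge_code L M t u ?v" unfolding edge_code_iff[OF du(1,2) dv(1,2)] v(2) u(3)
      using step.hyps(2) unfolding conf_edges_def by blast
    then have "(u, ?v) \<in> ?R" unfolding edges_below_def step_code_def using u v vv by blast
    then show ?case using u(4) v vv by (meson rtrancl.rtrancl_into_rtrancl)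
  qed
  have as: "asleep_code L M t v \<longleftrightarrow> (\<exists>p\<in>dec v. hist (dec v) t p = IQ)" if "valid_code g L M v" for v
    using asleep_code_iff valid_codeD[OF that] by blast
  show ?thesis
  proof
    assume g: "good_code g L M t c"
    show "good ?D t (dec c)" unfolding good_def
    proof (intro allI impI ballI notI)
      fix C' p assume C': "(dec c, C') \<in> (conf_edges ?D t)\<^sup>*" "p \<in> C'" "hist C' t p = IQ"
      obtain v where v: "v < 2^M" "valid_code g L M v" "dec v = C'" "(c, v) \<in> ?R\<^sup>*" using up[OF C'(1)] by blast
      have "asleep_code L M t v" unfolding as[OF v(2)] v(3) using C'(2,3) by blast
      then show False using g v(1,4) savitch[OF v(1)] unfolding good_code_def by blast
    qed
  next
    assume g: "good ?D t (dec c)"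
    show "good_code g L M t c" unfolding good_code_def
    proof (rule notI, elim exE conjE)
      fix v assume v: "v < 2^M" "savitch (2^M) (step_code g L M t) (2 * M) c v" "asleep_code L M t v"
      have "valid_code g L M v \<and> (dec c, dec v) \<in> (conf_edges ?D t)\<^sup>*" using down v(2) savitch[OF v(1)] by blast
      then show False using g v(3) as unfolding good_def by blast
    qed
  qed
qed

end

section \<open>Decoding the input\<close>

text \<open>Lengths of bit maps enter as bit lengths of numbers from here on. They are then small
  automatically, and the rules in \<open>PS_intros\<close> need no side condition.\<close>

lemma PS_compr_bl [PS_intros]:
  assumes "PS vs z" "PSP (ext_vars vs) (\<lambda>x. P (fst x) (snd x))"
  shows "PS vs (\<lambda>e. compr (bl (z e)) (\<lambda>i. P i e))"
  by (rule PS_compr[OF PS_bl[OF assms(1)] small_bl[OF assms(1)] assms(2)])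

lemma PS_centre [PS_intros]: "PS vs a \<Longrightarrow> PS vs (\<lambda>e. centre (a e))"
  unfolding centre_def by (intro PS_intros)

lemma PSP_inner_index [PS_intros]: "PS vs a \<Longrightarrow> PS vs b \<Longrightarrow> PSP vs (\<lambda>e. inner_index (a e) (b e))"
  unfolding inner_index_def by (intro PS_intros)

lemma PSP_same_nbrs [PS_intros]:
  "PS vs a \<Longrightarrow> PS vs b \<Longrightarrow> PS vs c \<Longrightarrow> PS vs d \<Longrightarrow> PSP vs (\<lambda>e. same_nbrs (a e) (b e) (c e) (d e))"
  unfolding same_nbrs_def by (intro PS_intros)

lemma PSP_nbrs_in [PS_intros]:
  "PS vs a \<Longrightarrow> PS vs b \<Longrightarrow> PS vs c \<Longrightarrow> PS vs d \<Longrightarrow> PSP vs (\<lambda>e. nbrs_in (a e) (b e) (c e) (d e))"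
  unfolding nbrs_in_def by (intro PS_intros)

lemma PS_deg_code [PS_intros]:
  "PS vs a \<Longrightarrow> PS vs b \<Longrightarrow> PS vs c \<Longrightarrow> PS vs (\<lambda>e. deg_code (a e) (b e) (c e))"
  unfolding deg_code_def by (intro PS_intros)

lemma bl_compr: "bl (compr n P) \<le> n"
  unfolding bl_le_iff by (rule compr_less)

lemma PS_awake_map [PS_intros]:
  "PS vs a \<Longrightarrow> PS vs z \<Longrightarrow> PS vs c \<Longrightarrow> PS vs s \<Longrightarrow> PS vs (\<lambda>e. awake_map (a e) (bl (z e)) (c e) (s e))"
proof (rule PS_comp4[where F="\<lambda>a z c s. awake_map a (bl z) c s"])
  let ?vs = "[\<lambda>x. fst x, \<lambda>x. fst (snd x), \<lambda>x. fst (snd (snd x)), \<lambda>x. snd (snd (snd x))] :: (nat \<times> nat \<times> nat \<times> nat \<Rightarrow> nat) list"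
  let ?h = "\<lambda>x. compr (bl (fst (snd (snd (snd x))))) (\<lambda>i. bit (fst (snd (snd (snd (snd x))))) i \<and>
     (bit (fst (snd x)) i \<or> bit (fst (snd x)) (i + fst (snd (snd x))) \<or>
     bit (fst (snd x)) (i + 1) \<or> bit (fst (snd x)) (i - fst (snd (snd x))) \<or> bit (fst (snd x)) (i - 1)))"
  show "PS ?vs (\<lambda>x. awake_map (fst x) (bl (fst (snd x))) (fst (snd (snd x))) (snd (snd (snd x))))"
  proof (rule PS_rec[where F="\<lambda>i e. awake_map (fst e) (bl (fst (snd e))) (fst (snd (snd e))) i"
        and g="\<lambda>e. compr (bl (fst (snd e))) (\<lambda>i. i = centre (fst e))" and h="?h" and bd="\<lambda>e. bl (fst (snd e))"])
    show "small ?vs (\<lambda>e. bl (fst (snd e)))" by (intro small_bl PS_var) simp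
    show "bl (awake_map (fst e) (bl (fst (snd e))) (fst (snd (snd e))) i) \<le> bl (fst (snd e))" for i and e :: "nat \<times> nat \<times> nat \<times> nat"
      by (cases i) (simp_all add: bl_compr)
    show "PS ((\<lambda>x. fst x) # (\<lambda>x. fst (snd x)) # map (\<lambda>v x. v (snd (snd x))) ?vs) ?h"
      by ((rule PS_var, (simp; fail)) | rule PS_intros)+
  qed (((rule PS_var, (simp; fail)) | rule PS_intros | simp)+)
qed auto

lemma PS_agree_map [PS_intros]:
  "PS vs a \<Longrightarrow> PS vs z \<Longrightarrow> PS vs c \<Longrightarrow> PS vs d \<Longrightarrow> PS vs s \<Longrightarrow> PS vs (\<lambda>e. agree_map (a e) (bl (z e)) (c e) (d e) (s e))"
proof (rule PS_comp5[where F="\<lambda>a z c d s. agree_map a (bl z) c d s"])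
  let ?vs = "[\<lambda>x. fst x, \<lambda>x. fst (snd x), \<lambda>x. fst (snd (snd x)), \<lambda>x. fst (snd (snd (snd x))), \<lambda>x. snd (snd (snd (snd x)))] :: (nat \<times> nat \<times> nat \<times> nat \<times> nat \<Rightarrow> nat) list"
  let ?a = "\<lambda>x. fst (snd (snd x))" and ?z = "\<lambda>x. fst (snd (snd (snd x)))" and ?c = "\<lambda>x. fst (snd (snd (snd (snd x))))"
    and ?d = "\<lambda>x. fst (snd (snd (snd (snd (snd x)))))"
  let ?g = "\<lambda>e. compr (bl (fst (snd e))) (\<lambda>i. bit (fst (snd (snd e))) i \<and> bit (fst (snd (snd (snd e)))) i \<and>
    (i = centre (fst e) \<longrightarrow> same_nbrs (fst e) (fst (snd (snd e))) (fst (snd (snd (snd e)))) i))"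
  let ?h = "\<lambda>x. compr (bl (?z x)) (\<lambda>i. bit (?c x) i \<and> bit (?d x) i \<and>
     (\<not> bit (awake_map (?a x) (bl (?z x)) (?c x) (Suc (fst x))) i \<and> \<not> bit (awake_map (?a x) (bl (?z x)) (?d x) (Suc (fst x))) i \<or>
      bit (fst (snd x)) i \<and> same_nbrs (?a x) (?c x) (?d x) i \<and> nbrs_in (?a x) (?c x) (fst (snd x)) i))"
  show "PS ?vs (\<lambda>x. agree_map (fst x) (bl (fst (snd x))) (fst (snd (snd x))) (fst (snd (snd (snd x)))) (snd (snd (snd (snd x)))))"
  proof (rule PS_rec[where F="\<lambda>i e. agree_map (fst e) (bl (fst (snd e))) (fst (snd (snd e))) (fst (snd (snd (snd e)))) i"
        and g="?g" and h="?h" and bd="\<lambda>e. bl (fst (snd e))"])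
    show "small ?vs (\<lambda>e. bl (fst (snd e)))" by (intro small_bl PS_var) simp
    show "bl (agree_map (fst e) (bl (fst (snd e))) (fst (snd (snd e))) (fst (snd (snd (snd e)))) i) \<le> bl (fst (snd e))"
      for i and e :: "nat \<times> nat \<times> nat \<times> nat \<times> nat"
      by (cases i) (simp_all add: bl_compr)
    show "PS ((\<lambda>x. fst x) # (\<lambda>x. fst (snd x)) # map (\<lambda>v x. v (snd (snd x))) ?vs) ?h"
      by ((rule PS_var, (simp; fail)) | rule PS_intros)+
    show "PS ?vs ?g" by ((rule PS_var, (simp; fail)) | rule PS_intros)+
    show "PS ?vs (\<lambda>e. snd (snd (snd (snd e))))" by (rule PS_var) simp
  qed simp_all
qed auto

lemma PSP_edge_code [PS_intros]:
  "PS vs a \<Longrightarrow> PS vs z \<Longrightarrow> PS vs t \<Longrightarrow> PS vs c \<Longrightarrow> PS vs d \<Longrightarrow> PSP vs (\<lambda>e. edge_code (a e) (bl (z e)) (t e) (c e) (d e))"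
  by (rule PSP_comp5[where F="\<lambda>a z t c d. edge_code a (bl z) t c d"], unfold edge_code_def)
    (((rule PS_var, (simp; fail)) | rule PS_intros | assumption)+)

lemma PSP_asleep_code [PS_intros]:
  "PS vs a \<Longrightarrow> PS vs z \<Longrightarrow> PS vs t \<Longrightarrow> PS vs c \<Longrightarrow> PSP vs (\<lambda>e. asleep_code (a e) (bl (z e)) (t e) (c e))"
  by (rule PSP_comp4[where F="\<lambda>a z t c. asleep_code a (bl z) t c"], unfold asleep_code_def)
    (((rule PS_var, (simp; fail)) | rule PS_intros | assumption)+)

lemma PSP_valid_code [PS_intros]:
  "PS vs a \<Longrightarrow> PS vs z \<Longrightarrow> PS vs c \<Longrightarrow> PSP vs (\<lambda>e. valid_code g (a e) (bl (z e)) (c e))"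
  by (rule PSP_comp3[where F="\<lambda>a z c. valid_code g a (bl z) c"], unfold valid_code_def)
    (((rule PS_var, (simp; fail)) | rule PSP_const PS_intros | assumption)+)

lemma PSP_good_code [PS_intros]:
  "PS vs a \<Longrightarrow> PS vs z \<Longrightarrow> PS vs t \<Longrightarrow> PS vs c \<Longrightarrow> PSP vs (\<lambda>e. good_code g (a e) (bl (z e)) (t e) (c e))"
proof (rule PSP_comp4[where F="\<lambda>a z t c. good_code g a (bl z) t c"])
  let ?vs = "[\<lambda>x. fst x, \<lambda>x. fst (snd x), \<lambda>x. fst (snd (snd x)), \<lambda>x. snd (snd (snd x))] :: (nat \<times> nat \<times> nat \<times> nat \<Rightarrow> nat) list"
  have z: "PS ?vs (\<lambda>x. fst (snd x))" by (rule PS_var) simp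
  have z': "PS (ext_vars ?vs) (\<lambda>x. fst (snd (snd x)))" by (rule PS_var) simp
  have p: "PS ?vs (\<lambda>x. 2 ^ bl (fst (snd x)))" by (intro PS_power2 PS_bl small_bl z)
  have E: "PSP (ext_vars (ext_vars (ext_vars ?vs))) (\<lambda>x. step_code g (fst (snd (snd (snd x)))) (bl (fst (snd (snd (snd (snd x))))))
      (fst (snd (snd (snd (snd (snd x)))))) (fst (snd x)) (fst x))"
    unfolding step_code_def by ((rule PS_var, (simp; fail)) | rule PS_intros)+
  have m: "PS (ext_vars ?vs) (\<lambda>x. bl (fst (snd (snd x))))" "small (ext_vars ?vs) (\<lambda>x. bl (fst (snd (snd x))))"
    "PS (ext_vars ?vs) (\<lambda>x. 2 * bl (fst (snd (snd x))))" "small (ext_vars ?vs) (\<lambda>x. 2 * bl (fst (snd (snd x))))"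
    by (intro PS_bl small_bl small_mult small_const PS_mult PS_const z')+
  have u: "PS (ext_vars ?vs) (\<lambda>x. snd (snd (snd (snd x))))" and v: "PS (ext_vars ?vs) (\<lambda>x. fst x)"
    by (rule PS_var, simp)+
  have savitch: "PSP (ext_vars ?vs) (\<lambda>x. savitch (2 ^ bl (fst (snd (snd x)))) (step_code g (fst (snd x)) (bl (fst (snd (snd x)))) (fst (snd (snd (snd x)))))
      (2 * bl (fst (snd (snd x)))) (snd (snd (snd (snd x)))) (fst x))"
    by (rule PSP_savitch[OF m(1) m(2) m(3) m(4) u v E])
  have as: "PSP (ext_vars ?vs) (\<lambda>x. asleep_code (fst (snd x)) (bl (fst (snd (snd x)))) (fst (snd (snd (snd x)))) (fst x))"
    by (rule PSP_asleep_code; rule PS_var, simp)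
  show "PSP ?vs (\<lambda>x. good_code g (fst x) (bl (fst (snd x))) (fst (snd (snd x))) (snd (snd (snd x))))"
    unfolding good_code_def by (rule PSP_not, rule PSP_ex, rule p, rule PSP_conj, rule savitch, rule as)
qed auto

section \<open>Parsing an encoded configuration and printing a number\<close>

definition symbol_at :: "nat \<Rightarrow> nat \<Rightarrow> nat" where
  "symbol_at w i = of_bool (bit w (3 * i)) + 2 * of_bool (bit w (3 * i + 1)) + 4 * of_bool (bit w (3 * i + 2))"

text \<open>The three input registers are merged so that symbol i occupies bits 3 * i to 3 * i + 2.\<close>

definition interleave :: "nat \<Rightarrow> nat \<Rightarrow> nat \<Rightarrow> nat" where
  "interleave a b c = compr (3 * (bl a + bl b + bl c))
     (\<lambda>k. k mod 3 = 0 \<and> bit a (k div 3) \<or> k mod 3 = 1 \<and> bit b (k div 3) \<or> k mod 3 = 2 \<and> bit c (k div 3))"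

text \<open>The number 0 is still written with one digit.\<close>

definition bin_len :: "nat \<Rightarrow> nat" where
  "bin_len v = (if bl v = 0 then 1 else bl v)"

definition dist_nat :: "nat \<Rightarrow> nat \<Rightarrow> nat" where
  "dist_nat a b = (a - b) + (b - a)"

text \<open>The number a stands for the integer a - T, as in the cell indices. After the sign come
  the digits, most significant first.\<close>

definition int_at :: "nat \<Rightarrow> nat \<Rightarrow> nat \<Rightarrow> nat \<Rightarrow> bool" where
  "int_at w T a i \<longleftrightarrow> symbol_at w i = (if a < T then 4 else 3) \<and>
     (\<forall>l<bin_len (dist_nat a T). symbol_at w (i + 1 + l) = 1 + of_bool (bit (dist_nat a T) (bin_len (dist_nat a T) - 1 - l)))"

definition block_at :: "nat \<Rightarrow> nat \<Rightarrow> nat \<Rightarrow> nat \<Rightarrow> nat \<Rightarrow> bool" where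
  "block_at w T a b i \<longleftrightarrow> int_at w T a i \<and> symbol_at w (i + 1 + bin_len (dist_nat a T)) = 5 \<and>
     int_at w T b (i + 2 + bin_len (dist_nat a T)) \<and> symbol_at w (i + 3 + bin_len (dist_nat a T) + bin_len (dist_nat b T)) = 6"

text \<open>Occurrences are anchored at block boundaries, that is at the start of the word or after
  a semicolon.\<close>

definition in_word :: "nat \<Rightarrow> nat \<Rightarrow> nat \<Rightarrow> bool" where
  "in_word w L q \<longleftrightarrow> (\<exists>i<bl w. (i = 0 \<or> symbol_at w (i - 1) = 6) \<and> block_at w (L div 2) (q div L) (q mod L) i)"

text \<open>With n = bl w at least the number of positions, times up to 2 * n + 1 matter, and truncation to radius
2 * n + 2 must stay off the border: T = 2 * n + 3 and the side is 2 * T + 1.\<close>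

definition side :: "nat \<Rightarrow> nat" where
  "side w = 4 * bl w + 7"

text \<open>Serves only as a number whose bit length is the number of cells.\<close>

definition full_map :: "nat \<Rightarrow> nat" where
  "full_map w = 2 ^ (side w * side w) - 1"

definition word_map :: "nat \<Rightarrow> nat" where
  "word_map w = compr (bl (full_map w)) (\<lambda>q. in_word w (side w) q)"

definition word_mft :: "nat \<Rightarrow> nat \<Rightarrow> nat" where
  "word_mft g w = bmin (2 * bl w + 2) (\<lambda>t. good_code g (side w) (bl (full_map w)) t (word_map w))"

text \<open>Digit 0 is symbol 1 and digit 1 is symbol 2, so track 1 holds the digits and track 0
  their complements. The order is reversed because the leading digit goes to cell 0.\<close>

definition out_track :: "nat \<Rightarrow> nat \<Rightarrow> nat" where
  "out_track b v = compr (bin_len v) (\<lambda>i. bit v (bin_len v - 1 - i) \<longleftrightarrow> b = 1)"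

lemma PS_symbol_at [PS_intros]: "PS vs a \<Longrightarrow> PS vs b \<Longrightarrow> PS vs (\<lambda>e. symbol_at (a e) (b e))"
  unfolding symbol_at_def by (intro PS_intros)

lemma PS_bin_len [PS_intros]: "PS vs a \<Longrightarrow> PS vs (\<lambda>e. bin_len (a e))"
  unfolding bin_len_def by (intro PS_intros)

lemma PS_dist_nat [PS_intros]: "PS vs a \<Longrightarrow> PS vs b \<Longrightarrow> PS vs (\<lambda>e. dist_nat (a e) (b e))"
  unfolding dist_nat_def by (intro PS_intros)

lemma PSP_int_at [PS_intros]:
  "PS vs a \<Longrightarrow> PS vs b \<Longrightarrow> PS vs c \<Longrightarrow> PS vs d \<Longrightarrow> PSP vs (\<lambda>e. int_at (a e) (b e) (c e) (d e))"
  by (rule PSP_comp4[where F=int_at], unfold int_at_def)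
    (((rule PS_var, (simp; fail)) | rule PS_intros | assumption)+)

lemma PSP_block_at [PS_intros]:
  "PS vs a \<Longrightarrow> PS vs b \<Longrightarrow> PS vs c \<Longrightarrow> PS vs d \<Longrightarrow> PS vs f \<Longrightarrow> PSP vs (\<lambda>e. block_at (a e) (b e) (c e) (d e) (f e))"
  unfolding block_at_def by (intro PS_intros)

lemma PSP_in_word [PS_intros]:
  "PS vs a \<Longrightarrow> PS vs b \<Longrightarrow> PS vs c \<Longrightarrow> PSP vs (\<lambda>e. in_word (a e) (b e) (c e))"
  by (rule PSP_comp3[where F=in_word], unfold in_word_def)
    (((rule PS_var, (simp; fail)) | rule PS_intros | assumption)+)

lemma PS_interleave:
  "PS vs a \<Longrightarrow> PS vs b \<Longrightarrow> PS vs c \<Longrightarrow> PS vs (\<lambda>e. interleave (a e) (b e) (c e))"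
proof (rule PS_comp3[where F=interleave])
  let ?vs = "[\<lambda>x. fst x, \<lambda>x. fst (snd x), \<lambda>x. snd (snd x)] :: (nat \<times> nat \<times> nat \<Rightarrow> nat) list"
  show "PS ?vs (\<lambda>x. interleave (fst x) (fst (snd x)) (snd (snd x)))"
    unfolding interleave_def
    by (rule PS_compr)
      ((rule small_mult small_add small_const small_bl | (rule PS_var, (simp; fail)) | rule PS_intros)+)
qed auto

lemma PS_side [PS_intros]: "PS vs a \<Longrightarrow> PS vs (\<lambda>e. side (a e))"
  unfolding side_def by (intro PS_intros)

lemma PS_full_map [PS_intros]: "PS vs a \<Longrightarrow> PS vs (\<lambda>e. full_map (a e))"
  unfolding full_map_def by (intro PS_diff PS_const PS_power2 PS_mult PS_side small_mult) (simp_all add: side_def small_add small_mult small_const small_bl)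

lemma PS_word_map [PS_intros]: "PS vs a \<Longrightarrow> PS vs (\<lambda>e. word_map (a e))"
  by (rule PS_comp1[where F=word_map], unfold word_map_def)
    (((rule PS_var, (simp; fail)) | rule PS_intros | assumption)+)

lemma PS_word_mft: "PS vs a \<Longrightarrow> PS vs (\<lambda>e. word_mft g (a e))"
  by (rule PS_comp1[where F="word_mft g"], unfold word_mft_def)
    (((rule PS_var, (simp; fail)) | rule PS_intros | assumption)+)

lemma PS_out_track: "PS vs a \<Longrightarrow> PS vs (\<lambda>e. out_track b (a e))"
proof (rule PS_comp1[where F="out_track b"])
  have "small [\<lambda>x. x] bin_len"
    by (rule small_mono[where g="\<lambda>x. bl x + 1"]) (intro small_add small_const small_bl PS_var, auto simp: bin_len_def)
  then show "PS [\<lambda>x. x] (out_track b)"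
    unfolding out_track_def
    by (intro PS_compr) ((assumption | (rule PS_var, (simp; fail)) | rule PSP_const PS_intros)+)
qed auto

section \<open>Correctness of parsing and printing\<close>

lemma bl_div2: "0 < n \<Longrightarrow> bl n = Suc (bl (n div 2))"
proof -
  assume n: "0 < n"
  have "bl n \<le> k \<longleftrightarrow> Suc (bl (n div 2)) \<le> k" for k
  proof (cases k)
    case 0
    then show ?thesis using n bl_le_iff[of n 0] by simp
  next
    case (Suc j)
    then show ?thesis by (auto simp: bl_le_iff)
  qed
  then show ?thesis by (metis le_antisym le_refl)
qed

lemma bin_len_div2: "2 \<le> n \<Longrightarrow> bin_len n = Suc (bin_len (n div 2))"
  using bl_div2[of n] bl_div2[of "n div 2"] by (simp add: bin_len_def)

lemma bin_len_less2: "n < 2 \<Longrightarrow> bin_len n = 1"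
proof -
  assume "n < 2"
  then have "bl n \<le> 1" by (simp add: bl_le_iff)
  then show ?thesis by (simp add: bin_len_def)
qed

lemma length_bin: "length (bin n) = bin_len n"
proof (induction n rule: bin.induct)
  case (1 n)
  then show ?case by (subst bin.simps) (simp add: bin_len_less2 bin_len_div2)
qed

lemma nth_bin: "l < bin_len n \<Longrightarrow> bin n ! l = 1 + of_bool (bit n (bin_len n - 1 - l))"
proof (induction n arbitrary: l rule: bin.induct)
  case (1 n)
  show ?case
  proof (cases "n < 2")
    case True
    then have "n = 0 \<or> n = 1" by linarith
    then show ?thesis using 1(2) True by (subst bin.simps) (auto simp: bin_len_less2 bit_0)
  next
    case False
    let ?h = "n div 2"
    have len: "bin_len n = Suc (bin_len ?h)" using False bin_len_div2[of n] by simp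
    have b: "bin n = bin ?h @ [n mod 2 + 1]" using False by (subst bin.simps) simp
    show ?thesis
    proof (cases "l < bin_len ?h")
      case True
      have "bin n ! l = 1 + of_bool (bit ?h (bin_len ?h - 1 - l))"
        unfolding b using True 1(1)[OF False True] by (simp add: nth_append length_bin)
      moreover have "bin_len n - 1 - l = Suc (bin_len ?h - 1 - l)" using True len by simp
      ultimately show ?thesis by (simp add: bit_Suc)
    next
      case F: False
      then have l: "l = bin_len ?h" using 1(2) len by simp
      then show ?thesis unfolding b len by (simp add: nth_append length_bin bit_0 mod2_eq_if)
    qed
  qed
qed

lemma bit_imp_less_bl: "bit n i \<Longrightarrow> i < bl n"
  using less_power_bl[of n] unfolding less_power2_iff_bit using not_le by blast

lemma bin_inj: "bin m = bin n \<Longrightarrow> m = n"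
proof (rule bit_eqI)
  fix i assume e: "bin m = bin n"
  then have len: "bin_len m = bin_len n" using length_bin by metis
  have le: "bl v \<le> bin_len v" for v by (simp add: bin_len_def)
  show "bit m i \<longleftrightarrow> bit n i"
  proof (cases "i < bin_len n")
    case True
    let ?l = "bin_len n - 1 - i"
    have l: "?l < bin_len n" and i: "bin_len n - 1 - ?l = i" using True by auto
    have "(of_bool (bit m i) :: nat) = of_bool (bit n i)"
      using nth_bin[of ?l m] nth_bin[of ?l n] e l unfolding len i by simp
    then show ?thesis by (simp add: of_bool_eq_iff)
  next
    case False
    then show ?thesis using bit_imp_less_bl[of m i] bit_imp_less_bl[of n i] le[of m] le[of n] len by linarith
  qed
qed

definition block :: "pos \<Rightarrow> nat list" where
  "block p = enc_int (fst p) @ [5] @ enc_int (snd p) @ [6]"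

lemma enc_config_list_block: "enc_config_list xs = concat (map block xs)"
proof -
  have "block = (\<lambda>(x, y). enc_int x @ [5] @ enc_int y @ [6])" by (auto simp: block_def)
  then show ?thesis by (simp add: enc_config_list_def)
qed

lemma bin_set: "set (bin n) \<subseteq> {1, 2}"
proof
  fix a assume "a \<in> set (bin n)"
  then obtain l where "l < bin_len n" "a = bin n ! l" by (auto simp: in_set_conv_nth length_bin)
  then show "a \<in> {1, 2}" using nth_bin[of l n] by (cases "bit n (bin_len n - 1 - l)") simp_all
qed

lemma enc_int_set: "set (enc_int z) \<subseteq> {1, 2, 3, 4}"
  using bin_set[of "nat \<bar>z\<bar>"] by (auto simp: enc_int_def)

lemma enc_int_inj:
  assumes "enc_int x = enc_int y"
  shows "x = y"
proof -
  have "(x < 0 \<longleftrightarrow> y < 0) \<and> bin (nat \<bar>x\<bar>) = bin (nat \<bar>y\<bar>)"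
    using assms by (auto simp: enc_int_def split: if_splits)
  then have "(x < 0 \<longleftrightarrow> y < 0) \<and> nat \<bar>x\<bar> = nat \<bar>y\<bar>" using bin_inj by blast
  then show ?thesis by linarith
qed

lemma separator_unique:
  assumes "us @ a # vs = us' @ a # vs'" "a \<notin> set us" "a \<notin> set us'"
  shows "us = us' \<and> vs = vs'"
proof -
  have t: "takeWhile (\<lambda>x. x \<noteq> a) (us @ a # vs) = us" if "a \<notin> set us" for us vs
    using that by (induction us) auto
  have "us = us'" using t[OF assms(2), of vs] t[OF assms(3), of vs'] assms(1) by simp
  then show ?thesis using assms(1) by simp
qed

text \<open>Comma and semicolon do not occur inside encoded integers, so the first separator
  determines the cut.\<close>

lemma block_prefix:
  assumes "block p @ s = block q @ s'"
  shows "p = q"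
proof -
  have n: "5 \<notin> set (enc_int z)" "6 \<notin> set (enc_int z)" for z using enc_int_set[of z] by auto
  have "enc_int (fst p) @ 5 # (enc_int (snd p) @ 6 # s) = enc_int (fst q) @ 5 # (enc_int (snd q) @ 6 # s')"
    using assms by (simp add: block_def)
  from separator_unique[OF this n(1) n(1)] have 1: "enc_int (fst p) = enc_int (fst q)"
    and "enc_int (snd p) @ 6 # s = enc_int (snd q) @ 6 # s'" by auto
  from separator_unique[OF this(2) n(2) n(2)] have 2: "enc_int (snd p) = enc_int (snd q)" by simp
  show ?thesis using enc_int_inj[OF 1] enc_int_inj[OF 2] by (rule prod_eqI)
qed

lemma block_butlast: "6 \<notin> set (butlast (block p))" "last (block p) = 6" "block p \<noteq> []"
  using enc_int_set[of "fst p"] enc_int_set[of "snd p"] by (auto simp: block_def butlast_append)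

text \<open>A semicolon occurs only as the last symbol of a block, so an occurrence preceded by one
  starts at a block boundary and is then identified by \<open>block_prefix\<close>.\<close>

lemma block_occurs_iff:
  "(\<exists>pre suf. concat (map block xs) = pre @ block p @ suf \<and> (pre = [] \<or> last pre = 6)) \<longleftrightarrow> p \<in> set xs"
proof
  assume "\<exists>pre suf. concat (map block xs) = pre @ block p @ suf \<and> (pre = [] \<or> last pre = 6)"
  then obtain pre suf where "concat (map block xs) = pre @ block p @ suf" "pre = [] \<or> last pre = 6" by blast
  then show "p \<in> set xs"
  proof (induction xs arbitrary: pre)
    case Nil
    then show ?case using block_butlast(3)[of p] by simp
  next
    case (Cons q xs)
    show ?case
    proof (cases "pre = []")
      case True
      then have "block p @ suf = block q @ concat (map block xs)" using Cons.prems(1) by simp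
      then show ?thesis using block_prefix by auto
    next
      case False
      have "pre @ (block p @ suf) = block q @ concat (map block xs)" using Cons.prems(1) by simp
      then obtain us where us: "pre = block q @ us \<and> us @ block p @ suf = concat (map block xs) \<or>
          pre @ us = block q \<and> block p @ suf = us @ concat (map block xs)"
        unfolding append_eq_append_conv2 by blast
      show ?thesis
      proof (cases "us = []")
        case True
        then have "concat (map block xs) = [] @ block p @ suf" using us by auto
        then show ?thesis using Cons.IH[of "[]"] by simp
      next
        case usn: False
        have "pre = block q @ us"
        proof (rule ccontr)
          assume "pre \<noteq> block q @ us"
          then have "pre @ us = block q" using us by blast
          then have "butlast (block q) = pre @ butlast us" using usn by (metis butlast_append)
          then have "last pre \<noteq> 6" using block_butlast(1)[of q] False last_in_set by fastforce
          then show False using Cons.prems(2) False by simp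
        qed
        then have "concat (map block xs) = us @ block p @ suf" "last us = 6" using us Cons.prems(2) usn False by auto
        then show ?thesis using Cons.IH[of us] by simp
      qed
    qed
  qed
next
  assume "p \<in> set xs"
  then obtain ys zs where xs: "xs = ys @ p # zs" by (meson split_list)
  have "concat (map block ys) = [] \<or> last (concat (map block ys)) = 6"
  proof (cases ys rule: rev_cases)
    case (snoc us q)
    then show ?thesis using block_butlast(2,3)[of q] by simp
  qed simp
  then show "\<exists>pre suf. concat (map block xs) = pre @ block p @ suf \<and> (pre = [] \<or> last pre = 6)"
    using xs by (intro exI[of _ "concat (map block ys)"] exI[of _ "concat (map block zs)"]) simp
qed

definition symbols_at :: "nat \<Rightarrow> nat \<Rightarrow> nat list \<Rightarrow> bool" where
  "symbols_at w i u \<longleftrightarrow> (\<forall>l<length u. symbol_at w (i + l) = u ! l)"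

lemma symbols_at_Cons: "symbols_at w i (x # u) \<longleftrightarrow> symbol_at w i = x \<and> symbols_at w (i + 1) u"
  unfolding symbols_at_def by (auto simp: less_Suc_eq_0_disj)

lemma symbols_at_append: "symbols_at w i (u @ v) \<longleftrightarrow> symbols_at w i u \<and> symbols_at w (i + length u) v"
  by (induction u arbitrary: i) (simp_all add: symbols_at_Cons, simp add: symbols_at_def)

lemma symbols_at_Nil: "symbols_at w i []"
  by (simp add: symbols_at_def)

lemma int_at_iff: "int_at w T a i \<longleftrightarrow> symbols_at w i (enc_int (int a - int T))"
proof -
  have "nat \<bar>int a - int T\<bar> = dist_nat a T" by (auto simp: dist_nat_def)
  moreover have "int a - int T < 0 \<longleftrightarrow> a < T" by auto
  ultimately show ?thesis
    unfolding int_at_def enc_int_def symbols_at_Cons by (auto simp: symbols_at_def length_bin nth_bin)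
qed

lemma length_enc_int: "length (enc_int (int a - int T)) = 1 + bin_len (dist_nat a T)"
proof -
  have "nat \<bar>int a - int T\<bar> = dist_nat a T" by (auto simp: dist_nat_def)
  then show ?thesis by (simp add: enc_int_def length_bin)
qed

lemma block_at_iff: "block_at w T a b i \<longleftrightarrow> symbols_at w i (block (int a - int T, int b - int T))"
  unfolding block_at_def int_at_iff block_def symbols_at_append symbols_at_Cons fst_conv snd_conv length_enc_int
  by (simp add: symbols_at_Nil symbols_at_Cons add_ac numeral_3_eq_3)

lemma symbol_bits: "a < 8 \<Longrightarrow> of_bool (bit a 0) + 2 * of_bool (bit a 1) + 4 * of_bool (bit a 2) = (a::nat)"
proof -
  assume "a < 8"
  then have "a = 0 \<or> a = 1 \<or> a = 2 \<or> a = 3 \<or> a = 4 \<or> a = 5 \<or> a = 6 \<or> a = 7" by linarith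
  then show ?thesis by (elim disjE) (simp_all add: bit_iff_odd)
qed

definition word_num :: "nat list \<Rightarrow> nat" where
  "word_num w = interleave (track w 0) (track w 1) (track w 2)"

lemma bit_word_num:
  assumes "j < 3"
  shows "bit (word_num w) (3 * i + j) \<longleftrightarrow> bit (track w j) i"
proof -
  have dm: "(3 * i + j) mod 3 = j" "(3 * i + j) div 3 = i" using assms by simp_all
  let ?n = "bl (track w 0) + bl (track w 1) + bl (track w 2)"
  have lt: "3 * i + j < 3 * ?n" if "bit (track w j) i"
  proof -
    have "bl (track w j) \<le> ?n" using assms by (auto simp: less_Suc_eq numeral_eq_Suc)
    then have "i < ?n" using bit_imp_less_bl[OF that] by (rule less_le_trans[rotated])
    then have "3 * i + 3 \<le> 3 * ?n" by simp
    then show ?thesis using assms by linarith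
  qed
  have "bit (word_num w) (3 * i + j) \<longleftrightarrow> 3 * i + j < 3 * ?n \<and>
    (j = 0 \<and> bit (track w 0) i \<or> j = 1 \<and> bit (track w 1) i \<or> j = 2 \<and> bit (track w 2) i)"
    unfolding word_num_def interleave_def bit_compr dm by blast
  also have "\<dots> \<longleftrightarrow> bit (track w j) i"
  proof -
    have "j = 0 \<or> j = 1 \<or> j = 2" using assms by linarith
    then show ?thesis using lt by auto
  qed
  finally show ?thesis .
qed

lemma symbol_at_word_num:
  assumes "\<forall>a\<in>set w. a < 8"
  shows "symbol_at (word_num w) i = (if i < length w then w ! i else 0)"
proof -
  have e: "symbol_at (word_num w) i = of_bool (bit (track w 0) i) + 2 * of_bool (bit (track w 1) i) + 4 * of_bool (bit (track w 2) i)"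
    unfolding symbol_at_def using bit_word_num[of 0 w i] bit_word_num[of 1 w i] bit_word_num[of 2 w i] by simp
  show ?thesis
  proof (cases "i < length w")
    case True
    then have "w ! i < 8" using assms by simp
    then show ?thesis unfolding e bit_track using True symbol_bits by simp
  next
    case False
    then show ?thesis unfolding e bit_track by simp
  qed
qed

lemma length_le_bl_word_num:
  assumes "\<forall>a\<in>set w. 0 < a \<and> a < 8"
  shows "length w \<le> bl (word_num w)"
proof (cases "w = []")
  case False
  let ?i = "length w - 1"
  have i: "?i < length w" using False by simp
  then have "symbol_at (word_num w) ?i \<noteq> 0" using assms symbol_at_word_num[of w ?i] by simp
  then have "bit (word_num w) (3 * ?i) \<or> bit (word_num w) (3 * ?i + 1) \<or> bit (word_num w) (3 * ?i + 2)"
    unfolding symbol_at_def by (rule contrapos_np) simp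
  then obtain j where "bit (word_num w) (3 * ?i + j)" by (metis add_0_right)
  then have "3 * ?i + j < bl (word_num w)" by (rule bit_imp_less_bl)
  then show ?thesis by linarith
qed simp

text \<open>Beyond the end of the word all symbols read as 0, so a match of a pattern without zeros
  cannot run over the end.\<close>

lemma symbols_at_word_num:
  assumes w: "\<forall>a\<in>set w. a < 8" and u: "u \<noteq> []" "0 \<notin> set u"
  shows "symbols_at (word_num w) i u \<longleftrightarrow> (\<exists>pre suf. w = pre @ u @ suf \<and> length pre = i)"
proof
  assume a: "symbols_at (word_num w) i u"
  have n: "i + l < length w \<and> w ! (i + l) = u ! l" if "l < length u" for l
  proof -
    have "symbol_at (word_num w) (i + l) = u ! l" using a that by (simp add: symbols_at_def)
    moreover have "u ! l \<noteq> 0" using u(2) that nth_mem by metis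
    ultimately show ?thesis using symbol_at_word_num[OF w, of "i + l"] by (auto split: if_splits)
  qed
  have "length u - 1 < length u" using u(1) by simp
  then have le: "i + length u \<le> length w" using n[of "length u - 1"] by linarith
  have "take (length u) (drop i w) = u"
    by (rule nth_equalityI) (use le n in auto)
  then have "w = take i w @ u @ drop (length u) (drop i w)" by (metis append_take_drop_id)
  moreover have "length (take i w) = i" using le by simp
  ultimately show "\<exists>pre suf. w = pre @ u @ suf \<and> length pre = i" by blast
next
  assume "\<exists>pre suf. w = pre @ u @ suf \<and> length pre = i"
  then obtain pre suf where "w = pre @ u @ suf" "length pre = i" by blast
  then have "i + l < length w \<and> w ! (i + l) = u ! l" if "l < length u" for l
    using that by (auto simp: nth_append)
  then show "symbols_at (word_num w) i u" unfolding symbols_at_def using symbol_at_word_num[OF w] by simp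
qed

lemma enc_config_list_symbols: "\<forall>a\<in>set (enc_config_list xs). 0 < a \<and> a < 8"
proof -
  have "\<forall>a\<in>set (block p). 0 < a \<and> a < 8" for p
    using enc_int_set[of "fst p"] enc_int_set[of "snd p"] by (auto simp: block_def)
  then show ?thesis unfolding enc_config_list_block by auto
qed

lemma in_word_iff:
  assumes w: "w = enc_config_list xs" and L: "L = 2 * T + 1"
  shows "in_word (word_num w) L q \<longleftrightarrow> (int (q div L) - int T, int (q mod L) - int T) \<in> set xs"
proof -
  let ?p = "(int (q div L) - int T, int (q mod L) - int T)"
  have s: "\<forall>a\<in>set w. 0 < a \<and> a < 8" using enc_config_list_symbols w by simp
  then have s8: "\<forall>a\<in>set w. a < 8" by blast
  have b: "block ?p \<noteq> []" "0 \<notin> set (block ?p)"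
    using block_butlast(3) enc_int_set[of "fst ?p"] enc_int_set[of "snd ?p"] by (auto simp: block_def)
  have L2: "L div 2 = T" using L by simp
  have "in_word (word_num w) L q \<longleftrightarrow> (\<exists>i<bl (word_num w). (i = 0 \<or> symbol_at (word_num w) (i - 1) = 6) \<and>
      (\<exists>pre suf. w = pre @ block ?p @ suf \<and> length pre = i))"
    unfolding in_word_def block_at_iff L2 symbols_at_word_num[OF s8 b] by blast
  also have "\<dots> \<longleftrightarrow> (\<exists>pre suf. w = pre @ block ?p @ suf \<and> (pre = [] \<or> last pre = 6))"
  proof
    assume "\<exists>i<bl (word_num w). (i = 0 \<or> symbol_at (word_num w) (i - 1) = 6) \<and> (\<exists>pre suf. w = pre @ block ?p @ suf \<and> length pre = i)"
    then obtain pre suf where p: "w = pre @ block ?p @ suf" "length pre = 0 \<or> symbol_at (word_num w) (length pre - 1) = 6" by blast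
    have "last pre = 6" if ne: "pre \<noteq> []"
    proof -
      have "w ! (length pre - 1) = last pre" using p(1) ne by (simp add: nth_append last_conv_nth)
      moreover have "length pre - 1 < length w" using p(1) ne by (cases pre) simp_all
      ultimately show ?thesis using p(2) ne symbol_at_word_num[OF s8, of "length pre - 1"] by simp
    qed
    then show "\<exists>pre suf. w = pre @ block ?p @ suf \<and> (pre = [] \<or> last pre = 6)" using p(1) by blast
  next
    assume "\<exists>pre suf. w = pre @ block ?p @ suf \<and> (pre = [] \<or> last pre = 6)"
    then obtain pre suf where p: "w = pre @ block ?p @ suf" "pre = [] \<or> last pre = 6" by blast
    have "length pre < length w" using p(1) b(1) by simp
    then have l: "length pre < bl (word_num w)" using length_le_bl_word_num[OF s] by linarith
    have "symbol_at (word_num w) (length pre - 1) = 6" if ne: "pre \<noteq> []"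
    proof -
      have "w ! (length pre - 1) = last pre" using p(1) ne by (simp add: nth_append last_conv_nth)
      moreover have "length pre - 1 < length w" using p(1) ne by (cases pre) simp_all
      ultimately show ?thesis using p(2) ne symbol_at_word_num[OF s8, of "length pre - 1"] by simp
    qed
    then show "\<exists>i<bl (word_num w). (i = 0 \<or> symbol_at (word_num w) (i - 1) = 6) \<and> (\<exists>pre suf. w = pre @ block ?p @ suf \<and> length pre = i)"
      using p(1) l by (intro exI[of _ "length pre"]) auto
  qed
  also have "\<dots> \<longleftrightarrow> ?p \<in> set xs" unfolding w enc_config_list_block by (rule block_occurs_iff)
  finally show ?thesis .
qed

section \<open>From the input word to the minimum firing time\<close>

lemma nball_coords: "p \<in> nball C (0,0) s \<Longrightarrow> \<bar>fst p\<bar> \<le> int s \<and> \<bar>snd p\<bar> \<le> int s"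
proof (induction s arbitrary: p)
  case (Suc s)
  show ?case
  proof (cases "p \<in> nball C (0,0) s")
    case True
    then show ?thesis using Suc.IH[OF True] by auto
  next
    case False
    then obtain i where "i < 4" "shift p i \<in> nball C (0,0) s" using Suc.prems by auto
    then show ?thesis using Suc.IH[of "shift p i"] by (auto simp: less_4_iff shift_def eps_def)
  qed
qed simp

lemma length_enc_config_list: "length xs \<le> length (enc_config_list xs)"
  unfolding enc_config_list_block
proof (induction xs)
  case (Cons p xs)
  have "0 < length (block p)" using block_butlast(3)[of p] by simp
  moreover have "length (concat (map block (p # xs))) = length (block p) + length (concat (map block xs))" by simp
  ultimately show ?case using Cons by (simp only: list.size)
qed simp

lemma bl_full_map: "bl (full_map w) = side w * side w"
proof -
  have "bl (2 ^ m - 1) \<le> k \<longleftrightarrow> m \<le> k" for m k :: nat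
  proof -
    have "(2::nat) ^ m - 1 < 2 ^ k \<longleftrightarrow> (2::nat) ^ m \<le> 2 ^ k" by (metis Suc_pred' less_Suc_eq_le not_less_eq zero_less_power zero_less_numeral One_nat_def Suc_le_eq)
    also have "\<dots> \<longleftrightarrow> m \<le> k" by simp
    finally show ?thesis unfolding bl_le_iff .
  qed
  then show ?thesis unfolding full_map_def by (metis le_antisym le_refl)
qed

lemma word_mft_eq:
  assumes sol: "is_solution (gamma g) A" and C: "C \<in> gamma g" and w: "w \<in> config_encodings C"
  shows "word_mft g (word_num w) = mft (gamma g) C"
proof -
  obtain xs where xs: "w = enc_config_list xs" "distinct xs" "set xs = C" using w by (auto simp: config_encodings_def)
  define n where "n = bl (word_num w)"
  define T where "T = 2 * n + 3"
  interpret grid T by unfold_locales (simp add: T_def)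
  have C2: "C \<in> configs_2REG" using C gamma_sub by blast
  then have fin: "finite C" "(0,0) \<in> C" and l: "linked C" using configs_2REG_linked by (auto simp: configs_2REG_iff)
  have "\<forall>a\<in>set w. 0 < a \<and> a < 8" using xs(1) enc_config_list_symbols by simp
  then have "length w \<le> n" unfolding n_def by (rule length_le_bl_word_num)
  moreover have "card C \<le> length w" using length_enc_config_list[of xs] distinct_card[OF xs(2)] xs(1,3) by simp
  ultimately have cn: "card C \<le> n" by linarith
  have small_inner: "nball C' (0,0) s \<subseteq> inner" if "s < T" for C' s
    using nball_coords[of _ C' s] that unfolding inner_def by fastforce
  have Cin: "C \<subseteq> inner"
    using nball_card[OF fin(1) l fin(2)] small_inner[of "card C" C] cn by (simp add: T_def)
  have "side (word_num w) = 2 * T + 1" by (simp add: side_def n_def T_def)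
  then have sd: "side (word_num w) = L" by (simp only: L_def)
  have m: "bl (full_map (word_num w)) = M" unfolding bl_full_map sd M_def ..
  have wm: "word_map (word_num w) = code C"
  proof (rule bit_eqI)
    fix q
    have "bit (word_map (word_num w)) q \<longleftrightarrow> q < M \<and> (int (q div L) - int T, int (q mod L) - int T) \<in> C"
      unfolding word_map_def bit_compr m sd in_word_iff[OF xs(1) L_def] xs(3) ..
    also have "\<dots> \<longleftrightarrow> q < M \<and> (\<exists>p\<in>C. idx p = q)"
    proof -
      have "idx (int (q div L) - int T, int (q mod L) - int T) = q" by (simp add: idx_def)
      moreover have "(int (q div L) - int T, int (q mod L) - int T) = p" if p: "p \<in> C" "idx p = q" for p
      proof -
        have pb: "p \<in> box" using p(1) Cin inner_box by blast
        then have "- int T \<le> fst p" "- int T \<le> snd p" by (auto simp: box_def)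
        then show ?thesis using idx_div[OF pb] idx_mod[OF pb] p(2) by (intro prod_eqI) simp_all
      qed
      ultimately show ?thesis by metis
    qed
    also have "\<dots> \<longleftrightarrow> bit (code C) q" by (simp add: code_def bit_compr)
    finally show "bit (word_map (word_num w)) q \<longleftrightarrow> bit (code C) q" .
  qed
  have vc: "valid_code g L M (code C)" unfolding valid_code_iff using inn_code[OF Cin] dec_code[OF Cin] C by simp
  have lt: "code C < 2 ^ M" unfolding code_def by (rule compr_less)
  \<comment> \<open>For t at most 2 * n + 1 the radius t + 1 is less than T, so truncated
    configurations lie in \<open>inner\<close> and the restriction to \<open>?D\<close> is
    justified.\<close>
  let ?D = "{C \<in> gamma g. C \<subseteq> inner}"
  have gc: "good_code g L M t (code C) \<longleftrightarrow> good (gamma g) t C" if "t < 2 * n + 2" for t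
  proof -
    have "good (gamma g) t C \<longleftrightarrow> good ?D t C"
    proof (rule good_restrict[OF gamma_sub nball_in_gamma])
      fix C' assume C': "C' \<in> gamma g"
      have "Suc t < T" using that by (simp add: T_def)
      then show "nball C' (0,0) (Suc t) \<in> ?D" using small_inner nball_in_gamma[OF C'] by blast
    qed (use C Cin in blast)+
    then show ?thesis using good_code_iff[OF vc lt] dec_code[OF Cin] by simp
  qed
  have gl: "good (gamma g) (2 * n + 1) C" by (rule good_large[OF gamma_sub C]) (use cn in simp)
  have "word_mft g (word_num w) = bmin (2 * n + 2) (\<lambda>t. good_code g L M t (code C))"
    unfolding word_mft_def sd m wm n_def ..
  also have "\<dots> = (LEAST t. good_code g L M t (code C))"
    by (rule bmin_eq_Least, rule exI[of _ "2 * n + 1"]) (use gc[of "2 * n + 1"] gl in simp)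
  also have "\<dots> = (LEAST t. good (gamma g) t C)"
  proof (rule Least_equality)
    let ?m = "LEAST t. good (gamma g) t C"
    have "?m \<le> 2 * n + 1" using gl by (rule Least_le)
    moreover have "good (gamma g) ?m C" using gl by (rule LeastI)
    ultimately show "good_code g L M ?m (code C)" using gc[of ?m] by simp
    fix y assume y: "good_code g L M y (code C)"
    show "?m \<le> y"
    proof (cases "y < 2 * n + 2")
      case True
      then show ?thesis using gc y Least_le[of "\<lambda>t. good (gamma g) t C" y] by blast
    next
      case False
      then show ?thesis using \<open>?m \<le> 2 * n + 1\<close> by linarith
    qed
  qed
  also have "\<dots> = mft (gamma g) C" by (rule mft_eq_Least_good[OF sol C, symmetric]) (use fin in blast)
  finally show ?thesis .
qed

lemma out_track_eq: "b < 2 \<Longrightarrow> out_track b v = track (bin v) b"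
proof (rule bit_eqI)
  fix i assume "b < 2"
  then have b: "b = 0 \<or> b = 1" by linarith
  show "bit (out_track b v) i \<longleftrightarrow> bit (track (bin v) b) i"
  proof (cases "i < bin_len v")
    case True
    show ?thesis unfolding out_track_def bit_compr bit_track length_bin nth_bin[OF True]
      using b True by (cases "bit v (bin_len v - 1 - i)") (auto simp: bit_iff_odd)
  next
    case False
    then show ?thesis unfolding out_track_def bit_compr bit_track length_bin by simp
  qed
qed

lemma pspace_computable_by_PS:
  assumes F: "PS [\<lambda>x. x] F"
    and w: "\<And>x w. x \<in> D \<Longrightarrow> w \<in> enc x \<Longrightarrow> w \<noteq> [] \<and> (\<forall>a\<in>set w. 0 < a \<and> a < 8)"
    and f: "\<And>x w. x \<in> D \<Longrightarrow> w \<in> enc x \<Longrightarrow> F (word_num w) = f x"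
  shows "pspace_computable D enc f"
proof -
  let ?vs = "[\<lambda>x. fst x, \<lambda>x. fst (snd x), \<lambda>x. snd (snd x)] :: (nat \<times> nat \<times> nat \<Rightarrow> nat) list"
  let ?G = "\<lambda>b e. out_track b (F (interleave (fst e) (fst (snd e)) (snd (snd e))))"
  have G: "PS ?vs (?G b)" for b
    by (intro PS_out_track PS_comp1[OF F] PS_interleave; rule PS_var, simp)
  obtain k0 where k0: "\<And>k' rs q b. k0 \<le> k' \<Longrightarrow> length rs = length ?vs \<Longrightarrow> (\<And>r. r \<in> set rs \<Longrightarrow> r < b) \<Longrightarrow> q < b \<Longrightarrow>
     \<exists>P. computes k' ?vs (?G 0) rs q b P" by (rule PS_D[OF G[of 0]]) blast
  obtain k1 where k1: "\<And>k' rs q b. k1 \<le> k' \<Longrightarrow> length rs = length ?vs \<Longrightarrow> (\<And>r. r \<in> set rs \<Longrightarrow> r < b) \<Longrightarrow> q < b \<Longrightarrow>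
     \<exists>P. computes k' ?vs (?G 1) rs q b P" by (rule PS_D[OF G[of 1]]) blast
  define k where "k = k0 + k1 + 1"
  have rs: "length [0, 1, 2::nat] = length ?vs" "\<And>r. r \<in> set [0, 1, 2::nat] \<Longrightarrow> r < 4" by auto
  have "k0 \<le> k" "k1 \<le> k" "0 < k" by (simp_all add: k_def)
  \<comment> \<open>The first output track is kept in register 3, because the second computation
    still reads registers 0 to 2. The second may overwrite its argument register 1, and register 3
    is then moved to 0.\<close>
  obtain P0 where P0: "computes k ?vs (?G 0) [0, 1, 2] 3 4 P0" using k0[OF \<open>k0 \<le> k\<close> rs, of 3] by auto
  obtain P1 where P1: "computes k ?vs (?G 1) [0, 1, 2] 1 4 P1" using k1[OF \<open>k1 \<le> k\<close> rs, of 1] by auto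
  show ?thesis
  proof (rule pspace_computable_by_program[where c="3 ^ k" and k=k and p="P0 @ P1 @ copy 3 0 4", OF w])
    fix x u assume xu: "x \<in> D" "u \<in> enc x"
    let ?e = "(track u 0, track u 1, track u 2)" and ?s = "input_regs u" and ?B = "2 ^ (3 ^ k * (length u + 1) ^ k) :: nat"
    have tl: "bl (track u j) \<le> length u" for j using track_less by (simp add: bl_le_iff)
    \<comment> \<open>Three registers of at most \<open>length u\<close> bits and the constant 2;
      this is the source of the factor \<open>3 ^ k\<close>.\<close>
    have "env_size ?vs ?e \<le> 3 * (length u + 1)"
      using tl[of 0] tl[of 1] tl[of 2] by (simp add: env_size_def)
    then have "env_size ?vs ?e ^ k \<le> (3 * (length u + 1)) ^ k" by (rule power_mono) simp
    then have B: "2 ^ (env_size ?vs ?e ^ k) \<le> ?B" unfolding power_mult_distrib by (rule power_increasing) simp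
    have m: "map ?s [0, 1, 2] = map (\<lambda>v. v ?e) ?vs" by (simp add: input_regs_def)
    have 1: "exec ?B P0 ?s (?s(3 := ?G 0 ?e))"
      by (rule computesD[OF P0 m _ B]) (simp add: input_regs_def)
    have lt: "?G 0 ?e < ?B" using exec_bound[OF 1, of 3] by (auto simp: input_regs_def)
    have 2: "exec ?B P1 (?s(3 := ?G 0 ?e)) (?s(3 := ?G 0 ?e, 1 := ?G 1 ?e))"
      by (rule computesD[OF P1 _ _ B]) (use m in \<open>simp_all add: input_regs_def\<close>)
    have 3: "exec ?B (copy 3 0 4) (?s(3 := ?G 0 ?e, 1 := ?G 1 ?e)) (?s(3 := ?G 0 ?e, 1 := ?G 1 ?e, 0 := ?G 0 ?e))"
      using exec_copy[of 3 0 4 "?s(3 := ?G 0 ?e, 1 := ?G 1 ?e)" ?B] lt by (simp add: input_regs_def)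
    have "?G b ?e = track (bin (f x)) b" if "b < 2" for b
      using out_track_eq[OF that] f[OF xu] by (simp add: word_num_def)
    then show "\<exists>s. exec ?B (P0 @ P1 @ copy 3 0 4) (input_regs u) s \<and> s 0 = track (bin (f x)) 0 \<and> s 1 = track (bin (f x)) 1"
      using exec_append[OF 1 exec_append[OF 2 3]]
      by (intro exI[of _ "?s(3 := ?G 0 ?e, 1 := ?G 1 ?e, 0 := ?G 0 ?e)"]) simp
  qed (use \<open>0 < k\<close> in simp_all)
qed

lemma mft_pspace_computable: "pspace_computable (gamma g) config_encodings (mft (gamma g))"
proof -
  have w: "w \<noteq> [] \<and> (\<forall>a\<in>set w. 0 < a \<and> a < 8)" if C: "C \<in> gamma g" "w \<in> config_encodings C" for C w
  proof -
    obtain xs where xs: "w = enc_config_list xs" "set xs = C" using C(2) by (auto simp: config_encodings_def)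
    have "C \<in> configs_2REG" using C(1) gamma_sub by blast
    then have "(0,0) \<in> C" by (simp add: configs_2REG_iff)
    then have "0 < length xs" using xs(2) by auto
    then show ?thesis using length_enc_config_list[of xs] enc_config_list_symbols[of xs] xs(1) by auto
  qed
  show ?thesis
  proof (cases "\<exists>A. is_solution (gamma g) A")
    case True
    then obtain A where A: "is_solution (gamma g) A" ..
    show ?thesis
      by (rule pspace_computable_by_PS[OF PS_word_mft[of _ "\<lambda>x. x" g] w])
        (use word_mft_eq[OF A] in \<open>auto intro: PS_var\<close>)
  next
    case False
    then have "mft (gamma g) C = (LEAST t. False)" for C by (simp add: mft_def)
    then show ?thesis
      by (intro pspace_computable_by_PS[OF PS_const[of _ "LEAST t. False"] w]) auto
  qed
qed

theorem theorem17:
  shows "pspace_computable configs_2REG config_encodings (mft configs_2REG) \<and>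
         pspace_computable configs_g2PATH config_encodings (mft configs_g2PATH) \<and>
         pspace_computable configs_2PATH config_encodings (mft configs_2PATH)"
  using mft_pspace_computable[of 0] mft_pspace_computable[of 1] mft_pspace_computable[of 2]
  unfolding gamma_0 gamma_1 gamma_2 by blast

end
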